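(* Let $\alpha\in(0,1)$, $d\in\mathbb{N}$ and let $D\subset\mathbb{R}^d$ be an open bounded set. Assume that $q:D\to\mathbb{R}$ is Hölder continuous with Hölder exponent $\eta>1-\alpha$, and that either $u$ is nonnegative on $\mathbb{R}^d$ or $\|u\|_\infty=\sup_{x\in\mathbb{R}^d}|u(x)|<\infty$. If $u$ is a weak solution of $$\Delta^{\alpha/2}u+qu=0\quad\text{on }D,$$ then, after a modification on a set of Lebesgue measure zero, $u$ is continuous on $D$ and is a strong solution of $\Delta^{\alpha/2}u+qu=0$ on $D$.
   Context: $\mathcal{L}^1$ denotes the space of Borel functions $f$ on $\mathbb{R}^d$ with $\int_{\mathbb{R}^d}|f(x)|(1+|x|)^{-d-\alpha}\,dx<\infty$. For $f\in\mathcal{L}^1$ and $x\in\mathbb{R}^d$, $$\Delta^{\alpha/2}f(x)=\mathcal{A}(d,-\alpha)\lim_{\varepsilon\downarrow0}\int_{|y-x|>\varepsilon}\frac{f(y)-f(x)}{|y-x|^{d+\alpha}}\,dy$$ whenever the limit exists, where $\mathcal{A}(d,\gamma)=\Gamma((d-\gamma)/2)/(2^\gamma\pi^{d/2}|\Gamma(\gamma/2)|)$. A function $u$ is a weak solution of $\Delta^{\alpha/2}u+qu=0$ on $D$ iff $u\in\mathcal{L}^1$, $uq\in L^1_{\mathrm{loc}}(D)$ and $\int_{\mathbb{R}^d}u(x)\big(\Delta^{\alpha/2}\varphi(x)+q(x)\varphi(x)\big)\,dx=0$ for all $\varphi\in C_c^\infty(D)$ (with $q\varphi=0$ outside $D$).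 It is a strong solution on $D$ iff $u\in\mathcal{L}^1$, $uq\in L^1_{\mathrm{loc}}(D)$ and $\Delta^{\alpha/2}u(x)+q(x)u(x)=0$ holds (with $\Delta^{\alpha/2}u(x)$ well defined pointwise) for every $x\in D$. $q:D\to\mathbb{R}$ is Hölder continuous with exponent $\eta>0$ if there is a constant $C$ with $|q(x)-q(y)|\le C|x-y|^\eta$ for all $x,y\in D$. *)

theory Defs
  imports "HOL-Analysis.Analysis"
begin

definition weighted_L1 :: "real \<Rightarrow> ('a::euclidean_space \<Rightarrow> real) set" where
  "weighted_L1 \<alpha> = {f. f \<in> borel_measurable borel \<and>
     integrable lborel (\<lambda>x. \<bar>f x\<bar> * (1 + norm x) powr (- real DIM('a) - \<alpha>))}"

definition riesz_const :: "nat \<Rightarrow> real \<Rightarrow> real" where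
  "riesz_const d \<gamma> = Gamma ((real d - \<gamma>) / 2) /
     (2 powr \<gamma> * pi powr (real d / 2) * \<bar>Gamma (\<gamma> / 2)\<bar>)"

definition frac_lap_trunc :: "real \<Rightarrow> ('a::euclidean_space \<Rightarrow> real) \<Rightarrow> 'a \<Rightarrow> real \<Rightarrow> real" where
  "frac_lap_trunc \<alpha> f x \<epsilon> =
     (LINT y:{y. norm (y - x) > \<epsilon>}|lborel.
        (f y - f x) / norm (y - x) powr (real DIM('a) + \<alpha>))"

text \<open>For \<open>f\<close> in \<open>weighted_L1 \<alpha>\<close> the truncated integrals converge absolutely. The value
  \<open>frac_lap \<alpha> f x\<close> is meaningful only if \<open>frac_lap_exists \<alpha> f x\<close> holds.\<close>

definition frac_lap_exists :: "real \<Rightarrow> ('a::euclidean_space \<Rightarrow> real) \<Rightarrow> 'a \<Rightarrow> bool" where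
  "frac_lap_exists \<alpha> f x \<longleftrightarrow> (\<exists>l. (frac_lap_trunc \<alpha> f x \<longlongrightarrow> l) (at_right 0))"

definition frac_lap :: "real \<Rightarrow> ('a::euclidean_space \<Rightarrow> real) \<Rightarrow> 'a \<Rightarrow> real" where
  "frac_lap \<alpha> f x = riesz_const DIM('a) (- \<alpha>) * Lim (at_right 0) (frac_lap_trunc \<alpha> f x)"

primrec C_k :: "nat \<Rightarrow> ('a::euclidean_space \<Rightarrow> real) \<Rightarrow> bool" where
  "C_k 0 f \<longleftrightarrow> continuous_on UNIV f"
| "C_k (Suc k) f \<longleftrightarrow> (\<forall>x. f differentiable (at x)) \<and>
     (\<forall>b\<in>Basis. C_k k (\<lambda>x. frechet_derivative f (at x) b))"

text \<open>Elements of \<open>C\<^sub>c\<^sup>\<infinity>(D)\<close>, extended by zero to the whole space.\<close>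

definition test_functions :: "'a::euclidean_space set \<Rightarrow> ('a \<Rightarrow> real) set" where
  "test_functions D = {\<phi>. (\<forall>k. C_k k \<phi>) \<and>
     compact (closure {x. \<phi> x \<noteq> 0}) \<and> closure {x. \<phi> x \<noteq> 0} \<subseteq> D}"

definition L1_loc :: "'a::euclidean_space set \<Rightarrow> ('a \<Rightarrow> real) set" where
  "L1_loc D = {f. \<forall>K. compact K \<and> K \<subseteq> D \<longrightarrow> set_integrable lborel K f}"

text \<open>A function \<open>q : D \<rightarrow> \<real>\<close> is represented by a total function, of which only the values on \<open>D\<close>
  matter: in the weak formulation \<open>\<phi>\<close>, and hence \<open>q \<phi>\<close>, vanishes outside \<open>D\<close>.
  There the integrand is automatically integrable, since \<open>frac_lap \<alpha> \<phi>\<close> is bounded by a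
  multiple of \<open>(1 + |x|)\<^sup>-\<^sup>d\<^sup>-\<^sup>\<alpha>\<close>.\<close>

definition weak_solution ::
  "real \<Rightarrow> ('a::euclidean_space \<Rightarrow> real) \<Rightarrow> 'a set \<Rightarrow> ('a \<Rightarrow> real) \<Rightarrow> bool" where
  "weak_solution \<alpha> q D u \<longleftrightarrow>
     u \<in> weighted_L1 \<alpha> \<and> (\<lambda>x. u x * q x) \<in> L1_loc D \<and>
     (\<forall>\<phi>\<in>test_functions D. (LINT x|lborel. u x * (frac_lap \<alpha> \<phi> x + q x * \<phi> x)) = 0)"

definition strong_solution ::
  "real \<Rightarrow> ('a::euclidean_space \<Rightarrow> real) \<Rightarrow> 'a set \<Rightarrow> ('a \<Rightarrow> real) \<Rightarrow> bool" where
  "strong_solution \<alpha> q D u \<longleftrightarrow>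
     u \<in> weighted_L1 \<alpha> \<and> (\<lambda>x. u x * q x) \<in> L1_loc D \<and>
     (\<forall>x\<in>D. frac_lap_exists \<alpha> u x \<and> frac_lap \<alpha> u x + q x * u x = 0)"

definition holder_continuous_on :: "real \<Rightarrow> 'a::metric_space set \<Rightarrow> ('a \<Rightarrow> real) \<Rightarrow> bool" where
  "holder_continuous_on \<eta> D q \<longleftrightarrow>
     \<eta> > 0 \<and> (\<exists>C. \<forall>x\<in>D. \<forall>y\<in>D. \<bar>q x - q y\<bar> \<le> C * dist x y powr \<eta>)"

end

theory Submission
  imports Defs
begin

text \<open>
  Let \<open>\<theta>\<close> be a smooth radial bump and \<open>\<psi>\<close> its jump integral. By radial symmetry
  \<open>\<phi>\<^sub>S z = - \<integral>\<^sub>0\<^sup>S s\<^sup>d\<^sup>-\<^sup>1 \<psi> (s z) ds\<close> is a constant times minus the integral of \<open>\<psi>\<close> over the ball of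
  radius \<open>S |z|\<close>, divided by \<open>|z|\<^sup>d\<close>. It is nonnegative and \<open>\<phi>\<^sub>S z = S\<^sup>d \<phi>\<^sub>1 (S z)\<close> is an approximate
  identity. Testing the weak equation with \<open>\<theta> (s (x - y))\<close> and integrating in \<open>s\<close> therefore
  represents \<open>u\<close> as a Lipschitz function plus a Riesz potential of \<open>q u\<close>, cut off at a finite radius;
  no explicit fundamental solution is needed.

  Iterating the representation gives local boundedness, then Hoelder continuity of some order
  \<open>\<gamma> > \<alpha>\<close>. Hence the jump integral of \<open>u\<close> converges absolutely on \<open>D\<close>, and
  \<open>s\<^sup>d\<^sup>+\<^sup>\<alpha> \<psi> (s z) \<rightarrow> (\<integral>\<theta>) |z|\<^sup>-\<^sup>d\<^sup>-\<^sup>\<alpha>\<close> turns the weak equation tested with \<open>\<theta> (s (x - y))\<close> into the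
  pointwise one as \<open>s \<rightarrow> \<infinity>\<close>.
\<close>

subsection \<open>Lebesgue measure under affine and orthogonal maps\<close>

text \<open>With g = u q and A the Riesz constant, the bump of scale s around x gives A s^\<alpha>
  \<integral> u(y) \<psi>(s(x-y)) dy = -\<integral> g(y) \<theta>(s(x-y)) dy. The derivative of
  \<phi>_s(z) in s being -s^(d-1) \<psi>(s z), this is a differential equation in the scale: the
  s-derivative of A u * \<phi>_s is s^(d-1-\<alpha>) times g convolved with \<theta>(s .).
  Integrated over s > R, the right side has the kernel \<integral> s^(d-1-\<alpha>) \<theta>(s z) ds
  \<le> |z|^(\<alpha>-d) / (d-\<alpha>). The bound \<alpha> < 1 makes jump integrals of bounded
  Lipschitz functions absolutely convergent and gives \<alpha> < d in every dimension. The sign of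
  \<phi>_s comes from antisymmetry: jumps inside a ball cancel, jumps out of it go down because
  \<theta> is radially decreasing. The obstacle is that u is at first only in a weighted L^1 space.
  So u * \<phi>_s is compared with u through integrals over boxes, which identifies the limit almost
  everywhere. The regular version is, up to a constant, the pointwise limit of u * \<phi>_n, which
  exists on all of D once u is locally bounded and inherits every estimate uniform in n.\<close>

lemma nn_integral_affine_euclidean:
  fixes f :: "'a::euclidean_space \<Rightarrow> ennreal" and t :: 'a
  assumes [measurable]: "f \<in> borel_measurable borel" and c: "c \<noteq> 0"
  shows "(\<integral>\<^sup>+x. f x \<partial>lborel) = \<bar>c\<bar> ^ DIM('a) * (\<integral>\<^sup>+x. f (t + c *\<^sub>R x) \<partial>lborel)"
  by (subst lborel_affine[OF c, of t])
     (simp add: nn_integral_density nn_integral_distr nn_integral_cmult ennreal_power)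

lemma integrable_affine_euclidean:
  fixes f :: "'a::euclidean_space \<Rightarrow> real" and t :: 'a
  assumes f: "integrable lborel f" and c: "c \<noteq> 0"
  shows "integrable lborel (\<lambda>x. f (t + c *\<^sub>R x))"
  using f f[THEN borel_measurable_integrable] c unfolding integrable_iff_bounded
  by (subst (asm) nn_integral_affine_euclidean[where c=c and t=t])
     (auto simp: ennreal_mult_less_top)

lemma integrable_affine_euclidean_iff:
  fixes f :: "'a::euclidean_space \<Rightarrow> real" and t :: 'a
  assumes c: "c \<noteq> 0"
  shows "integrable lborel (\<lambda>x. f (t + c *\<^sub>R x)) \<longleftrightarrow> integrable lborel f"
  using integrable_affine_euclidean[OF _ c, of f t]
    integrable_affine_euclidean[of "\<lambda>x. f (t + c *\<^sub>R x)" "1/c" "-(t /\<^sub>R c)"] c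
  by (auto simp add: scaleR_right_diff_distrib divide_inverse)

lemma integral_affine_euclidean:
  fixes f :: "'a::euclidean_space \<Rightarrow> real" and t :: 'a
  assumes c: "c \<noteq> 0"
  shows "(\<integral>x. f x \<partial>lborel) = \<bar>c\<bar> ^ DIM('a) * (\<integral>x. f (t + c *\<^sub>R x) \<partial>lborel)"
proof cases
  assume f[measurable]: "integrable lborel f" then show ?thesis
    using c f f[THEN borel_measurable_integrable] integrable_affine_euclidean[OF f c, of t]
    by (subst lborel_affine[OF c, of t]) (simp add: integral_density integral_distr)
next
  assume "\<not> integrable lborel f" with c show ?thesis
    by (simp add: integrable_affine_euclidean_iff not_integrable_integral_eq)
qed

lemma nn_integral_lborel_minus:
  fixes f :: "'a::euclidean_space \<Rightarrow> ennreal"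
  assumes "f \<in> borel_measurable borel"
  shows "(\<integral>\<^sup>+y. f (x - y) \<partial>lborel) = (\<integral>\<^sup>+y. f y \<partial>lborel)"
  using nn_integral_affine_euclidean[OF assms, of "-1" x] by simp

lemma nn_integral_lborel_shift:
  fixes f :: "'a::euclidean_space \<Rightarrow> ennreal"
  assumes "f \<in> borel_measurable borel"
  shows "(\<integral>\<^sup>+y. f (y - x) \<partial>lborel) = (\<integral>\<^sup>+y. f y \<partial>lborel)"
  using nn_integral_affine_euclidean[OF assms, of "1" "-x"] by simp

lemma integral_lborel_minus:
  fixes f :: "'a::euclidean_space \<Rightarrow> real"
  shows "(\<integral>y. f (x - y) \<partial>lborel) = (\<integral>y. f y \<partial>lborel)"
  using integral_affine_euclidean[of "-1" f x] by simp

lemma integral_lborel_shift: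
  fixes f :: "'a::euclidean_space \<Rightarrow> real"
  shows "(\<integral>y. f (y - x) \<partial>lborel) = (\<integral>y. f y \<partial>lborel)"
  using integral_affine_euclidean[of "1" f "-x"] by simp

lemma integrable_lborel_minus_iff:
  fixes f :: "'a::euclidean_space \<Rightarrow> real"
  shows "integrable lborel (\<lambda>y. f (x - y)) \<longleftrightarrow> integrable lborel f"
  using integrable_affine_euclidean_iff[of "-1" f x] by simp

lemma integrable_lborel_shift_iff:
  fixes f :: "'a::euclidean_space \<Rightarrow> real"
  shows "integrable lborel (\<lambda>y. f (y - x)) \<longleftrightarrow> integrable lborel f"
  using integrable_affine_euclidean_iff[of "1" f "-x"] by simp

text \<open>Uniqueness of Haar measure, specialised: an orthogonal transformation \<open>T\<close> maps Lebesgue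
  measure to a translation invariant measure that agrees with it on the unit ball.\<close>

lemma nn_integral_orthogonal_transformation:
  fixes f :: "'a::euclidean_space \<Rightarrow> ennreal" and T :: "'a \<Rightarrow> 'a"
  assumes T: "orthogonal_transformation T" and [measurable]: "f \<in> borel_measurable borel"
  shows "(\<integral>\<^sup>+x. f (T x) \<partial>lborel) = (\<integral>\<^sup>+x. f x \<partial>lborel)"
proof -
  define g :: "'a \<Rightarrow> ennreal" where "g = indicator (ball 0 1)"
  have [measurable]: "g \<in> borel_measurable borel" unfolding g_def by (intro borel_measurable_indicator borel_open open_ball)
  have lin: "linear T" using T by (simp add: orthogonal_transformation_def)
  then have [measurable]: "T \<in> borel_measurable borel"
    by (intro borel_measurable_continuous_onI linear_continuous_on) (simp add: linear_linear)
  have gT: "g (T x) = g x" for x :: 'a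
    using T by (simp add: g_def indicator_def orthogonal_transformation_norm)
  have surj: "surj T" by (rule orthogonal_transformation_surj[OF T])
  let ?V = "\<integral>\<^sup>+x. g x \<partial>lborel"
  have V: "?V \<noteq> 0" "?V \<noteq> \<infinity>"
    using emeasure_lborel_ball_finite[of "0::'a" 1]
    by (auto simp: g_def emeasure_ball ennreal_eq_0_iff not_le)
  have "(\<integral>\<^sup>+x. f (T x) \<partial>lborel) * ?V = (\<integral>\<^sup>+x. \<integral>\<^sup>+y. f (T x) * g y \<partial>lborel \<partial>lborel)"
    by (simp add: nn_integral_cmult nn_integral_multc)
  also have "\<dots> = (\<integral>\<^sup>+x. \<integral>\<^sup>+y. f (T x) * g (y - T x) \<partial>lborel \<partial>lborel)"
    by (simp add: nn_integral_cmult nn_integral_lborel_shift)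
  also have "\<dots> = (\<integral>\<^sup>+y. \<integral>\<^sup>+x. f (T x) * g (y - T x) \<partial>lborel \<partial>lborel)"
    by (rule lborel_pair.Fubini') simp
  also have "\<dots> = (\<integral>\<^sup>+y. \<integral>\<^sup>+x. f (y - T x) * g (T x) \<partial>lborel \<partial>lborel)"
  proof (rule nn_integral_cong)
    fix y
    \<comment> \<open>For fixed \<open>y = T z\<close> the reflection
      \<open>x \<mapsto> z - x\<close> exchanges \<open>T x\<close> and \<open>y - T x\<close>.
      Afterwards \<open>f\<close> is integrated by translation invariance in \<open>y\<close>, and
      only \<open>g (T x) = g x\<close> remains.\<close>
    obtain z where z: "y = T z" using surj by (auto elim: surjE)
    show "(\<integral>\<^sup>+x. f (T x) * g (y - T x) \<partial>lborel) = (\<integral>\<^sup>+x. f (y - T x) * g (T x) \<partial>lborel)"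
      using nn_integral_lborel_minus[of "\<lambda>x. f (T x) * g (y - T x)" z]
      by (simp add: z linear_diff[OF lin])
  qed
  also have "\<dots> = (\<integral>\<^sup>+x. \<integral>\<^sup>+y. f (y - T x) * g (T x) \<partial>lborel \<partial>lborel)"
    by (rule lborel_pair.Fubini') simp
  also have "\<dots> = (\<integral>\<^sup>+x. f x \<partial>lborel) * ?V"
    by (simp add: nn_integral_multc nn_integral_lborel_shift gT nn_integral_cmult)
  finally show ?thesis
    using V by (metis ennreal_mult_cancel_left mult.commute infinity_ennreal_def)
qed

lemma integral_orthogonal_transformation:
  fixes f :: "'a::euclidean_space \<Rightarrow> real" and T :: "'a \<Rightarrow> 'a"
  assumes T: "orthogonal_transformation T" and [measurable]: "f \<in> borel_measurable borel"
  shows "(\<integral>x. f (T x) \<partial>lborel) = (\<integral>x. f x \<partial>lborel)"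
proof -
  have lin: "linear T" using T by (simp add: orthogonal_transformation_def)
  then have [measurable]: "T \<in> borel_measurable borel"
    by (intro borel_measurable_continuous_onI linear_continuous_on) (simp add: linear_linear)
  have "distr lborel borel T = (lborel :: 'a measure)"
  proof (rule measure_eqI)
    fix A assume "A \<in> sets (distr lborel borel T)"
    then have [measurable]: "A \<in> sets borel" by simp
    show "emeasure (distr lborel borel T) A = emeasure lborel A"
      using nn_integral_orthogonal_transformation[OF T, of "indicator A"]
        nn_integral_distr[of T lborel borel "indicator A"] by simp
  qed simp
  then show ?thesis using integral_distr[of T lborel borel f] by simp
qed

subsection \<open>Polar coordinates for radial functions\<close>

text \<open>Both measures assign to \<open>{..<a}\<close> the volume of the ball of radius
  \<open>a\<close>, whose derivative in \<open>a\<close> is the density. Radial integrands are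
  thereby reduced to one dimension without a surface measure on the sphere.\<close>

lemma lborel_distr_norm:
  "distr (lborel :: 'a::euclidean_space measure) borel norm =
   density lborel (\<lambda>s. ennreal (real DIM('a) * unit_ball_vol DIM('a) * s ^ (DIM('a) - 1)) * indicator {0<..} s)"
  (is "?M = ?N")
proof (rule measure_eqI_generator_eq_countable)
  let ?E = "range (\<lambda>a::real. {..<a})"
  show "Int_stable ?E" unfolding Int_stable_def
  proof safe
    fix a b :: real
    have "{..<a} \<inter> {..<b} = {..<min a b}" by auto
    then show "{..<a} \<inter> {..<b} \<in> ?E" by blast
  qed
  show "?E \<subseteq> Pow UNIV" "sets ?M = sigma_sets UNIV ?E" "sets ?N = sigma_sets UNIV ?E"
    unfolding sets_distr sets_density sets_lborel borel_Iio by auto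
  have ball: "emeasure ?M {..<a} = emeasure lborel (ball (0::'a) a)" for a
    by (subst emeasure_distr) (auto intro!: arg_cong2[where f=emeasure])
  show "(\<lambda>a::real. {..<a}) ` Rats \<subseteq> ?E" "(\<Union>((\<lambda>a::real. {..<a}) ` Rats)) = UNIV"
    by auto (metis Rats_no_top_le UNIV_I Rats_dense_in_real less_add_one)
  show "countable ((\<lambda>a::real. {..<a}) ` Rats)" by (simp add: countable_rat)
  show "emeasure ?M A \<noteq> \<infinity>" if "A \<in> (\<lambda>a::real. {..<a}) ` Rats" for A
    using that emeasure_lborel_ball_finite[of "0::'a"] by (auto simp: ball less_top)
  show "emeasure ?M X = emeasure ?N X" if E: "X \<in> ?E" for X
  proof -
    obtain a :: real where X: "X = {..<a}" using E by blast
    show ?thesis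
    proof (cases "a \<le> 0")
      case True
      then have z: "indicator {0<..} x * indicator {..<a} x = (0::ennreal)" for x
        by (auto simp: indicator_def)
      have "emeasure ?N X = (\<integral>\<^sup>+x. 0 \<partial>(lborel :: real measure))"
        unfolding X by (subst emeasure_density) (auto simp: mult.assoc z)
      then show ?thesis using True by (simp add: X ball ball_empty)
    next
      case False
      then have a: "0 \<le> a" by simp
      let ?d = "DIM('a)" and ?c = "unit_ball_vol DIM('a)"
      have "emeasure ?N X = (\<integral>\<^sup>+x. ennreal (real ?d * ?c * x ^ (?d - 1)) * indicator {0<..} x * indicator {..<a} x \<partial>lborel)"
        unfolding X by (subst emeasure_density) auto
      \<comment> \<open>The two endpoints are null sets; adding them turns the open interval into
        the closed one of the fundamental theorem of calculus.\<close>
      also have "\<dots> = (\<integral>\<^sup>+x. ennreal (real ?d * ?c * x ^ (?d - 1)) * indicator {0..a} x \<partial>lborel)"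
        using AE_lborel_singleton[of 0] AE_lborel_singleton[of a]
        by (intro nn_integral_cong_AE, eventually_elim) (auto simp: indicator_def)
      also have "\<dots> = ennreal (?c * a ^ ?d - ?c * 0 ^ ?d)"
        by (rule nn_integral_FTC_Icc) (use a in \<open>auto intro!: derivative_eq_intros simp: mult_ac\<close>)
      finally show ?thesis using a by (simp add: X ball emeasure_ball)
    qed
  qed
qed

lemma nn_integral_radial:
  fixes f :: "real \<Rightarrow> ennreal"
  assumes [measurable]: "f \<in> borel_measurable borel"
  shows "(\<integral>\<^sup>+x. f (norm (x::'a::euclidean_space)) \<partial>lborel) =
    (\<integral>\<^sup>+s. ennreal (real DIM('a) * unit_ball_vol DIM('a) * s ^ (DIM('a) - 1)) * indicator {0<..} s * f s \<partial>lborel)"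
proof -
  have "(\<integral>\<^sup>+x. f (norm (x::'a)) \<partial>lborel) = (\<integral>\<^sup>+s. f s \<partial>distr (lborel :: 'a measure) borel norm)"
    by (subst nn_integral_distr) auto
  then show ?thesis
    unfolding lborel_distr_norm by (simp add: nn_integral_density)
qed

lemma integral_radial:
  fixes f :: "real \<Rightarrow> real"
  assumes [measurable]: "f \<in> borel_measurable borel"
  shows "(\<integral>x. f (norm (x::'a::euclidean_space)) \<partial>lborel) =
    real DIM('a) * unit_ball_vol DIM('a) * (LINT s:{0<..}|lborel. s ^ (DIM('a) - 1) * f s)"
proof -
  let ?w = "\<lambda>s::real. real DIM('a) * unit_ball_vol DIM('a) * s ^ (DIM('a) - 1) * indicator {0<..} s"
  have w: "(\<lambda>s. ennreal (real DIM('a) * unit_ball_vol DIM('a) * s ^ (DIM('a) - 1)) * indicator {0<..} s) = (\<lambda>s. ennreal (?w s))"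
    by (auto simp: fun_eq_iff indicator_def)
  have "(\<integral>x. f (norm (x::'a)) \<partial>lborel) = (\<integral>s. f s \<partial>distr (lborel :: 'a measure) borel norm)"
    by (subst integral_distr) auto
  also have "\<dots> = (\<integral>s. ?w s * f s \<partial>lborel)"
    unfolding lborel_distr_norm w
    by (subst integral_density) (auto simp: indicator_def)
  also have "\<dots> = (\<integral>s. real DIM('a) * unit_ball_vol DIM('a) * (indicator {0<..} s *\<^sub>R (s ^ (DIM('a) - 1) * f s)) \<partial>lborel)"
    by (intro Bochner_Integration.integral_cong) (auto simp: indicator_def)
  finally show ?thesis by (simp add: set_lebesgue_integral_def)
qed

lemmas [measurable] = borel_closed[OF closed_cball] borel_open[OF open_ball]

subsection \<open>Integrability of powers of the norm\<close>

lemma has_integral_indicator_mult_UNIV: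
  fixes f :: "'a::euclidean_space \<Rightarrow> real"
  shows "((\<lambda>x. indicator S x * f x) has_integral I) UNIV \<longleftrightarrow> (f has_integral I) S"
proof -
  have "(\<lambda>x. indicator S x * f x) = (\<lambda>x. if x \<in> S then f x else 0)"
    by (auto simp: indicator_def)
  then show ?thesis by (simp add: has_integral_restrict_UNIV)
qed

lemma nn_integral_norm_powr_cball:
  fixes a R :: real
  assumes a: "a < real DIM('a::euclidean_space)" and R: "0 < R"
  shows "(\<integral>\<^sup>+x. ennreal (norm (x::'a) powr (-a)) * indicator (cball 0 R) x \<partial>lborel) =
    ennreal (real DIM('a) * unit_ball_vol DIM('a) * (R powr (real DIM('a) - a) / (real DIM('a) - a)))"
proof -
  let ?d = "DIM('a)" and ?c = "unit_ball_vol DIM('a)"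
  have "(\<integral>\<^sup>+x. ennreal (norm (x::'a) powr (-a)) * indicator (cball 0 R) x \<partial>lborel) =
     (\<integral>\<^sup>+x. ennreal (norm (x::'a) powr (-a)) * indicator {..R} (norm x) \<partial>lborel)"
    by (intro nn_integral_cong) (auto simp: indicator_def)
  also have "\<dots> = (\<integral>\<^sup>+s. ennreal (real ?d * ?c * s ^ (?d - 1)) * indicator {0<..} s *
     (ennreal (s powr (-a)) * indicator {..R} s) \<partial>lborel)"
    by (subst nn_integral_radial) auto
  also have "\<dots> = (\<integral>\<^sup>+s. ennreal (real ?d * ?c) * (indicator {0..R} s * ennreal (s powr (?d - 1 - a))) \<partial>lborel)"
  proof (rule nn_integral_cong_AE, use AE_lborel_singleton[of "0::real"] in eventually_elim)
    case (elim s)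
    show ?case
    proof (cases "0 < s \<and> s \<le> R")
      case True
      then have "s powr (?d - 1 - a) = s ^ (?d - 1) * s powr (-a)"
        by (simp add: powr_realpow[symmetric] powr_add[symmetric] of_nat_diff DIM_positive Suc_leI)
      with True show ?thesis
        by (simp add: ennreal_mult mult_ac)
    qed (use elim in \<open>auto simp: indicator_def\<close>)
  qed
  also have "\<dots> = ennreal (real ?d * ?c) * (\<integral>\<^sup>+s. (indicator {0..R} s * ennreal (s powr (?d - 1 - a))) \<partial>lborel)"
    by (rule nn_integral_cmult) auto
  also have "(\<integral>\<^sup>+s. (indicator {0..R} s * ennreal (s powr (?d - 1 - a))) \<partial>lborel) = (\<integral>\<^sup>+s. ennreal (indicator {0..R} s * (s powr (?d - 1 - a))) \<partial>lborel)"
    by (intro nn_integral_cong) (auto simp: indicator_def)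
  also have "\<dots> = ennreal (R powr (?d - a) / (?d - a))"
    using has_integral_powr_from_0[of "?d - 1 - a" R] a R
    by (intro nn_integral_has_integral_lborel) (auto simp: has_integral_indicator_mult_UNIV)
  finally show ?thesis using a by (simp add: ennreal_mult[symmetric] mult.assoc)
qed

lemma nn_integral_norm_powr_outside:
  fixes a R :: real
  assumes a: "real DIM('a::euclidean_space) < a" and R: "0 < R"
  shows "(\<integral>\<^sup>+x. ennreal (norm (x::'a) powr (-a)) * indicator {x. R \<le> norm x} x \<partial>lborel) =
    ennreal (real DIM('a) * unit_ball_vol DIM('a) * (R powr (real DIM('a) - a) / (a - DIM('a))))"
proof -
  let ?d = "DIM('a)" and ?c = "unit_ball_vol DIM('a)"
  have "(\<integral>\<^sup>+x. ennreal (norm (x::'a) powr (-a)) * indicator {x. R \<le> norm x} x \<partial>lborel) =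
     (\<integral>\<^sup>+x. ennreal (norm (x::'a) powr (-a)) * indicator {R..} (norm x) \<partial>lborel)"
    by (intro nn_integral_cong) (auto simp: indicator_def)
  also have "\<dots> = (\<integral>\<^sup>+s. ennreal (real ?d * ?c * s ^ (?d - 1)) * indicator {0<..} s *
     (ennreal (s powr (-a)) * indicator {R..} s) \<partial>lborel)"
    by (subst nn_integral_radial) auto
  also have "\<dots> = (\<integral>\<^sup>+s. ennreal (real ?d * ?c) * (indicator {R..} s * ennreal (s powr (?d - 1 - a))) \<partial>lborel)"
  proof (intro nn_integral_cong)
    fix s
    show "ennreal (real ?d * ?c * s ^ (?d - 1)) * indicator {0<..} s * (ennreal (s powr (-a)) * indicator {R..} s)
      = ennreal (real ?d * ?c) * (indicator {R..} s * ennreal (s powr (?d - 1 - a)))"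
    proof (cases "R \<le> s")
      case True
      then have "s powr (?d - 1 - a) = s ^ (?d - 1) * s powr (-a)"
        using R by (simp add: powr_realpow[symmetric] powr_add[symmetric] of_nat_diff DIM_positive Suc_leI)
      with True R show ?thesis
        by (simp add: ennreal_mult mult_ac)
    qed auto
  qed
  also have "\<dots> = ennreal (real ?d * ?c) * (\<integral>\<^sup>+s. (indicator {R..} s * ennreal (s powr (?d - 1 - a))) \<partial>lborel)"
    by (rule nn_integral_cmult) auto
  also have "(\<integral>\<^sup>+s. (indicator {R..} s * ennreal (s powr (?d - 1 - a))) \<partial>lborel) = (\<integral>\<^sup>+s. ennreal (indicator {R..} s * (s powr (?d - 1 - a))) \<partial>lborel)"
    by (intro nn_integral_cong) (auto simp: indicator_def)
  also have "\<dots> = ennreal (R powr (?d - a) / (a - ?d))"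
    using has_integral_powr_to_inf[of "?d - 1 - a" R] a R minus_divide_right[of "R powr (?d - a)" "?d - a"]
    by (intro nn_integral_has_integral_lborel) (auto simp: has_integral_indicator_mult_UNIV)
  finally show ?thesis using a by (simp add: ennreal_mult[symmetric] mult.assoc)
qed

lemma integrable_norm_powr_cball:
  fixes a R :: real
  assumes "a < real DIM('a::euclidean_space)"
  shows "integrable lborel (\<lambda>x::'a. norm (x - z) powr (-a) * indicator (cball z R) x)"
proof -
  \<comment> \<open>The radius is enlarged to \<open>max 1 R\<close> because the integral over a
    ball is computed for positive radii, while \<open>R\<close> is arbitrary here.\<close>
  have "integrable lborel (\<lambda>x::'a. norm x powr (-a) * indicator (cball 0 (max 1 R)) x)"
  proof (rule integrableI_nonneg)
    have "(\<integral>\<^sup>+x. ennreal (norm (x::'a) powr (-a) * indicator (cball 0 (max 1 R)) x) \<partial>lborel) =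
      (\<integral>\<^sup>+x. ennreal (norm (x::'a) powr (-a)) * indicator (cball 0 (max 1 R)) x \<partial>lborel)"
      by (intro nn_integral_cong) (auto simp: indicator_def)
    then show "(\<integral>\<^sup>+x. ennreal (norm (x::'a) powr (-a) * indicator (cball 0 (max 1 R)) x) \<partial>lborel) < \<infinity>"
      using nn_integral_norm_powr_cball[OF assms, of "max 1 R"] by simp
  qed auto
  then have "integrable lborel (\<lambda>x::'a. norm (x - z) powr (-a) * indicator (cball 0 (max 1 R)) (x - z))"
    using integrable_lborel_shift_iff[of "\<lambda>x. norm x powr (-a) * indicator (cball 0 (max 1 R)) x" z] by simp
  then show ?thesis
    by (rule Bochner_Integration.integrable_bound)
       (auto simp: indicator_def dist_norm norm_minus_commute)
qed

lemma integrable_norm_powr_outside: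
  fixes a R :: real
  assumes "real DIM('a::euclidean_space) < a" and "0 < R"
  shows "integrable lborel (\<lambda>x::'a. norm (x - z) powr (-a) * indicator {x. R \<le> norm (x - z)} x)"
proof -
  have "integrable lborel (\<lambda>x::'a. norm x powr (-a) * indicator {x. R \<le> norm x} x)"
  proof (rule integrableI_nonneg)
    have "(\<integral>\<^sup>+x. ennreal (norm (x::'a) powr (-a) * indicator {x. R \<le> norm x} x) \<partial>lborel) =
      (\<integral>\<^sup>+x. ennreal (norm (x::'a) powr (-a)) * indicator {x. R \<le> norm x} x \<partial>lborel)"
      by (intro nn_integral_cong) (auto simp: indicator_def)
    then show "(\<integral>\<^sup>+x. ennreal (norm (x::'a) powr (-a) * indicator {x. R \<le> norm x} x) \<partial>lborel) < \<infinity>"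
      using nn_integral_norm_powr_outside[OF assms] by simp
  qed auto
  then have "integrable lborel (\<lambda>x::'a. norm (x - z) powr (-a) * indicator {x. R \<le> norm x} (x - z))"
    using integrable_lborel_shift_iff[of "\<lambda>x. norm x powr (-a) * indicator {x. R \<le> norm x} x" z] by simp
  then show ?thesis
    by (simp add: indicator_def)
qed

lemma integrable_one_plus_norm_powr:
  fixes a :: real
  assumes "real DIM('a::euclidean_space) < a"
  shows "integrable lborel (\<lambda>x::'a. (1 + norm x) powr (-a))"
proof (rule Bochner_Integration.integrable_bound)
  show "integrable lborel (\<lambda>x::'a. indicator (cball 0 1) x + norm (x - 0) powr (-a) * indicator {x. 1 \<le> norm (x - 0)} x)"
    using integrable_norm_powr_outside[OF assms, of 1 0] emeasure_lborel_cball_finite[of "0::'a" 1]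
    by (intro Bochner_Integration.integrable_add) (auto simp: less_top)
  show "AE x in lborel. norm ((1 + norm x) powr (-a))
      \<le> norm (indicator (cball 0 1) x + norm (x - 0) powr (-a) * indicator {x. 1 \<le> norm (x - 0)} (x::'a))"
  proof (intro AE_I2)
    fix x :: 'a
    show "norm ((1 + norm x) powr (-a)) \<le> norm (indicator (cball 0 1) x + norm (x - 0) powr (-a) * indicator {x. 1 \<le> norm (x - 0)} x)"
    proof (cases "norm x < 1")
      case True
      have "(1 + norm x) powr (-a) \<le> 1 powr (-a)"
        using assms by (intro powr_mono2') auto
      with True show ?thesis by (auto simp: indicator_def)
    next
      case False
      have "(1 + norm x) powr (-a) \<le> norm x powr (-a)"
        using assms False by (intro powr_mono2') auto
      with False show ?thesis by (auto simp: indicator_def)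
    qed
  qed
qed auto

text \<open>A form of Peetre's inequality, from 1 + |y| \<le> (1 + |x|) (1 + |x - y|). It moves the
  decay from \<open>x - y\<close> to \<open>y\<close> at the price of a constant that depends on |x|
  only.\<close>

lemma one_plus_norm_diff_powr_le:
  fixes x y :: "'a::real_normed_vector"
  assumes "0 \<le> p"
  shows "(1 + norm (x - y)) powr (-p) \<le> (1 + norm x) powr p * (1 + norm y) powr (-p)"
proof -
  have "1 + norm y \<le> 1 + norm x + norm (x - y)"
    using norm_triangle_ineq4[of x "x - y"] by simp
  also have "\<dots> \<le> (1 + norm x) * (1 + norm (x - y))" by (simp add: algebra_simps)
  finally have "(1 + norm y) powr p \<le> ((1 + norm x) * (1 + norm (x - y))) powr p"
    using assms by (intro powr_mono2) auto
  then have "(1 + norm y) powr p \<le> (1 + norm x) powr p * (1 + norm (x - y)) powr p"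
    by (simp add: powr_mult)
  moreover have "0 < (1 + norm (x - y)) powr p" "0 < (1 + norm y) powr p"
    by (auto simp: powr_gt_zero add_nonneg_eq_0_iff)
  ultimately show ?thesis by (simp add: powr_minus field_simps)
qed

text \<open>The weight in \<open>weighted_L1\<close>. A measurable function bounded by a multiple of
  it can be integrated against every element of that space, so decay estimates below are always
  stated in this form.\<close>

definition decay :: "real \<Rightarrow> 'a::euclidean_space \<Rightarrow> real" where
  "decay \<alpha> x = (1 + norm x) powr (- real DIM('a) - \<alpha>)"

lemma decay_measurable [measurable]: "decay \<alpha> \<in> borel_measurable borel"
  unfolding decay_def by measurable

lemma decay_pos: "0 < decay \<alpha> x"
  unfolding decay_def using norm_ge_zero[of x] by (auto simp: powr_gt_zero add_nonneg_eq_0_iff)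

lemma integrable_decay: "0 < \<alpha> \<Longrightarrow> integrable lborel (decay \<alpha> :: 'a::euclidean_space \<Rightarrow> real)"
  using integrable_one_plus_norm_powr[where 'a='a, of "real DIM('a) + \<alpha>"] by (simp add: decay_def[abs_def])

lemma decay_diff_le:
  fixes x y :: "'a::euclidean_space"
  assumes "0 < \<alpha>"
  shows "decay \<alpha> (x - y) \<le> (1 + norm x) powr (real DIM('a) + \<alpha>) * decay \<alpha> y"
  using one_plus_norm_diff_powr_le[of "real DIM('a) + \<alpha>" x y] assms by (simp add: decay_def)

subsection \<open>The jump integral\<close>

text \<open>The operator without truncation and without its normalising constant. For \<alpha> < 1
  no cancellation around \<open>x\<close> has to be exploited: the integral converges absolutely for
  the functions met here.\<close>

definition jump_int :: "real \<Rightarrow> ('a::euclidean_space \<Rightarrow> real) \<Rightarrow> 'a \<Rightarrow> real" where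
  "jump_int \<alpha> f x = (LINT y|lborel. (f y - f x) / norm (y - x) powr (real DIM('a) + \<alpha>))"

definition jump_integrable :: "real \<Rightarrow> ('a::euclidean_space \<Rightarrow> real) \<Rightarrow> 'a \<Rightarrow> bool" where
  "jump_integrable \<alpha> f x \<longleftrightarrow> integrable lborel (\<lambda>y. (f y - f x) / norm (y - x) powr (real DIM('a) + \<alpha>))"

text \<open>Dominated convergence: the untruncated integrand is a majorant, and at every
  \<open>y \<noteq> x\<close> the truncation is eventually inactive. At \<open>y = x\<close> the
  integrand is 0.\<close>

lemma frac_lap_trunc_tendsto:
  assumes "jump_integrable \<alpha> f x"
  shows "(frac_lap_trunc \<alpha> f x \<longlongrightarrow> jump_int \<alpha> f x) (at_right 0)"
proof (rule tendsto_at_right_sequentially[of 0 1])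
  fix S :: "nat \<Rightarrow> real" assume S: "\<And>n. 0 < S n" "S \<longlonglongrightarrow> 0"
  let ?F = "\<lambda>y. (f y - f x) / norm (y - x) powr (real DIM('a) + \<alpha>)"
  have int: "integrable lborel ?F" using assms by (simp add: jump_integrable_def)
  then have [measurable]: "?F \<in> borel_measurable borel" by simp
  show "(\<lambda>n. frac_lap_trunc \<alpha> f x (S n)) \<longlonglongrightarrow> jump_int \<alpha> f x"
    unfolding frac_lap_trunc_def jump_int_def set_lebesgue_integral_def
  proof (rule integral_dominated_convergence)
    show "integrable lborel (\<lambda>y. \<bar>?F y\<bar>)" using int by (rule integrable_abs)
    show "(\<lambda>y. indicat_real {y. S n < norm (y - x)} y *\<^sub>R ?F y) \<in> borel_measurable lborel" for n
      by measurable
    show "AE y in lborel. (\<lambda>n. indicat_real {y. S n < norm (y - x)} y *\<^sub>R ?F y) \<longlonglongrightarrow> ?F y"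
    proof (intro AE_I2)
      fix y
      show "(\<lambda>n. indicat_real {y. S n < norm (y - x)} y *\<^sub>R ?F y) \<longlonglongrightarrow> ?F y"
      proof (cases "y = x")
        case False
        then have "eventually (\<lambda>n. S n < norm (y - x)) sequentially"
          using S(2) by (intro order_tendstoD) auto
        then have "eventually (\<lambda>n. indicat_real {y. S n < norm (y - x)} y *\<^sub>R ?F y = ?F y) sequentially"
          by eventually_elim auto
        then show ?thesis by (rule tendsto_eventually)
      qed simp
    qed
    show "AE y in lborel. norm (indicat_real {y. S n < norm (y - x)} y *\<^sub>R ?F y) \<le> \<bar>?F y\<bar>" for n
      by (auto simp: indicator_def)
  qed (use int in simp)
qed simp

lemma frac_lap_eq_jump_int:
  fixes f :: "'a::euclidean_space \<Rightarrow> real"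
  assumes "jump_integrable \<alpha> f x"
  shows "frac_lap_exists \<alpha> f x" "frac_lap \<alpha> f x = riesz_const DIM('a) (- \<alpha>) * jump_int \<alpha> f x"
  using frac_lap_trunc_tendsto[OF assms] tendsto_Lim[OF _ frac_lap_trunc_tendsto[OF assms]]
  by (auto simp: frac_lap_exists_def frac_lap_def)

text \<open>\<open>Gamma\<close> takes the value 0 at its poles, so \<open>- \<alpha> / 2\<close>
  has to be kept away from the nonpositive integers; it lies strictly between -1/2 and 0.\<close>

lemma riesz_const_pos:
  assumes "0 < \<alpha>" "\<alpha> < 1" "0 < d"
  shows "0 < riesz_const d (- \<alpha>)"
proof -
  have "- \<alpha> / 2 \<notin> \<int>\<^sub>\<le>\<^sub>0"
  proof
    assume "- \<alpha> / 2 \<in> \<int>\<^sub>\<le>\<^sub>0"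
    then obtain n :: nat where "- \<alpha> / 2 = - of_nat n" by (auto elim!: nonpos_Ints_cases')
    then have "\<alpha> = 2 * n" by simp
    with assms show False by (cases n) auto
  qed
  then have "Gamma (- \<alpha> / 2) \<noteq> 0" by (simp add: Gamma_eq_zero_iff)
  moreover have "0 < Gamma ((real d + \<alpha>) / 2)" using assms by (intro Gamma_real_pos) auto
  ultimately show ?thesis by (simp add: riesz_const_def)
qed

text \<open>The jump integral of the modulus min(1, |z|), which up to a factor dominates the
  increments of every bounded Lipschitz function. The type argument fixes the dimension.\<close>

definition jump_const :: "'a::euclidean_space itself \<Rightarrow> real \<Rightarrow> real" where
  "jump_const _ \<alpha> = (LINT z|lborel. min 1 (norm (z::'a)) / norm z powr (real DIM('a) + \<alpha>))"

text \<open>At the origin the singularity has the order d + \<alpha> - 1, which is below d exactly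
  because \<alpha> < 1; at infinity the order d + \<alpha> exceeds d.\<close>

lemma integrable_jump_const:
  assumes "0 < \<alpha>" "\<alpha> < 1"
  shows "integrable lborel (\<lambda>z::'a::euclidean_space. min 1 (norm z) / norm z powr (real DIM('a) + \<alpha>))"
proof (rule Bochner_Integration.integrable_bound)
  show "integrable lborel (\<lambda>z::'a. norm (z - 0) powr (-(real DIM('a) + \<alpha> - 1)) * indicator (cball 0 1) z
      + norm (z - 0) powr (-(real DIM('a) + \<alpha>)) * indicator {x. 1 \<le> norm (x - 0)} z)"
    using assms by (intro Bochner_Integration.integrable_add integrable_norm_powr_cball integrable_norm_powr_outside) auto
  show "AE z in lborel. norm (min 1 (norm z) / norm z powr (real DIM('a) + \<alpha>)) \<le>
      norm (norm (z - 0) powr (-(real DIM('a) + \<alpha> - 1)) * indicator (cball 0 1) z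
      + norm (z - 0) powr (-(real DIM('a) + \<alpha>)) * indicator {x. 1 \<le> norm (x - 0)} (z::'a))"
  proof (intro AE_I2)
    fix z :: 'a
    have "norm z / norm z powr (real DIM('a) + \<alpha>) = norm z powr (-(real DIM('a) + \<alpha> - 1))"
      using powr_diff[of "norm z" 1 "real DIM('a) + \<alpha>"] by (cases "z = 0") (auto simp: algebra_simps)
    moreover have "norm z powr (- real DIM('a) - \<alpha>) = inverse (norm z powr (real DIM('a) + \<alpha>))"
      by (simp add: powr_minus[symmetric])
    ultimately show "norm (min 1 (norm z) / norm z powr (real DIM('a) + \<alpha>)) \<le>
      norm (norm (z - 0) powr (-(real DIM('a) + \<alpha> - 1)) * indicator (cball 0 1) z
      + norm (z - 0) powr (-(real DIM('a) + \<alpha>)) * indicator {x. 1 \<le> norm (x - 0)} z)"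
      by (auto simp: indicator_def min_def powr_minus divide_inverse)
  qed
qed auto

lemma jump_const_nonneg: "0 \<le> jump_const TYPE('a::euclidean_space) \<alpha>"
  unfolding jump_const_def by (intro Bochner_Integration.integral_nonneg) auto

lemma
  fixes f :: "'a::euclidean_space \<Rightarrow> real"
  assumes \<alpha>: "0 < \<alpha>" "\<alpha> < 1" and [measurable]: "f \<in> borel_measurable borel"
    and f: "\<And>y. \<bar>f y - f x\<bar> \<le> L * min 1 (norm (y - x))"
  shows jump_integrable_Lipschitz: "jump_integrable \<alpha> f x"
    and jump_int_abs_le: "(LINT y|lborel. \<bar>(f y - f x) / norm (y - x) powr (real DIM('a) + \<alpha>)\<bar>) \<le> L * jump_const TYPE('a) \<alpha>"
proof -
  let ?k = "\<lambda>z::'a. min 1 (norm z) / norm z powr (real DIM('a) + \<alpha>)"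
  have k: "integrable lborel (\<lambda>y. L * ?k (y - x))"
    using integrable_jump_const[where 'a='a, OF \<alpha>] integrable_lborel_shift_iff[of ?k x]
    by (intro integrable_mult_right) simp
  have le: "\<bar>(f y - f x) / norm (y - x) powr (real DIM('a) + \<alpha>)\<bar> \<le> L * ?k (y - x)" for y
    using divide_right_mono[OF f[of y], of "norm (y - x) powr (real DIM('a) + \<alpha>)"] by (simp add: abs_divide)
  show *: "jump_integrable \<alpha> f x"
    unfolding jump_integrable_def
  proof (rule Bochner_Integration.integrable_bound[OF k])
    show "AE y in lborel. norm ((f y - f x) / norm (y - x) powr (real DIM('a) + \<alpha>)) \<le> norm (L * ?k (y - x))"
      unfolding real_norm_def by (intro AE_I2 order_trans[OF le abs_ge_self])
  qed measurable
  have "(LINT y|lborel. \<bar>(f y - f x) / norm (y - x) powr (real DIM('a) + \<alpha>)\<bar>) \<le> (LINT y|lborel. L * ?k (y - x))"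
    by (rule integral_mono[OF integrable_abs[OF *[unfolded jump_integrable_def]] k le])
  also have "\<dots> = L * (LINT y|lborel. ?k (y - x))" by (rule integral_mult_right_zero)
  also have "\<dots> = L * jump_const TYPE('a) \<alpha>"
    using integral_lborel_shift[of ?k x] by (simp add: jump_const_def)
  finally show "(LINT y|lborel. \<bar>(f y - f x) / norm (y - x) powr (real DIM('a) + \<alpha>)\<bar>) \<le> L * jump_const TYPE('a) \<alpha>" .
qed

lemma abs_jump_int_le:
  fixes x :: "'a::euclidean_space"
  shows "\<bar>jump_int \<alpha> f x\<bar> \<le> (LINT y|lborel. \<bar>(f y - f x) / norm (y - x) powr (real DIM('a) + \<alpha>)\<bar>)"
  unfolding jump_int_def by (rule integral_abs_bound)

lemma jump_int_diff:
  assumes "jump_integrable \<alpha> f x" "jump_integrable \<alpha> g x"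
  shows "jump_int \<alpha> (\<lambda>y. f y - g y) x = jump_int \<alpha> f x - jump_int \<alpha> g x"
  using assms unfolding jump_int_def jump_integrable_def
  by (subst Bochner_Integration.integral_diff[symmetric])
     (auto simp: diff_divide_distrib[symmetric] algebra_simps)

subsection \<open>A smooth radial bump\<close>

text \<open>The functions e^(-1/s) s^(-n), extended by 0. Their linear span is closed under
  differentiation, so smoothness of all orders becomes a single induction with \<open>n\<close>
  generalised.\<close>

definition flat :: "nat \<Rightarrow> real \<Rightarrow> real" where
  "flat n s = (if 0 < s then exp (- (1 / s)) / s ^ n else 0)"

lemma flat_nonneg: "0 \<le> flat n s"
  by (simp add: flat_def)

text \<open>From e^t \<ge> (1 + t/m)^m with m = n + 1 and t = 1/s. A bound linear in
  \<open>s\<close> for every \<open>n\<close> gives both a global bound on s \<le> 1 and, applied to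
  n + 1, the derivative at 0.\<close>

lemma flat_le:
  assumes "0 \<le> s"
  shows "flat n s \<le> real (Suc n) ^ Suc n * s"
proof (cases "s = 0")
  case False
  with assms have s: "0 < s" by simp
  let ?m = "real (Suc n)"
  have "(1 / s / ?m) ^ Suc n \<le> (1 + 1 / s / ?m) ^ Suc n"
    using s by (intro power_mono) auto
  also have "\<dots> \<le> exp (1 / s)"
  proof (rule exp_ge_one_plus_x_over_n_power_n)
    have "- real (Suc n) \<le> 0" by simp
    also have "0 \<le> 1 / s" using s by simp
    finally show "- real (Suc n) \<le> 1 / s" .
  qed simp
  finally have "1 / (s ^ Suc n * ?m ^ Suc n) \<le> exp (1 / s)"
    by (simp add: power_divide power_mult_distrib del: power_Suc of_nat_Suc)
  then have "1 \<le> exp (1 / s) * (s ^ Suc n * ?m ^ Suc n)"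
    using s by (simp add: divide_le_eq del: power_Suc of_nat_Suc)
  then have "exp (- (1 / s)) \<le> s ^ Suc n * ?m ^ Suc n"
    by (simp add: exp_minus field_simps del: power_Suc of_nat_Suc)
  then show ?thesis
    using s by (simp add: flat_def divide_le_eq mult_ac)
qed (simp add: flat_def)

lemma flat_le_const: "s \<le> 1 \<Longrightarrow> flat n s \<le> real (Suc n) ^ Suc n"
proof (cases "0 \<le> s")
  case True
  moreover assume "s \<le> 1"
  ultimately have "real (Suc n) ^ Suc n * s \<le> real (Suc n) ^ Suc n * 1"
    by (intro mult_left_mono) auto
  with flat_le[OF True, of n] show ?thesis by linarith
qed (simp add: flat_def)

lemma DERIV_flat: "(flat n has_real_derivative flat (n + 2) s - real n * flat (n + 1) s) (at s)"
proof -
  consider "0 < s" | "s < 0" | "s = 0" by linarith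
  then show ?thesis
  proof cases
    case 1
    have "((\<lambda>s. exp (- (1 / s)) / s ^ n) has_real_derivative flat (n + 2) s - real n * flat (n + 1) s) (at s)"
      using 1 by (auto intro!: derivative_eq_intros simp: flat_def) (cases n; simp add: field_simps power2_eq_square)
    then show ?thesis
      by (rule has_field_derivative_transform_within_open[of _ _ _ "{0<..}"]) (use 1 in \<open>auto simp: flat_def\<close>)
  next
    case 2
    have "((\<lambda>s. 0) has_real_derivative flat (n + 2) s - real n * flat (n + 1) s) (at s)"
      using 2 by (auto simp: flat_def)
    then show ?thesis
      by (rule has_field_derivative_transform_within_open[of _ _ _ "{..<0}"]) (use 2 in \<open>auto simp: flat_def\<close>)
  next
    case 3
    \<comment> \<open>To the right of 0 the difference quotient of \<open>flat n\<close> is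
      \<open>flat (Suc n)\<close>, which \<open>flat_le\<close> sends to 0; to the left it
      vanishes.\<close>
    have "((\<lambda>h. (flat n (0 + h) - flat n 0) / h) \<longlongrightarrow> 0) (at 0)"
    proof (rule Lim_null_comparison)
      have "norm ((flat n (0 + h) - flat n 0) / h) \<le> real (Suc (Suc n)) ^ Suc (Suc n) * \<bar>h\<bar>" for h
      proof (cases "0 < h")
        case True
        then have "(flat n (0 + h) - flat n 0) / h = flat (Suc n) h" by (simp add: flat_def)
        with flat_le[of h "Suc n"] flat_nonneg[of "Suc n" h] True show ?thesis by simp
      next
        case False
        then have "norm ((flat n (0 + h) - flat n 0) / h) = 0" by (simp add: flat_def)
        then show ?thesis by (metis abs_ge_zero mult_nonneg_nonneg of_nat_0_le_iff zero_le_power)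
      qed
      then show "\<forall>\<^sub>F h in at 0. norm ((flat n (0 + h) - flat n 0) / h) \<le> real (Suc (Suc n)) ^ Suc (Suc n) * \<bar>h\<bar>"
        by simp
      have "((\<lambda>h::real. real (Suc (Suc n)) ^ Suc (Suc n) * \<bar>h\<bar>) \<longlongrightarrow> real (Suc (Suc n)) ^ Suc (Suc n) * \<bar>0\<bar>) (at 0)"
        by (intro tendsto_intros)
      then show "((\<lambda>h::real. real (Suc (Suc n)) ^ Suc (Suc n) * \<bar>h\<bar>) \<longlongrightarrow> 0) (at 0)" by simp
    qed
    then show ?thesis using 3 by (simp add: DERIV_def flat_def)
  qed
qed

lemma isCont_flat: "isCont (flat n) s"
  using DERIV_flat by (rule DERIV_isCont)

lemma continuous_on_flat [continuous_intros]:
  "continuous_on S f \<Longrightarrow> continuous_on S (\<lambda>x. flat n (f x))"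
  using continuous_on_compose2[of UNIV "flat n" S f] isCont_flat
  by (auto intro: continuous_at_imp_continuous_on)

section \<open>Calculus of functions of class C^k\<close>

lemma C_k_const: "C_k k (\<lambda>x. c)"
proof (induction k arbitrary: c)
  case (Suc k)
  have "frechet_derivative (\<lambda>x::'a. c) (at x) = (\<lambda>b. 0)" for x
    by (rule frechet_derivative_at[symmetric]) auto
  then show ?case using Suc[of 0] by simp
qed simp

lemma C_k_Suc_I:
  assumes "\<And>x. (f has_derivative f' x) (at x)" "\<And>b. b \<in> Basis \<Longrightarrow> C_k k (\<lambda>x. f' x b)"
  shows "C_k (Suc k) f"
  using assms frechet_derivative_at[OF assms(1)] by (auto simp: differentiable_def)

lemma C_k_SucD: "C_k (Suc k) f \<Longrightarrow> C_k k f"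
proof (induction k arbitrary: f)
  case 0
  then show ?case
    by (auto intro!: continuous_at_imp_continuous_on differentiable_imp_continuous_within)
qed auto

lemma C_k_Suc_derivative: "C_k (Suc k) f \<Longrightarrow> (f has_derivative frechet_derivative f (at x)) (at x)"
  by (simp add: frechet_derivative_works[symmetric])

lemma C_k_add:
  assumes "C_k k f" "C_k k g" shows "C_k k (\<lambda>x. f x + g x)"
  using assms
proof (induction k arbitrary: f g)
  case (Suc k)
  show ?case
  proof (rule C_k_Suc_I)
    show "((\<lambda>x. f x + g x) has_derivative (\<lambda>b. frechet_derivative f (at x) b + frechet_derivative g (at x) b)) (at x)" for x
      using Suc.prems by (intro has_derivative_add C_k_Suc_derivative)
  qed (use Suc in auto)
qed (auto intro: continuous_intros)

lemma C_k_mult: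
  assumes "C_k k f" "C_k k g" shows "C_k k (\<lambda>x. f x * g x)"
  using assms
proof (induction k arbitrary: f g)
  case (Suc k)
  show ?case
  proof (rule C_k_Suc_I)
    show "((\<lambda>x. f x * g x) has_derivative (\<lambda>b. f x * frechet_derivative g (at x) b + frechet_derivative f (at x) b * g x)) (at x)" for x
      using Suc.prems by (intro has_derivative_mult C_k_Suc_derivative)
    show "C_k k (\<lambda>x. f x * frechet_derivative g (at x) b + frechet_derivative f (at x) b * g x)" if "b \<in> Basis" for b
      using Suc.prems that C_k_SucD[OF Suc.prems(1)] C_k_SucD[OF Suc.prems(2)] by (intro C_k_add Suc.IH) auto
  qed
qed (auto intro: continuous_intros)

lemma C_k_inner: "C_k k (\<lambda>x. (x0 - x) \<bullet> b)"
proof (cases k)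
  case (Suc n)
  then show ?thesis
    by (simp only:) (rule C_k_Suc_I[where f' = "\<lambda>x h. (0 - h) \<bullet> b"], auto intro!: C_k_const derivative_eq_intros)
qed (auto intro!: continuous_intros)

text \<open>\<open>n\<close> varies in the induction on \<open>k\<close>: one derivative produces
  the orders n + 1 and n + 2 multiplied by an affine function of \<open>y\<close>.\<close>

lemma C_k_flat: "C_k k (\<lambda>y::'a::euclidean_space. flat n (1 - (s *\<^sub>R (x - y)) \<bullet> (s *\<^sub>R (x - y))))"
proof (induction k arbitrary: n)
  case (Suc k)
  let ?h = "\<lambda>y. 1 - (s *\<^sub>R (x - y)) \<bullet> (s *\<^sub>R (x - y))"
  show ?case
  proof (rule C_k_Suc_I)
    have h: "(?h has_derivative (\<lambda>b. 2 * s\<^sup>2 * ((x - y) \<bullet> b))) (at y)" for y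
      by (auto intro!: derivative_eq_intros simp: inner_commute power2_eq_square algebra_simps fun_eq_iff)
    have D: "((flat n) has_derivative (\<lambda>z. (flat (n + 2) t + - real n * flat (n + 1) t) * z)) (at t)" for t
      using DERIV_flat[of n t] by (simp add: has_field_derivative_def)
    show "((\<lambda>y. flat n (?h y)) has_derivative
        (\<lambda>b. (flat (n + 2) (?h y) + - real n * flat (n + 1) (?h y)) * (2 * s\<^sup>2 * ((x - y) \<bullet> b)))) (at y)" for y
      by (rule has_derivative_compose[OF h D])
    show "C_k k (\<lambda>y. (flat (n + 2) (?h y) + - real n * flat (n + 1) (?h y)) * (2 * s\<^sup>2 * ((x - y) \<bullet> b)))" for b
      by (intro C_k_mult C_k_add C_k_inner C_k_const Suc.IH)
  qed
qed (auto intro!: continuous_intros)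

text \<open>The standard mollifier exp(-1 / (1 - |x|^2)) on the unit ball, extended by 0 and not
  normalised.\<close>

definition bump :: "'a::euclidean_space \<Rightarrow> real" where
  "bump x = flat 0 (1 - x \<bullet> x)"

lemma bump_nonneg: "0 \<le> bump x"
  by (simp add: bump_def flat_nonneg)

lemma bump_le_1: "bump x \<le> 1"
  using flat_le_const[of "1 - x \<bullet> x" 0] by (simp add: bump_def)

lemma bump_eq_0: "1 \<le> norm x \<Longrightarrow> bump x = 0"
proof -
  assume "1 \<le> norm x"
  then have "1 \<le> x \<bullet> x" using one_le_power[of "norm x" 2] by (simp add: dot_square_norm)
  then show ?thesis by (simp add: bump_def flat_def)
qed

lemma scaled_bump_eq_0:
  assumes "0 < s" "y \<notin> cball x (1 / s)"
  shows "bump (s *\<^sub>R (x - y)) = 0"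
proof (rule bump_eq_0)
  have "1 < s * norm (x - y)" using assms by (simp add: dist_norm field_simps)
  then show "1 \<le> norm (s *\<^sub>R (x - y))" unfolding norm_scaleR using assms(1) by simp
qed

lemma bump_pos: "norm x < 1 \<Longrightarrow> 0 < bump x"
  using power_strict_mono[of "norm x" 1 2] by (simp add: bump_def flat_def dot_square_norm)

lemma bump_norm_cong: "norm x = norm y \<Longrightarrow> bump x = bump y"
  by (simp add: bump_def dot_square_norm)

lemma bump_uminus [simp]: "bump (- x) = bump x"
  by (rule bump_norm_cong) simp

lemma continuous_on_bump [continuous_intros]:
  "continuous_on S f \<Longrightarrow> continuous_on S (\<lambda>x. bump (f x))"
  unfolding bump_def by (intro continuous_intros)

lemma bump_measurable [measurable]: "bump \<in> borel_measurable borel"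
  by (intro borel_measurable_continuous_onI continuous_intros)

lemma bump_test_function:
  assumes "0 < s" "cball x (1 / s) \<subseteq> D"
  shows "(\<lambda>y. bump (s *\<^sub>R (x - y))) \<in> test_functions D"
proof -
  let ?S = "{y. bump (s *\<^sub>R (x - y)) \<noteq> 0}"
  have "?S \<subseteq> cball x (1 / s)"
  proof
    fix y assume "y \<in> ?S"
    then have "norm (s *\<^sub>R (x - y)) < 1" using bump_eq_0[of "s *\<^sub>R (x - y)"] by force
    then have "s * norm (x - y) < 1" unfolding norm_scaleR using assms by simp
    then show "y \<in> cball x (1 / s)" using assms by (simp add: dist_norm field_simps)
  qed
  then have cl: "closure ?S \<subseteq> cball x (1 / s)" by (rule closure_minimal) simp
  then have "compact (closure ?S)"
    using compact_cball by (metis bounded_cball bounded_subset closed_closure compact_eq_bounded_closed)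
  moreover have "C_k k (\<lambda>y. bump (s *\<^sub>R (x - y)))" for k
    unfolding bump_def by (rule C_k_flat)
  ultimately show ?thesis
    using cl assms(2) by (auto simp: test_functions_def)
qed

text \<open>The second bound controls a mixed second difference; it says that an increment of the
  bump by \<open>h\<close> is itself Lipschitz with a constant of order |h|, which is what makes the
  jump integral of the bump Lipschitz. Both bounds come from the gradient, which is bounded and
  Lipschitz.\<close>

lemma bump_Lipschitz:
  "\<exists>L\<ge>0. \<forall>x y::'a::euclidean_space. \<bar>bump x - bump y\<bar> \<le> L * norm (x - y)"
  "\<exists>L\<ge>0. \<forall>x y h::'a. \<bar>(bump (x + h) - bump x) - (bump (y + h) - bump y)\<bar> \<le> L * norm h * norm (x - y)"
proof -
  define K :: "nat \<Rightarrow> real" where "K n = real (Suc n) ^ Suc n" for n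
  have K: "0 \<le> K n" for n by (simp add: K_def)
  have flat_K: "\<bar>flat n (1 - x \<bullet> x)\<bar> \<le> K n" for n and x :: 'a
    using flat_nonneg[of n] flat_le_const[of "1 - x \<bullet> x" n] by (simp add: K_def)
  \<comment> \<open>Factors |x| cost nothing, since \<open>flat n (1 - x \<bullet> x)\<close>
    vanishes outside the unit ball.\<close>
  have flat_norm: "\<bar>flat n (1 - x \<bullet> x)\<bar> * norm x \<le> K n" for n and x :: 'a
  proof (cases "norm x \<le> 1")
    case True
    then have "\<bar>flat n (1 - x \<bullet> x)\<bar> * norm x \<le> K n * 1"
      using K[of n] flat_K[of n x] by (intro mult_mono) auto
    then show ?thesis by simp
  next
    case False
    then have "1 \<le> x \<bullet> x" using one_le_power[of "norm x" 2] by (simp add: dot_square_norm)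
    then show ?thesis using K[of n] by (simp add: flat_def)
  qed
  \<comment> \<open>\<open>V\<close> is minus one half of the gradient of the bump.\<close>
  define V :: "'a \<Rightarrow> 'a" where "V x = flat 2 (1 - x \<bullet> x) *\<^sub>R x" for x
  have h: "((\<lambda>x::'a. 1 - x \<bullet> x) has_derivative (\<lambda>b. - 2 * (x \<bullet> b))) (at x)" for x
    by (auto intro!: derivative_eq_intros simp: inner_commute fun_eq_iff)
  have D: "((\<lambda>x::'a. flat n (1 - x \<bullet> x)) has_derivative
      (\<lambda>b. (flat (n + 2) (1 - x \<bullet> x) - real n * flat (n + 1) (1 - x \<bullet> x)) * (- 2 * (x \<bullet> b)))) (at x)" for n x
    by (rule has_derivative_compose[OF h]) (use DERIV_flat[of n] in \<open>simp add: has_field_derivative_def\<close>)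
  have Dbump: "(bump has_derivative (\<lambda>b. - 2 * (V x \<bullet> b))) (at x)" for x :: 'a
    using D[of 0 x] by (simp add: bump_def[abs_def] V_def mult_ac numeral_2_eq_2)
  have V: "norm (V x) \<le> K 2" for x :: 'a
    using flat_norm[of 2 x] by (simp add: V_def)
  have 1: "\<bar>bump x - bump y\<bar> \<le> 2 * K 2 * norm (x - y)" for x y :: 'a
    unfolding real_norm_def[symmetric]
  proof (rule differentiable_bound[of UNIV bump "\<lambda>x b. - 2 * (V x \<bullet> b)"])
    show "onorm (\<lambda>b. - 2 * (V x \<bullet> b)) \<le> 2 * K 2" for x :: 'a
    proof (rule onorm_bound)
      fix b :: 'a
      have "\<bar>V x \<bullet> b\<bar> \<le> K 2 * norm b"
        using Cauchy_Schwarz_ineq2[of "V x" b] mult_right_mono[OF V[of x] norm_ge_zero[of b]] by linarith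
      then show "norm (- 2 * (V x \<bullet> b)) \<le> 2 * K 2 * norm b" by (simp add: abs_mult)
    qed (simp add: K)
  qed (use Dbump in auto)
  then show "\<exists>L\<ge>0. \<forall>x y::'a. \<bar>bump x - bump y\<bar> \<le> L * norm (x - y)"
    using K[of 2] by (intro exI[of _ "2 * K 2"]) auto
  \<comment> \<open>A bound for the derivative of \<open>V\<close>: \<open>K 2\<close> for the
    multiple of the identity, the rest for the rank one term, whose scalar factor is the derivative
    of \<open>flat 2 (1 - x \<bullet> x)\<close>.\<close>
  define M where "M = K 2 + 2 * (K 4 + 2 * K 3)"
  have M: "0 \<le> M" unfolding M_def using K[of 2] K[of 3] K[of 4] by simp
  have VL: "norm (V x - V y) \<le> M * norm (x - y)" for x y :: 'a
  proof (rule differentiable_bound[of UNIV V "\<lambda>x b. flat 2 (1 - x \<bullet> x) *\<^sub>R b +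
      ((flat 4 (1 - x \<bullet> x) - 2 * flat 3 (1 - x \<bullet> x)) * (- 2 * (x \<bullet> b))) *\<^sub>R x"])
    show "(V has_derivative (\<lambda>b. flat 2 (1 - x \<bullet> x) *\<^sub>R b +
      ((flat 4 (1 - x \<bullet> x) - 2 * flat 3 (1 - x \<bullet> x)) * (- 2 * (x \<bullet> b))) *\<^sub>R x)) (at x within UNIV)" for x
      unfolding V_def using has_derivative_scaleR[OF D[of 2 x] has_derivative_ident] by simp
    show "onorm (\<lambda>b. flat 2 (1 - x \<bullet> x) *\<^sub>R b +
      ((flat 4 (1 - x \<bullet> x) - 2 * flat 3 (1 - x \<bullet> x)) * (- 2 * (x \<bullet> b))) *\<^sub>R x) \<le> M" for x :: 'a
    proof (rule onorm_bound)
      fix b :: 'a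
      let ?f = "\<lambda>n. flat n (1 - x \<bullet> x)"
      have nx: "\<bar>?f n\<bar> * (norm x * norm x) \<le> K n" for n
      proof (cases "norm x \<le> 1")
        case True
        then have "\<bar>?f n\<bar> * norm x * norm x \<le> K n * 1"
          using K[of n] flat_norm[of n x] by (intro mult_mono) auto
        then show ?thesis by (simp add: mult.assoc)
      next
        case False
        then have "1 \<le> x \<bullet> x" using one_le_power[of "norm x" 2] by (simp add: dot_square_norm)
        then show ?thesis using K[of n] by (simp add: flat_def)
      qed
      have "norm (((?f 4 - 2 * ?f 3) * (- 2 * (x \<bullet> b))) *\<^sub>R x) = 2 * \<bar>?f 4 - 2 * ?f 3\<bar> * (\<bar>x \<bullet> b\<bar> * norm x)"
        by (simp add: abs_mult)
      also have "\<dots> \<le> 2 * (\<bar>?f 4\<bar> + 2 * \<bar>?f 3\<bar>) * ((norm x * norm b) * norm x)"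
        by (intro mult_mono mult_left_mono mult_right_mono Cauchy_Schwarz_ineq2) auto
      also have "\<dots> = 2 * (\<bar>?f 4\<bar> * (norm x * norm x) + 2 * (\<bar>?f 3\<bar> * (norm x * norm x))) * norm b"
        by (simp add: algebra_simps)
      also have "\<dots> \<le> 2 * (K 4 + 2 * K 3) * norm b"
        by (intro mult_mono mult_left_mono mult_right_mono add_mono nx) (use K in auto)
      finally have "norm (((?f 4 - 2 * ?f 3) * (- 2 * (x \<bullet> b))) *\<^sub>R x) \<le> 2 * (K 4 + 2 * K 3) * norm b" .
      moreover have "norm (?f 2 *\<^sub>R b) \<le> K 2 * norm b"
        using flat_K[of 2 x] by (simp add: mult_right_mono)
      ultimately show "norm (?f 2 *\<^sub>R b + ((?f 4 - 2 * ?f 3) * (- 2 * (x \<bullet> b))) *\<^sub>R x) \<le> M * norm b"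
        unfolding M_def distrib_right by (intro norm_triangle_le) linarith
    qed (rule M)
  qed auto
  have 2: "\<bar>(bump (x + h) - bump x) - (bump (y + h) - bump y)\<bar> \<le> 2 * (M * norm h) * norm (x - y)" for x y h :: 'a
    unfolding real_norm_def[symmetric]
  proof (rule differentiable_bound[of UNIV "\<lambda>x. bump (x + h) - bump x" "\<lambda>x b. - 2 * (V (x + h) \<bullet> b) - (- 2 * (V x \<bullet> b))"])
    have sh: "((\<lambda>x. x + h) has_derivative (\<lambda>b. b)) (at x)" for x
      by (auto intro!: derivative_eq_intros)
    show "((\<lambda>x. bump (x + h) - bump x) has_derivative (\<lambda>b. - 2 * (V (x + h) \<bullet> b) - (- 2 * (V x \<bullet> b)))) (at x within UNIV)" for x
      by (intro has_derivative_diff Dbump has_derivative_compose[OF sh Dbump])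
    show "onorm (\<lambda>b. - 2 * (V (x + h) \<bullet> b) - (- 2 * (V x \<bullet> b))) \<le> 2 * (M * norm h)" for x :: 'a
    proof (rule onorm_bound)
      fix b :: 'a
      have "\<bar>(V (x + h) - V x) \<bullet> b\<bar> \<le> (M * norm h) * norm b"
        using Cauchy_Schwarz_ineq2[of "V (x + h) - V x" b] mult_right_mono[OF VL[of "x + h" x] norm_ge_zero[of b]] by simp
      moreover have "- 2 * (V (x + h) \<bullet> b) - (- 2 * (V x \<bullet> b)) = - 2 * ((V (x + h) - V x) \<bullet> b)"
        by (simp add: inner_diff_left)
      ultimately show "norm (- 2 * (V (x + h) \<bullet> b) - (- 2 * (V x \<bullet> b))) \<le> 2 * (M * norm h) * norm b"
        by (simp add: abs_mult)
    qed (use M in simp)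
  qed auto
  then show "\<exists>L\<ge>0. \<forall>x y h::'a. \<bar>(bump (x + h) - bump x) - (bump (y + h) - bump y)\<bar> \<le> L * norm h * norm (x - y)"
    using M by (intro exI[of _ "2 * M"]) (auto simp: mult.assoc)
qed

lemma bump_min_Lipschitz:
  "\<exists>L>0. (\<forall>x y::'a::euclidean_space. \<bar>bump x - bump y\<bar> \<le> L * min 1 (norm (x - y))) \<and>
    (\<forall>x y h::'a. \<bar>(bump (x + h) - bump x) - (bump (y + h) - bump y)\<bar> \<le> L * norm h * min 1 (norm (x - y)))"
proof -
  obtain L1 where L1: "0 \<le> L1" "\<And>x y::'a. \<bar>bump x - bump y\<bar> \<le> L1 * norm (x - y)"
    using bump_Lipschitz(1) by blast
  obtain L2 where L2: "0 \<le> L2"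
    "\<And>x y h::'a. \<bar>(bump (x + h) - bump x) - (bump (y + h) - bump y)\<bar> \<le> L2 * norm h * norm (x - y)"
    using bump_Lipschitz(2) by blast
  \<comment> \<open>\<open>2 * L1\<close> bounds a mixed difference by |h| alone when the base
    points are far apart, \<open>L2\<close> handles close base points, and the summand 1 covers the
    oscillation of the bump itself.\<close>
  define L where "L = 2 * L1 + L2 + 1"
  have L: "0 < L" "1 \<le> L" "L1 \<le> L" "L2 \<le> L" "2 * L1 \<le> L" using L1(1) L2(1) by (auto simp: L_def)
  have "\<bar>bump x - bump y\<bar> \<le> L * min 1 (norm (x - y))" for x y :: 'a
  proof -
    have "\<bar>bump x - bump y\<bar> \<le> L"
      using bump_nonneg[of x] bump_nonneg[of y] bump_le_1[of x] bump_le_1[of y] L by linarith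
    moreover have "\<bar>bump x - bump y\<bar> \<le> L * norm (x - y)"
      using L1(2)[of x y] mult_right_mono[OF L(3), of "norm (x - y)"] by simp
    ultimately show ?thesis by (simp add: min_def)
  qed
  moreover have "\<bar>(bump (x + h) - bump x) - (bump (y + h) - bump y)\<bar> \<le> L * norm h * min 1 (norm (x - y))" for x y h :: 'a
  proof -
    have "\<bar>(bump (x + h) - bump x) - (bump (y + h) - bump y)\<bar> \<le> 2 * L1 * norm h"
      using L1(2)[of "x + h" x] L1(2)[of "y + h" y] by simp
    also have "\<dots> \<le> L * norm h" using L(5) by (rule mult_right_mono) simp
    finally have "\<bar>(bump (x + h) - bump x) - (bump (y + h) - bump y)\<bar> \<le> L * norm h" .
    moreover have "L2 * norm h * norm (x - y) \<le> L * norm h * norm (x - y)"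
      using L(4) by (intro mult_right_mono) auto
    ultimately show ?thesis using L2(2)[of x h y] by (simp add: min_def)
  qed
  ultimately show ?thesis using L(1) by blast
qed

subsection \<open>The jump integral of the bump\<close>

text \<open>The Householder reflection along \<open>w = x - y\<close> exchanges two vectors of equal
  norm; for \<open>w = 0\<close> the formula gives the identity.\<close>

lemma orthogonal_transformation_exists_norm_eq:
  fixes x y :: "'a::euclidean_space"
  assumes "norm x = norm y"
  obtains T where "orthogonal_transformation T" "T x = y"
proof -
  define w where "w = x - y"
  define T where "T z = z - (2 * (z \<bullet> w) / (w \<bullet> w)) *\<^sub>R w" for z
  have "linear T"
    by (rule linearI) (auto simp: T_def algebra_simps inner_add_left add_divide_distrib)
  moreover have "norm (T z) = norm z" for z
  proof (cases "w = 0")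
    case False
    then have "T z \<bullet> T z = z \<bullet> z"
      by (simp add: T_def inner_diff_left inner_diff_right inner_commute field_simps)
    then show ?thesis by (simp add: norm_eq_sqrt_inner)
  qed (simp add: T_def)
  moreover have "T x = y"
  proof (cases "w = 0")
    case False
    have "x \<bullet> x = y \<bullet> y" using assms by (simp add: norm_eq)
    then have "2 * (x \<bullet> w) = w \<bullet> w"
      by (simp add: w_def inner_diff_left inner_diff_right inner_commute)
    with False show ?thesis by (simp add: T_def w_def)
  qed (simp add: T_def w_def)
  ultimately show ?thesis
    using that by (auto simp: orthogonal_transformation)
qed

definition bump_jump :: "real \<Rightarrow> 'a::euclidean_space \<Rightarrow> real" where
  "bump_jump \<alpha> x = jump_int \<alpha> bump x"

definition bump_kern :: "real \<Rightarrow> 'a::euclidean_space \<Rightarrow> 'a \<Rightarrow> real" where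
  "bump_kern \<alpha> x y = (bump y - bump x) / norm (y - x) powr (real DIM('a) + \<alpha>)"

lemma bump_kern_measurable [measurable]:
  "(\<lambda>p. bump_kern \<alpha> (fst p) (snd p)) \<in> borel_measurable (borel \<Otimes>\<^sub>M borel)"
  "bump_kern \<alpha> x \<in> borel_measurable borel"
  unfolding bump_kern_def by measurable

lemma bump_jump_eq: "bump_jump \<alpha> x = (LINT y|lborel. bump_kern \<alpha> x y)"
  by (simp add: bump_jump_def jump_int_def bump_kern_def)

context
  fixes \<alpha> :: real
  assumes \<alpha>: "0 < \<alpha>" "\<alpha> < 1"
begin

lemma jump_integrable_bump: "jump_integrable \<alpha> (bump :: 'a::euclidean_space \<Rightarrow> real) x"
proof -
  obtain L where L: "\<forall>x y::'a. \<bar>bump x - bump y\<bar> \<le> L * min 1 (norm (x - y))"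
    using bump_min_Lipschitz by blast
  show ?thesis by (rule jump_integrable_Lipschitz[OF \<alpha>, of _ _ L]) (use L in auto)
qed

lemma integrable_bump_kern: "integrable lborel (bump_kern \<alpha> x)"
  using jump_integrable_bump[of x] by (simp add: jump_integrable_def bump_kern_def[abs_def])

text \<open>For |x| > 2 the bump vanishes at \<open>x\<close>, so only \<open>y\<close> in the unit
  ball contributes, and there |y - x| \<ge> (1 + |x|) / 4. For |x| \<le> 2 the Lipschitz bound
  suffices. The absolute value stays inside the integral because the estimate also serves to justify
  Fubini.\<close>

lemma bump_kern_decay:
  "\<exists>C>0. \<forall>x::'a::euclidean_space. (LINT y|lborel. \<bar>bump_kern \<alpha> x y\<bar>) \<le> C * decay \<alpha> x"
proof -
  let ?p = "real DIM('a) + \<alpha>"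
  obtain L where L: "0 < L" "\<forall>x y::'a. \<bar>bump x - bump y\<bar> \<le> L * min 1 (norm (x - y))"
    using bump_min_Lipschitz by blast
  define C where "C = L * jump_const TYPE('a) \<alpha> * 3 powr ?p + measure lborel (cball (0::'a) 1) * 4 powr ?p + 1"
  have C: "L * jump_const TYPE('a) \<alpha> * 3 powr ?p \<le> C" "measure lborel (cball (0::'a) 1) * 4 powr ?p \<le> C" "0 < C"
    using L jump_const_nonneg[where 'a='a, of \<alpha>] by (auto simp: C_def add_nonneg_pos)
  have "(LINT y|lborel. \<bar>bump_kern \<alpha> x y\<bar>) \<le> C * decay \<alpha> x" for x :: 'a
  proof (cases "norm x \<le> 2")
    case True
    have "(LINT y|lborel. \<bar>bump_kern \<alpha> x y\<bar>) \<le> L * jump_const TYPE('a) \<alpha>"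
      unfolding bump_kern_def by (rule jump_int_abs_le[OF \<alpha>]) (use L in auto)
    also have "\<dots> = L * jump_const TYPE('a) \<alpha> * 3 powr ?p * 3 powr (- ?p)"
      by (simp add: powr_add[symmetric] mult.assoc)
    also have "\<dots> \<le> C * 3 powr (- ?p)" using C by (intro mult_right_mono) auto
    also have "3 powr (- ?p) \<le> (1 + norm x) powr (- ?p)"
      using True \<alpha> by (intro powr_mono2') (auto intro: add_pos_nonneg)
    then have "C * 3 powr (- ?p) \<le> C * decay \<alpha> x" using C by (simp add: decay_def)
    finally show ?thesis .
  next
    case False
    have le: "\<bar>bump_kern \<alpha> x y\<bar> \<le> indicator (cball 0 1) y * (4 powr ?p * decay \<alpha> x)" for y
    proof (cases "norm y \<le> 1")
      case True
      have "(1 + norm x) / 4 \<le> norm (y - x)"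
        using False True norm_triangle_ineq2[of x y] norm_minus_commute[of x y] by simp
      then have "((1 + norm x) / 4) powr ?p \<le> norm (y - x) powr ?p"
        using \<alpha> by (intro powr_mono2) auto
      then have "(1 + norm x) powr ?p / 4 powr ?p \<le> norm (y - x) powr ?p"
        by (simp add: powr_divide)
      moreover have "\<bar>bump y - bump x\<bar> \<le> 1"
        using False bump_eq_0[of x] bump_nonneg[of y] bump_le_1[of y] by simp
      moreover have "0 < (1 + norm x) powr ?p"
        using norm_ge_zero[of x] by (auto simp: powr_gt_zero add_nonneg_eq_0_iff)
      ultimately have "\<bar>bump y - bump x\<bar> / norm (y - x) powr ?p \<le> 1 / ((1 + norm x) powr ?p / 4 powr ?p)"
        by (intro frac_le) auto
      with True show ?thesis
        using powr_minus_divide[of "1 + norm x" ?p] by (simp add: bump_kern_def abs_divide decay_def)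
    next
      case False
      with \<open>\<not> norm x \<le> 2\<close> show ?thesis by (simp add: bump_kern_def bump_eq_0)
    qed
    have "(LINT y|lborel. \<bar>bump_kern \<alpha> x y\<bar>) \<le> (LINT y|lborel. indicator (cball 0 1) (y::'a) * (4 powr ?p * decay \<alpha> x))"
    proof (rule integral_mono)
      show "integrable lborel (\<lambda>y. \<bar>bump_kern \<alpha> x y\<bar>)" by (intro integrable_abs integrable_bump_kern)
      show "integrable lborel (\<lambda>y. indicator (cball 0 1) (y::'a) * (4 powr ?p * decay \<alpha> x))"
        using emeasure_lborel_cball_finite[of "0::'a" 1] by (intro integrable_mult_left) (simp add: less_top)
    qed (rule le)
    also have "\<dots> = measure lborel (cball (0::'a) 1) * 4 powr ?p * decay \<alpha> x"
      by simp
    also have "\<dots> \<le> C * decay \<alpha> x" using C decay_pos[of \<alpha> x] by (intro mult_right_mono) auto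
    finally show ?thesis .
  qed
  with C show ?thesis by blast
qed

lemma bump_jump_decay: "\<exists>C>0. \<forall>x::'a::euclidean_space. \<bar>bump_jump \<alpha> x\<bar> \<le> C * decay \<alpha> x"
proof -
  obtain C where "0 < C" and C: "\<And>x::'a. (LINT y|lborel. \<bar>bump_kern \<alpha> x y\<bar>) \<le> C * decay \<alpha> x"
    using bump_kern_decay by blast
  moreover have "\<bar>bump_jump \<alpha> x\<bar> \<le> C * decay \<alpha> x" for x :: 'a
    unfolding bump_jump_eq by (rule order_trans[OF integral_abs_bound C])
  ultimately show ?thesis by blast
qed

lemma bump_jump_translate: "bump_jump \<alpha> (x + h) = jump_int \<alpha> (\<lambda>y. bump (y + h)) x"
proof -
  have "bump_jump \<alpha> (x + h) = (LINT y|lborel. bump_kern \<alpha> (x + h) (y - - h))"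
    unfolding bump_jump_eq by (rule integral_lborel_shift[symmetric])
  then show ?thesis by (simp add: jump_int_def bump_kern_def algebra_simps)
qed

text \<open>A translation passes onto the bump, so the difference is the jump integral of an
  increment of the bump, whose modulus L |h| min(1, |x - y|) is integrable against the jump
  kernel.\<close>

lemma bump_jump_Lipschitz:
  "\<exists>C>0. \<forall>x y::'a::euclidean_space. \<bar>bump_jump \<alpha> x - bump_jump \<alpha> y\<bar> \<le> C * norm (x - y)"
proof -
  obtain L where L: "0 < L" "\<And>x y::'a. \<bar>bump x - bump y\<bar> \<le> L * min 1 (norm (x - y))"
    "\<And>x y h::'a. \<bar>(bump (x + h) - bump x) - (bump (y + h) - bump y)\<bar> \<le> L * norm h * min 1 (norm (x - y))"
    using bump_min_Lipschitz by blast
  have "\<bar>bump_jump \<alpha> (y + h) - bump_jump \<alpha> y\<bar> \<le> (L * jump_const TYPE('a) \<alpha> + 1) * norm h" for y h :: 'a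
  proof -
    have 1: "jump_integrable \<alpha> (\<lambda>z. bump (z + h)) y"
      by (rule jump_integrable_Lipschitz[OF \<alpha>, of _ _ L]) (use L(2)[of "_ + h" "y + h"] in auto)
    have "bump_jump \<alpha> (y + h) - bump_jump \<alpha> y = jump_int \<alpha> (\<lambda>z. bump (z + h) - bump z) y"
      unfolding bump_jump_translate unfolding bump_jump_def
      using jump_int_diff[OF 1 jump_integrable_bump] by simp
    then have "\<bar>bump_jump \<alpha> (y + h) - bump_jump \<alpha> y\<bar> \<le> L * norm h * jump_const TYPE('a) \<alpha>"
      by (simp only:) (rule order_trans[OF abs_jump_int_le jump_int_abs_le[OF \<alpha>]], use L(3) in auto)
    also have "\<dots> \<le> (L * jump_const TYPE('a) \<alpha> + 1) * norm h" by (simp add: algebra_simps)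
    finally show ?thesis .
  qed
  from this[of "y" "x - y" for x y] have "\<bar>bump_jump \<alpha> x - bump_jump \<alpha> y\<bar> \<le> (L * jump_const TYPE('a) \<alpha> + 1) * norm (x - y)" for x y :: 'a
    by simp
  moreover have "0 < L * jump_const TYPE('a) \<alpha> + 1"
    using L jump_const_nonneg[where 'a='a, of \<alpha>] by (intro add_nonneg_pos) auto
  ultimately show ?thesis by blast
qed

lemma continuous_on_bump_jump: "continuous_on S (bump_jump \<alpha> :: 'a::euclidean_space \<Rightarrow> real)"
proof -
  obtain C where C: "0 < C" "\<And>x y::'a. \<bar>bump_jump \<alpha> x - bump_jump \<alpha> y\<bar> \<le> C * norm (x - y)"
    using bump_jump_Lipschitz by blast
  then have "C-lipschitz_on S (bump_jump \<alpha> :: 'a \<Rightarrow> real)"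
    by (intro lipschitz_onI) (auto simp: dist_norm)
  then show ?thesis by (rule lipschitz_on_continuous_on)
qed

lemma bump_jump_measurable: "bump_jump \<alpha> \<in> borel_measurable borel"
  by (rule borel_measurable_continuous_onI[OF continuous_on_bump_jump])

text \<open>Radiality is what allows the one-dimensional integral in \<open>kern\<close> to be read
  as an integral over a ball, where Fubini and antisymmetry determine its sign.\<close>

lemma bump_jump_norm_cong:
  fixes x y :: "'a::euclidean_space"
  assumes "norm x = norm y"
  shows "bump_jump \<alpha> x = bump_jump \<alpha> y"
proof -
  obtain T :: "'a \<Rightarrow> 'a" where T: "orthogonal_transformation T" "T x = y"
    using orthogonal_transformation_exists_norm_eq[OF assms] .
  have lin: "linear T" using T by (simp add: orthogonal_transformation_def)
  have "bump_kern \<alpha> y (T z) = bump_kern \<alpha> x z" for z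
  proof -
    have "T z - y = T (z - x)" using T by (simp add: linear_diff[OF lin])
    then have "norm (T z - y) = norm (z - x)" using T by (simp add: orthogonal_transformation_norm)
    moreover have "bump (T z) = bump z" by (rule bump_norm_cong) (simp add: orthogonal_transformation_norm[OF T(1)])
    moreover have "bump y = bump x" by (rule bump_norm_cong) (simp add: assms)
    ultimately show ?thesis by (simp add: bump_kern_def)
  qed
  then show ?thesis
    unfolding bump_jump_eq using integral_orthogonal_transformation[OF T(1), of "bump_kern \<alpha> y"] by simp
qed

text \<open>The substitution w = s (x - z) yields s^(d+\<alpha>) from the kernel and s^(-d) from the
  volume element; the remaining s^\<alpha> is the homogeneity of the operator.\<close>

lemma jump_scaled_bump:
  fixes x y :: "'a::euclidean_space"
  assumes s: "0 < s"
  shows "jump_integrable \<alpha> (\<lambda>z. bump (s *\<^sub>R (x - z))) y"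
    and "jump_int \<alpha> (\<lambda>z. bump (s *\<^sub>R (x - z))) y = s powr \<alpha> * bump_jump \<alpha> (s *\<^sub>R (x - y))"
proof -
  let ?p = "real DIM('a) + \<alpha>"
  let ?F = "\<lambda>z. (bump (s *\<^sub>R (x - z)) - bump (s *\<^sub>R (x - y))) / norm (z - y) powr ?p"
  have F: "?F (x + (-1/s) *\<^sub>R w) = s powr ?p * bump_kern \<alpha> (s *\<^sub>R (x - y)) w" for w
  proof -
    have "x + (-1/s) *\<^sub>R w - y = (-1/s) *\<^sub>R (w - s *\<^sub>R (x - y))"
      using s by (simp add: algebra_simps)
    then have "norm (x + (-1/s) *\<^sub>R w - y) = norm (w - s *\<^sub>R (x - y)) / s"
      using s by (simp only: norm_scaleR) simp
    moreover have "s *\<^sub>R (x - (x + (-1/s) *\<^sub>R w)) = w" using s by simp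
    ultimately show ?thesis
      using s by (simp only: bump_kern_def) (simp add: powr_divide)
  qed
  have s0: "(-1/s) \<noteq> 0" using s by simp
  show "jump_integrable \<alpha> (\<lambda>z. bump (s *\<^sub>R (x - z))) y"
    unfolding jump_integrable_def
    by (subst integrable_affine_euclidean_iff[OF s0, of ?F x, symmetric], unfold F)
      (intro integrable_mult_right integrable_bump_kern)
  have "jump_int \<alpha> (\<lambda>z. bump (s *\<^sub>R (x - z))) y = \<bar>-1/s\<bar> ^ DIM('a) * (LINT w|lborel. s powr ?p * bump_kern \<alpha> (s *\<^sub>R (x - y)) w)"
    unfolding jump_int_def by (subst integral_affine_euclidean[OF s0, of ?F x], unfold F) simp
  also have "\<dots> = \<bar>-1/s\<bar> ^ DIM('a) * (s powr ?p * bump_jump \<alpha> (s *\<^sub>R (x - y)))"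
    unfolding bump_jump_eq by (simp only: integral_mult_right_zero)
  also have "\<bar>-1/s\<bar> ^ DIM('a) * s powr ?p = s powr \<alpha>"
    using s by (simp add: powr_add powr_realpow power_divide)
  then have "\<bar>-1/s\<bar> ^ DIM('a) * (s powr ?p * bump_jump \<alpha> (s *\<^sub>R (x - y))) = s powr \<alpha> * bump_jump \<alpha> (s *\<^sub>R (x - y))"
    by (simp only: mult.assoc[symmetric])
  finally show "jump_int \<alpha> (\<lambda>z. bump (s *\<^sub>R (x - z))) y = s powr \<alpha> * bump_jump \<alpha> (s *\<^sub>R (x - y))" .
qed

lemma frac_lap_scaled_bump:
  fixes x y :: "'a::euclidean_space"
  assumes "0 < s"
  shows "frac_lap \<alpha> (\<lambda>z. bump (s *\<^sub>R (x - z))) y =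
    riesz_const DIM('a) (- \<alpha>) * (s powr \<alpha> * bump_jump \<alpha> (s *\<^sub>R (x - y)))"
  using frac_lap_eq_jump_int(2)[OF jump_scaled_bump(1)[OF assms, of x y]] jump_scaled_bump(2)[OF assms, of x y] by simp

lemma integrable_bump_jump: "integrable lborel (bump_jump \<alpha> :: 'a::euclidean_space \<Rightarrow> real)"
proof -
  obtain C where "0 < C" and C: "\<And>x::'a. \<bar>bump_jump \<alpha> x\<bar> \<le> C * decay \<alpha> x"
    using bump_jump_decay by blast
  have "integrable lborel (\<lambda>x::'a. C * decay \<alpha> x)"
    using \<alpha> by (intro integrable_mult_right integrable_decay) auto
  then show ?thesis
    by (rule Bochner_Integration.integrable_bound)
       (use C bump_jump_measurable in \<open>auto intro!: AE_I2 intro: order_trans[OF C abs_ge_self]\<close>)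
qed

subsection \<open>The jump integral of the bump over balls\<close>

lemma integrable_bump_kern_pair:
  "integrable (lborel \<Otimes>\<^sub>M lborel) (\<lambda>(x, y). bump_kern \<alpha> (x::'a::euclidean_space) y)"
proof (rule lborel_pair.Fubini_integrable)
  obtain C where "0 < C" and C: "\<And>x::'a. (LINT y|lborel. \<bar>bump_kern \<alpha> x y\<bar>) \<le> C * decay \<alpha> x"
    using bump_kern_decay by blast
  have "integrable lborel (\<lambda>x::'a. C * decay \<alpha> x)"
    using \<alpha> by (intro integrable_mult_right integrable_decay) auto
  then show "integrable lborel (\<lambda>x::'a. LINT y|lborel. norm (case (x, y) of (x, y) \<Rightarrow> bump_kern \<alpha> x y))"
  proof (rule Bochner_Integration.integrable_bound)
    show "AE x in lborel. norm (LINT y|lborel. norm (case (x::'a, y) of (x, y) \<Rightarrow> bump_kern \<alpha> x y)) \<le> norm (C * decay \<alpha> x)"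
      using C \<open>0 < C\<close> by (intro AE_I2) (auto intro: order_trans[OF _ abs_ge_self])
  qed (simp add: bump_kern_def split_beta')
  show "AE x in lborel. integrable lborel (\<lambda>y. case (x::'a, y) of (x, y) \<Rightarrow> bump_kern \<alpha> x y)"
    by (simp add: integrable_bump_kern)
qed (simp add: bump_kern_def split_beta')

lemma integral_antisymmetric_eq_0:
  fixes F :: "'a::euclidean_space \<Rightarrow> 'a \<Rightarrow> real"
  assumes "integrable (lborel \<Otimes>\<^sub>M lborel) (\<lambda>(x, y). F x y)" and "\<And>x y. F y x = - F x y"
  shows "(LINT x|lborel. LINT y|lborel. F x y) = 0"
proof -
  have "(LINT x|lborel. LINT y|lborel. F x y) = (LINT y|lborel. LINT x|lborel. F x y)"
    by (rule lborel_pair.Fubini_integral[symmetric]) (use assms(1) in simp)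
  also have "\<dots> = (LINT y|lborel. LINT x|lborel. - F y x)"
    by (intro Bochner_Integration.integral_cong refl assms(2))
  also have "\<dots> = - (LINT y|lborel. LINT x|lborel. F y x)" by simp
  finally show ?thesis by simp
qed

lemma bump_kern_antisym: "bump_kern \<alpha> y x = - bump_kern \<alpha> x y"
  by (simp add: bump_kern_def norm_minus_commute[of x y] minus_divide_left)

lemma integral_bump_jump: "(LINT x|lborel. bump_jump \<alpha> (x::'a::euclidean_space)) = 0"
  unfolding bump_jump_eq
  by (intro integral_antisymmetric_eq_0 integrable_bump_kern_pair bump_kern_antisym)

text \<open>Jumps between two points of the ball cancel by antisymmetry of \<open>bump_kern\<close>;
  only jumps from the ball to its complement survive.\<close>

lemma integral_bump_jump_ball:
  "(LINT x|lborel. indicator (ball 0 R) x * bump_jump \<alpha> (x::'a::euclidean_space)) =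
   (LINT x|lborel. LINT y|lborel. indicator (ball 0 R) x * indicator (- ball 0 R) y * bump_kern \<alpha> (x::'a) y)"
  and integrable_bump_kern_ball:
  "integrable (lborel \<Otimes>\<^sub>M lborel) (\<lambda>(x, y). indicator (ball 0 R) x * indicator (- ball 0 R) y * bump_kern \<alpha> (x::'a) y)"
proof -
  let ?B = "ball (0::'a) R"
  have [measurable]: "- ?B \<in> sets borel" by (auto intro: borel_comp)
  have int: "integrable (lborel \<Otimes>\<^sub>M lborel) (\<lambda>(x, y). indicator ?B x * indicator A y * bump_kern \<alpha> x y)"
    if [measurable]: "A \<in> sets borel" for A
    by (rule Bochner_Integration.integrable_bound[OF integrable_bump_kern_pair])
       (auto simp: split_beta' indicator_def bump_kern_def)
  from int[of "- ?B"] show "integrable (lborel \<Otimes>\<^sub>M lborel) (\<lambda>(x, y). indicator ?B x * indicator (- ?B) y * bump_kern \<alpha> x y)"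
    by simp
  let ?G = "\<lambda>A x. LINT y|lborel. indicator ?B x * indicator A y * bump_kern \<alpha> x y"
  have ik: "integrable lborel (\<lambda>y. indicator ?B x * indicator A y * bump_kern \<alpha> x y)"
    if [measurable]: "A \<in> sets borel" for A x
    by (rule Bochner_Integration.integrable_bound[OF integrable_bump_kern[of x]]) (auto simp: indicator_def)
  have "(LINT x|lborel. indicator ?B x * bump_jump \<alpha> x) = (LINT x|lborel. ?G ?B x + ?G (- ?B) x)"
  proof (rule Bochner_Integration.integral_cong)
    fix x
    have "?G ?B x + ?G (- ?B) x =
      (LINT y|lborel. indicator ?B x * indicator ?B y * bump_kern \<alpha> x y + indicator ?B x * indicator (- ?B) y * bump_kern \<alpha> x y)"
      by (rule Bochner_Integration.integral_add[OF ik ik, symmetric]) measurable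
    also have "\<dots> = (LINT y|lborel. indicator ?B x * bump_kern \<alpha> x y)"
      by (rule Bochner_Integration.integral_cong) (auto simp: indicator_def)
    finally have "?G ?B x + ?G (- ?B) x = (LINT y|lborel. indicator ?B x * bump_kern \<alpha> x y)" .
    then show "indicator ?B x * bump_jump \<alpha> x = ?G ?B x + ?G (- ?B) x"
      by (simp add: bump_jump_eq)
  qed simp
  also have "\<dots> = (LINT x|lborel. ?G ?B x) + (LINT x|lborel. ?G (- ?B) x)"
    using lborel_pair.integrable_fst[OF int[of ?B]] lborel_pair.integrable_fst[OF int[of "- ?B"]]
    by (intro Bochner_Integration.integral_add) auto
  also have "(LINT x|lborel. ?G ?B x) = 0"
  proof -
    have 1: "indicator ?B y * indicator ?B x * bump_kern \<alpha> y x = - (indicator ?B x * indicator ?B y * bump_kern \<alpha> x y)" for x y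
      using bump_kern_antisym[of y x] by simp
    have 2: "integrable (lborel \<Otimes>\<^sub>M lborel) (\<lambda>(x, y). indicator ?B x * indicator ?B y * bump_kern \<alpha> x y)"
      by (rule int) measurable
    show ?thesis by (rule integral_antisymmetric_eq_0[OF 2 1])
  qed
  finally show "(LINT x|lborel. indicator ?B x * bump_jump \<alpha> x) = (LINT x|lborel. ?G (- ?B) x)" by simp
qed

lemma bump_antimono: "norm x \<le> norm y \<Longrightarrow> bump y \<le> bump x"
proof -
  assume le: "norm x \<le> norm y"
  show ?thesis
  proof (cases "norm y < 1")
    case True
    have "x \<bullet> x \<le> y \<bullet> y" using le by (simp add: dot_square_norm)
    moreover have "y \<bullet> y < 1" using True power_strict_mono[of "norm y" 1 2] by (simp add: dot_square_norm)
    ultimately show ?thesis by (simp add: bump_def flat_def frac_le)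
  next
    case False
    then show ?thesis using bump_nonneg[of x] by (simp add: bump_eq_0)
  qed
qed

text \<open>The bump decreases with the distance from the origin, so every jump out of a centred
  ball goes down.\<close>

lemma integral_bump_jump_ball_nonpos:
  "(LINT x|lborel. indicator (ball 0 R) x * bump_jump \<alpha> (x::'a::euclidean_space)) \<le> 0"
proof -
  have "indicator (ball 0 R) x * indicator (- ball 0 R) y * bump_kern \<alpha> x y \<le> 0" for x y :: 'a
    using bump_antimono[of x y] by (auto simp: indicator_def bump_kern_def divide_le_0_iff)
  then have "0 \<le> (LINT x|lborel. LINT y|lborel. - (indicator (ball 0 R) x * indicator (- ball 0 R) y * bump_kern \<alpha> (x::'a) y))"
    by (intro Bochner_Integration.integral_nonneg) simp
  then show ?thesis by (subst integral_bump_jump_ball) simp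
qed

text \<open>Strictness needs a set of jumps of positive measure with a fixed loss: from the ball of
  radius 1/2, where the bump is bounded below, to a unit ball around \<open>3 *\<^sub>R e\<close>,
  where it vanishes.\<close>

lemma integral_bump_jump_ball_neg:
  "(LINT x|lborel. indicator (ball 0 1) x * bump_jump \<alpha> (x::'a::euclidean_space)) < 0"
proof -
  let ?p = "real DIM('a) + \<alpha>"
  obtain e :: 'a where "e \<in> Basis" using nonempty_Basis by blast
  then have e: "norm e = 1" by simp
  obtain e' :: 'a where e': "norm e' = 1/2" using e by (metis norm_scaleR abs_of_pos half_gt_zero_iff mult.right_neutral zero_less_one)
  \<comment> \<open>On the ball of radius 1/2 the bump is at least its value on the bounding sphere,
    and the jumps considered have length at most 5.\<close>
  define c where "c = bump e' / 5 powr ?p"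
  have c: "0 < c" using e' bump_pos[of e'] by (simp add: c_def)
  let ?A = "ball (0::'a) (1/2)" and ?C = "ball ((3::real) *\<^sub>R e) 1"
  let ?g = "\<lambda>x y. - (indicator (ball 0 1) x * indicator (- ball 0 1) y * bump_kern \<alpha> (x::'a) y)"
  let ?h = "\<lambda>x y. c * indicator ?A x * indicator ?C y"
  have le: "?h x y \<le> ?g x y" for x y
  proof (cases "x \<in> ?A \<and> y \<in> ?C")
    case True
    have y: "1 < norm y" "norm y < 4"
      using True e norm_triangle_ineq2[of "3 *\<^sub>R e" y] norm_triangle_ineq2[of y "3 *\<^sub>R e"]
      by (auto simp: dist_norm norm_minus_commute)
    then have "norm (y - x) \<le> 5" using True norm_triangle_ineq4[of y x] by simp
    then have 1: "norm (y - x) powr ?p \<le> 5 powr ?p" using \<alpha> by (intro powr_mono2) auto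
    have "norm (y - x) \<noteq> 0" using y True by auto
    then have 2: "0 < norm (y - x) powr ?p" by simp
    have "bump e' \<le> bump x" using True e' by (intro bump_antimono) auto
    then have "c \<le> bump x / norm (y - x) powr ?p"
      unfolding c_def using 1 2 bump_nonneg[of x] by (intro frac_le) auto
    then show ?thesis using True y by (auto simp: bump_kern_def bump_eq_0 indicator_def)
  next
    case False
    have "0 \<le> ?g x y"
      using bump_antimono[of x y] by (auto simp: indicator_def bump_kern_def divide_le_0_iff)
    then show ?thesis using False by (auto simp: indicator_def)
  qed
  have fin: "emeasure lborel ?A < \<infinity>" "emeasure lborel ?C < \<infinity>" by (rule emeasure_lborel_ball_finite)+
  have ig: "integrable lborel (\<lambda>y. ?g x y)" for x
    by (intro integrable_minus, rule Bochner_Integration.integrable_bound[OF integrable_bump_kern[of x]]) (auto simp: indicator_def borel_comp)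
  have ih: "integrable lborel (\<lambda>y. ?h x y)" for x
    using fin by (intro integrable_mult_right) (auto simp: less_top)
  have "0 < c * measure lborel ?A * measure lborel ?C"
    using c content_ball_pos[of "1/2" "0::'a"] content_ball_pos[of 1 "3 *\<^sub>R e"] by simp
  also have "\<dots> = (LINT x|lborel. c * indicator ?A x * measure lborel ?C)"
    using fin by simp
  also have "\<dots> = (LINT x|lborel. LINT y|lborel. ?h x y)"
    using fin by simp
  also have "\<dots> \<le> (LINT x|lborel. LINT y|lborel. ?g x y)"
  proof (rule integral_mono)
    show "integrable lborel (\<lambda>x. LINT y|lborel. ?h x y)" using fin by (simp add: less_top)
    show "integrable lborel (\<lambda>x. LINT y|lborel. ?g x y)"
      using lborel_pair.integrable_fst[OF integrable_bump_kern_ball[of 1]] by simp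
    show "(LINT y|lborel. ?h x y) \<le> (LINT y|lborel. ?g x y)" for x
      by (rule integral_mono[OF ih ig le])
  qed
  also have "\<dots> = - (LINT x|lborel. indicator (ball 0 1) x * bump_jump \<alpha> (x::'a))"
    by (subst integral_bump_jump_ball) simp
  finally show ?thesis by simp
qed

end

subsection \<open>The approximate identity\<close>

definition kern :: "real \<Rightarrow> real \<Rightarrow> 'a::euclidean_space \<Rightarrow> real" where
  "kern \<alpha> S z = - (LINT s:{0<..<S}|lborel. s ^ (DIM('a) - 1) * bump_jump \<alpha> (s *\<^sub>R z))"

context
  fixes \<alpha> :: real
  assumes \<alpha>: "0 < \<alpha>" "\<alpha> < 1"
begin

lemma continuous_on_bump_jump_compose [continuous_intros]:
  fixes f :: "'b::topological_space \<Rightarrow> 'a::euclidean_space"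
  shows "continuous_on S f \<Longrightarrow> continuous_on S (\<lambda>x. bump_jump \<alpha> (f x))"
  by (rule continuous_on_compose2[OF continuous_on_bump_jump[OF \<alpha>, of UNIV]]) auto

lemmas [measurable] = bump_jump_measurable[OF \<alpha>]

lemma kern_integrable:
  "set_integrable lborel {a..b} (\<lambda>s. s ^ n * bump_jump \<alpha> (s *\<^sub>R z))"
  by (intro borel_integrable_atLeastAtMost' continuous_intros)

lemma kern_eq_Icc:
  fixes z :: "'a::euclidean_space"
  shows "kern \<alpha> S z = - (LINT s:{0..S}|lborel. s ^ (DIM('a) - 1) * bump_jump \<alpha> (s *\<^sub>R z))"
proof -
  have "(LINT s:{0<..<S}|lborel. s ^ (DIM('a) - 1) * bump_jump \<alpha> (s *\<^sub>R z)) = (LINT s:{0..S}|lborel. s ^ (DIM('a) - 1) * bump_jump \<alpha> (s *\<^sub>R z))"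
    unfolding set_lebesgue_integral_def
  proof (rule integral_cong_AE)
    show "AE s in lborel. indicator {0<..<S} s *\<^sub>R (s ^ (DIM('a) - 1) * bump_jump \<alpha> (s *\<^sub>R z)) =
        indicator {0..S} s *\<^sub>R (s ^ (DIM('a) - 1) * bump_jump \<alpha> (s *\<^sub>R z))"
      using AE_lborel_singleton[of 0] AE_lborel_singleton[of S]
      by eventually_elim (auto simp: indicator_def)
  qed measurable
  then show ?thesis by (simp add: kern_def)
qed

lemma kern_diff:
  fixes z :: "'a::euclidean_space"
  assumes "0 \<le> R" "R \<le> S"
  shows "kern \<alpha> S z - kern \<alpha> R z = - (LINT s:{R..S}|lborel. s ^ (DIM('a) - 1) * bump_jump \<alpha> (s *\<^sub>R z))"
proof -
  let ?f = "\<lambda>s. s ^ (DIM('a) - 1) * bump_jump \<alpha> (s *\<^sub>R z)"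
  have "(LINT s:{0..S}|lborel. ?f s) = (LINT s:{0..R} \<union> {R..S}|lborel. ?f s)"
    using assms by (simp add: ivl_disj_un_two_touch)
  also have "\<dots> = (LINT s:{0..R}|lborel. ?f s) + (LINT s:{R..S}|lborel. ?f s)"
    using AE_lborel_singleton[of R]
    by (intro set_integral_Un_AE kern_integrable) (auto elim: eventually_mono)
  finally show ?thesis by (simp add: kern_eq_Icc)
qed

lemma kern_scaleR:
  fixes z :: "'a::euclidean_space"
  assumes c: "0 < c"
  shows "kern \<alpha> S (c *\<^sub>R z) = kern \<alpha> (c * S) z / c ^ DIM('a)"
proof -
  let ?f = "\<lambda>s. indicator {0<..<c * S} s *\<^sub>R (s ^ (DIM('a) - 1) * bump_jump \<alpha> (s *\<^sub>R z))"
  have "(LINT s|lborel. ?f s) = \<bar>c\<bar> *\<^sub>R (LINT s|lborel. ?f (0 + c * s))"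
    using c by (intro lborel_integral_real_affine) auto
  also have "\<dots> = c * (LINT s|lborel. c ^ (DIM('a) - 1) * (indicator {0<..<S} s *\<^sub>R (s ^ (DIM('a) - 1) * bump_jump \<alpha> (s *\<^sub>R c *\<^sub>R z))))"
    using c by (auto intro!: Bochner_Integration.integral_cong simp: indicator_def power_mult_distrib zero_less_mult_iff mult_ac)
  also have "\<dots> = c ^ DIM('a) * (LINT s|lborel. indicator {0<..<S} s *\<^sub>R (s ^ (DIM('a) - 1) * bump_jump \<alpha> (s *\<^sub>R c *\<^sub>R z)))"
    by (simp only: integral_mult_right_zero mult.assoc[symmetric])
       (simp add: power_eq_if)
  finally show ?thesis using c by (simp add: kern_def set_lebesgue_integral_def field_simps)
qed

lemma kern_eq_scaled:
  fixes z :: "'a::euclidean_space"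
  assumes "0 < S"
  shows "kern \<alpha> S z = S ^ DIM('a) * kern \<alpha> 1 (S *\<^sub>R z)"
  using kern_scaleR[OF assms, of 1 z] assms by simp

text \<open>Polar coordinates; the factor is the area of the unit sphere. In particular the value
  does not depend on the unit vector \<open>u\<close>.\<close>

lemma kern_unit:
  fixes u :: "'a::euclidean_space"
  assumes u: "norm u = 1"
  shows "real DIM('a) * unit_ball_vol DIM('a) * kern \<alpha> R u = - (LINT x|lborel. indicator (ball 0 R) x * bump_jump \<alpha> (x::'a))"
proof -
  have "(LINT x|lborel. indicator (ball 0 R) x * bump_jump \<alpha> (x::'a)) =
    (LINT x|lborel. indicator {..<R} (norm (x::'a)) * bump_jump \<alpha> (norm x *\<^sub>R u))"
    using u by (intro Bochner_Integration.integral_cong refl arg_cong2[where f="(*)"] bump_jump_norm_cong[OF \<alpha>])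
      (auto simp: indicator_def)
  also have "\<dots> = real DIM('a) * unit_ball_vol DIM('a) * (LINT s:{0<..}|lborel. s ^ (DIM('a) - 1) * (indicator {..<R} s * bump_jump \<alpha> (s *\<^sub>R u)))"
    by (rule integral_radial) measurable
  also have "(LINT s:{0<..}|lborel. s ^ (DIM('a) - 1) * (indicator {..<R} s * bump_jump \<alpha> (s *\<^sub>R u))) =
    (LINT s:{0<..<R}|lborel. s ^ (DIM('a) - 1) * bump_jump \<alpha> (s *\<^sub>R u))"
    unfolding set_lebesgue_integral_def by (rule Bochner_Integration.integral_cong) (auto simp: indicator_def)
  finally show ?thesis by (simp add: kern_def)
qed

lemma dim_ball_vol_pos: "0 < real DIM('a::euclidean_space) * unit_ball_vol DIM('a)"
  by simp

lemma kern_unit_nonneg: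
  fixes u :: "'a::euclidean_space"
  assumes u: "norm u = 1"
  shows "0 \<le> kern \<alpha> R u"
proof -
  have "0 \<le> real DIM('a) * unit_ball_vol DIM('a) * kern \<alpha> R u"
    unfolding kern_unit[OF u] using integral_bump_jump_ball_nonpos[OF \<alpha>, where 'a='a] by simp
  then show ?thesis using dim_ball_vol_pos[where 'a='a] by (simp only: zero_le_mult_iff) auto
qed

lemma kern_unit_pos:
  fixes u :: "'a::euclidean_space"
  assumes u: "norm u = 1"
  shows "0 < kern \<alpha> 1 u"
proof -
  have "0 < real DIM('a) * unit_ball_vol DIM('a) * kern \<alpha> 1 u"
    unfolding kern_unit[OF u] using integral_bump_jump_ball_neg[OF \<alpha>, where 'a='a] by simp
  then show ?thesis using dim_ball_vol_pos[where 'a='a] by (rule zero_less_mult_pos)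
qed

section \<open>Decay and increments of the approximate identity\<close>

lemma decay_le_powr:
  fixes x :: "'a::euclidean_space"
  assumes "x \<noteq> 0"
  shows "decay \<alpha> x \<le> norm x powr (- (real DIM('a) + \<alpha>))"
  unfolding decay_def using assms \<alpha>
    powr_mono2'[of "- real DIM('a) - \<alpha>" "norm x" "1 + norm x"] by simp

text \<open>Since the total integral of \<^term>\<open>bump_jump \<alpha>\<close> vanishes, the integral over a ball is minus
  that over its complement, where the decay of \<^term>\<open>bump_jump \<alpha>\<close> can be used.\<close>

lemma kern_unit_le: "\<exists>C>0. \<forall>(u::'a::euclidean_space) R. norm u = 1 \<longrightarrow> 0 < R \<longrightarrow> kern \<alpha> R u \<le> C * R powr (- \<alpha>)"
proof -
  let ?p = "real DIM('a) + \<alpha>"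
  obtain C where C: "0 < C" "\<And>x::'a. \<bar>bump_jump \<alpha> x\<bar> \<le> C * decay \<alpha> x"
    using bump_jump_decay[OF \<alpha>] by blast
  have "kern \<alpha> R u \<le> (C / \<alpha>) * R powr (- \<alpha>)" if u: "norm u = 1" and R: "0 < R" for R and u :: 'a
  proof -
    let ?g = "\<lambda>x::'a. norm (x - 0) powr (- ?p) * indicator {x. R \<le> norm (x - 0)} x"
    have g: "integrable lborel ?g" using \<alpha> R by (intro integrable_norm_powr_outside) auto
    have int: "integrable lborel (\<lambda>x::'a. indicator A x * bump_jump \<alpha> x)" if [measurable]: "A \<in> sets borel" for A
      by (rule Bochner_Integration.integrable_bound[OF integrable_bump_jump[OF \<alpha>]]) (auto simp: indicator_def)
    have cb: "- ball (0::'a) R \<in> sets borel" by (auto intro: borel_comp)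
    have "(LINT x|lborel. indicator (ball 0 R) x * bump_jump \<alpha> (x::'a)) + (LINT x|lborel. indicator (- ball 0 R) x * bump_jump \<alpha> (x::'a))
      = (LINT x|lborel. indicator (ball 0 R) x * bump_jump \<alpha> (x::'a) + indicator (- ball 0 R) x * bump_jump \<alpha> x)"
      using cb by (intro Bochner_Integration.integral_add[symmetric] int) auto
    also have "\<dots> = (LINT x|lborel. bump_jump \<alpha> (x::'a))"
      by (rule Bochner_Integration.integral_cong) (auto simp: indicator_def)
    also have "\<dots> = 0" by (rule integral_bump_jump[OF \<alpha>])
    finally have "real DIM('a) * unit_ball_vol DIM('a) * kern \<alpha> R u = (LINT x|lborel. indicator (- ball 0 R) x * bump_jump \<alpha> (x::'a))"
      unfolding kern_unit[OF u] by simp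
    also have "\<dots> \<le> (LINT x|lborel. C * ?g x)"
    proof (rule integral_mono)
      fix x :: 'a
      have "bump_jump \<alpha> x \<le> C * norm x powr (- ?p)" if "x \<noteq> 0"
      proof -
        have "C * decay \<alpha> x \<le> C * norm x powr (- ?p)"
          using C(1) by (intro mult_left_mono decay_le_powr that) auto
        with C(2)[of x] show ?thesis by linarith
      qed
      then show "indicator (- ball 0 R) x * bump_jump \<alpha> x \<le> C * ?g x"
        using R by (cases "x = 0") (auto simp: indicator_def)
    qed (use int[OF cb] g in auto)
    also have "\<dots> = C * (LINT x|lborel. ?g x)" by (rule integral_mult_right_zero)
    also have "(LINT x|lborel. ?g x) = real DIM('a) * unit_ball_vol DIM('a) * (R powr (- \<alpha>) / \<alpha>)"
    proof -
      have "ennreal (LINT x|lborel. ?g x) = (\<integral>\<^sup>+x. ennreal (?g x) \<partial>lborel)"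
        by (rule nn_integral_eq_integral[OF g, symmetric]) (auto simp: indicator_def)
      also have "\<dots> = (\<integral>\<^sup>+x. ennreal (norm (x::'a) powr (-?p)) * indicator {x. R \<le> norm x} x \<partial>lborel)"
        by (intro nn_integral_cong) (auto simp: indicator_def)
      also have "\<dots> = ennreal (real DIM('a) * unit_ball_vol DIM('a) * (R powr (- \<alpha>) / \<alpha>))"
        using nn_integral_norm_powr_outside[where 'a='a, of ?p R] \<alpha> R by simp
      finally show ?thesis
        using \<alpha> by (subst (asm) ennreal_inj) (auto intro!: Bochner_Integration.integral_nonneg mult_nonneg_nonneg divide_nonneg_nonneg)
    qed
    finally have "real DIM('a) * unit_ball_vol DIM('a) * kern \<alpha> R u \<le> real DIM('a) * unit_ball_vol DIM('a) * ((C / \<alpha>) * R powr (- \<alpha>))"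
      by (simp add: mult_ac)
    then show ?thesis using dim_ball_vol_pos[where 'a='a] by (simp only: mult_le_cancel_left_pos)
  qed
  then show ?thesis using C(1) \<alpha> by (intro exI[of _ "C / \<alpha>"]) auto
qed

text \<open>The integrand s^(d-1) \<psi>(s u) has the order s^(-1-\<alpha>) by the decay of
  \<open>bump_jump\<close>; for s \<ge> R \<ge> 1 this is weakened to R^(-\<alpha>), the size of
  \<open>kern\<close> itself at that radius.\<close>

lemma kern_unit_Lipschitz:
  "\<exists>C>0. \<forall>(u::'a::euclidean_space) R S. norm u = 1 \<longrightarrow> 1 \<le> R \<longrightarrow> R \<le> S \<longrightarrow>
     \<bar>kern \<alpha> S u - kern \<alpha> R u\<bar> \<le> C * (S - R) * R powr (- \<alpha>)"
proof -
  obtain C where C: "0 < C" "\<And>x::'a. \<bar>bump_jump \<alpha> x\<bar> \<le> C * decay \<alpha> x"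
    using bump_jump_decay[OF \<alpha>] by blast
  have "\<bar>kern \<alpha> S u - kern \<alpha> R u\<bar> \<le> C * (S - R) * R powr (- \<alpha>)" if u: "norm u = 1" "1 \<le> R" "R \<le> S" for R S and u :: 'a
  proof -
    let ?f = "\<lambda>s. s ^ (DIM('a) - 1) * bump_jump \<alpha> (s *\<^sub>R u)"
    have le: "\<bar>?f s\<bar> \<le> C * R powr (- \<alpha>)" if s: "s \<in> {R..S}" for s
    proof -
      have s1: "1 \<le> s" and u0: "u \<noteq> 0" using s u by auto
      have "\<bar>?f s\<bar> \<le> s ^ (DIM('a) - 1) * (C * decay \<alpha> (s *\<^sub>R u))"
        using s1 C(2)[of "s *\<^sub>R u"] by (simp add: abs_mult mult_left_mono)
      also have "\<dots> \<le> s ^ (DIM('a) - 1) * (C * s powr (- (real DIM('a) + \<alpha>)))"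
        using decay_le_powr[of "s *\<^sub>R u"] s1 u u0 C(1) by (intro mult_left_mono) auto
      also have "\<dots> = C * (s powr (real (DIM('a) - 1)) * s powr (- (real DIM('a) + \<alpha>)))"
        by (subst powr_realpow) (use s1 in auto)
      also have "\<dots> = C * s powr (- 1 - \<alpha>)"
        by (simp add: powr_add[symmetric] of_nat_diff)
      also have "s powr (- 1 - \<alpha>) \<le> s powr (- \<alpha>)" using s1 by (intro powr_mono) auto
      also have "\<dots> \<le> R powr (- \<alpha>)" using s u \<alpha> by (intro powr_mono2') auto
      finally show ?thesis using C(1) by simp
    qed
    have "\<bar>kern \<alpha> S u - kern \<alpha> R u\<bar> = \<bar>LINT s:{R..S}|lborel. ?f s\<bar>"
      using u by (subst kern_diff) auto
    also have "\<dots> \<le> (LINT s:{R..S}|lborel. \<bar>?f s\<bar>)"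
      unfolding set_lebesgue_integral_def by (rule order_trans[OF integral_abs_bound]) (auto simp: abs_mult)
    also have "\<dots> \<le> (LINT s:{R..S}|lborel. C * R powr (- \<alpha>))"
      using le
      by (intro set_integral_mono set_integrable_abs kern_integrable borel_integrable_atLeastAtMost' continuous_on_const)
    also have "\<dots> = C * (S - R) * R powr (- \<alpha>)"
      using u by (simp add: set_lebesgue_integral_def mult_ac)
    finally show ?thesis .
  qed
  with C show ?thesis by blast
qed

text \<open>By homogeneity the kernel is a function of the radius divided by the d-th power of the
  radius. As \<open>u\<close> is arbitrary, the values at two points can be compared along one and
  the same unit vector.\<close>

lemma kern_1_polar:
  fixes x u :: "'a::euclidean_space"
  assumes "x \<noteq> 0" "norm u = 1"
  shows "kern \<alpha> 1 x = kern \<alpha> (norm x) u / norm x ^ DIM('a)"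
proof -
  have "kern \<alpha> 1 x = kern \<alpha> 1 (norm x *\<^sub>R (x /\<^sub>R norm x))" using assms by simp
  also have "\<dots> = kern \<alpha> (norm x) (x /\<^sub>R norm x) / norm x ^ DIM('a)"
    using assms by (subst kern_scaleR) auto
  also have "kern \<alpha> (norm x) (x /\<^sub>R norm x) = kern \<alpha> (norm x) u"
  proof -
    have "norm (x /\<^sub>R norm x) = 1" using assms by simp
    from kern_unit[OF this, of "norm x"] kern_unit[OF assms(2), of "norm x"] dim_ball_vol_pos[where 'a='a]
    show ?thesis by (metis mult_left_cancel less_irrefl)
  qed
  finally show ?thesis .
qed

lemma kern_1_Lipschitz:
  "\<exists>C>0. \<forall>x y::'a::euclidean_space. \<bar>kern \<alpha> 1 x - kern \<alpha> 1 y\<bar> \<le> C * norm (x - y)"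
proof -
  obtain C where C: "0 < C" "\<And>x y::'a. \<bar>bump_jump \<alpha> x - bump_jump \<alpha> y\<bar> \<le> C * norm (x - y)"
    using bump_jump_Lipschitz[OF \<alpha>] by blast
  have "\<bar>kern \<alpha> 1 x - kern \<alpha> 1 y\<bar> \<le> C * norm (x - y)" for x y :: 'a
  proof -
    let ?f = "\<lambda>z s. s ^ (DIM('a) - 1) * bump_jump \<alpha> (s *\<^sub>R z)"
    have le: "\<bar>?f y s - ?f x s\<bar> \<le> C * norm (x - y)" if s: "s \<in> {0..1}" for s
    proof -
      have "\<bar>?f y s - ?f x s\<bar> = s ^ (DIM('a) - 1) * \<bar>bump_jump \<alpha> (s *\<^sub>R y) - bump_jump \<alpha> (s *\<^sub>R x)\<bar>"
        using s by (simp add: abs_mult right_diff_distrib[symmetric])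
      also have "\<dots> \<le> 1 * (C * norm (s *\<^sub>R y - s *\<^sub>R x))"
        using s C by (intro mult_mono power_le_one) auto
      also have "norm (s *\<^sub>R y - s *\<^sub>R x) = s * norm (x - y)"
        using s by (simp add: scaleR_right_diff_distrib[symmetric] norm_minus_commute del: scaleR_right_diff_distrib)
      also have "1 * (C * (s * norm (x - y))) \<le> C * norm (x - y)"
        using s C(1) mult_left_le_one_le[of "norm (x - y)" s] by simp
      finally show ?thesis .
    qed
    have "kern \<alpha> 1 x - kern \<alpha> 1 y = (LINT s:{0..1}|lborel. ?f y s - ?f x s)"
      by (simp add: kern_eq_Icc set_integral_diff kern_integrable)
    also have "\<bar>\<dots>\<bar> \<le> (LINT s:{0..1}|lborel. \<bar>?f y s - ?f x s\<bar>)"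
      unfolding set_lebesgue_integral_def by (rule order_trans[OF integral_abs_bound]) (auto simp: abs_mult)
    also have "\<dots> \<le> (LINT s:{0..1::real}|lborel. C * norm (x - y))"
      using le
      by (intro set_integral_mono set_integrable_abs set_integral_diff(1) kern_integrable borel_integrable_atLeastAtMost' continuous_on_const)
    also have "\<dots> = C * norm (x - y)" by (simp add: set_lebesgue_integral_def)
    finally show ?thesis .
  qed
  with C show ?thesis by blast
qed

lemma continuous_on_kern_1: "continuous_on S (kern \<alpha> 1 :: 'a::euclidean_space \<Rightarrow> real)"
proof -
  obtain C where C: "0 < C" "\<And>x y::'a. \<bar>kern \<alpha> 1 x - kern \<alpha> 1 y\<bar> \<le> C * norm (x - y)"
    using kern_1_Lipschitz by blast
  then have "C-lipschitz_on S (kern \<alpha> 1 :: 'a \<Rightarrow> real)"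
    by (intro lipschitz_onI) (auto simp: dist_norm)
  then show ?thesis by (rule lipschitz_on_continuous_on)
qed

lemma kern_1_measurable [measurable]: "(kern \<alpha> 1 :: 'a::euclidean_space \<Rightarrow> real) \<in> borel_measurable borel"
  by (rule borel_measurable_continuous_onI[OF continuous_on_kern_1])

lemma kern_1_pos: "norm x = 1 \<Longrightarrow> 0 < kern \<alpha> 1 x"
  by (rule kern_unit_pos)

text \<open>The polar formula leaves out the origin, where the sign follows by continuity.\<close>

lemma kern_1_nonneg: "0 \<le> kern \<alpha> 1 (x::'a::euclidean_space)"
proof (cases "x = 0")
  case True
  have "0 \<le> kern \<alpha> 1 y" if "y \<noteq> 0" for y :: 'a
  proof -
    have "norm (y /\<^sub>R norm y) = 1" using that by simp
    from kern_1_polar[OF that this] kern_unit_nonneg[OF this, of "norm y"] show ?thesis by simp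
  qed
  then have sub: "- {0} \<subseteq> {y::'a. 0 \<le> kern \<alpha> 1 y}" by auto
  have "closed {y::'a. 0 \<le> kern \<alpha> 1 y}"
    by (intro closed_Collect_le continuous_on_kern_1 continuous_on_const)
  with sub have "closure (- {0::'a}) \<subseteq> {y. 0 \<le> kern \<alpha> 1 y}" by (rule closure_minimal)
  then show ?thesis by (auto simp: closure_complement)
next
  case False
  have "norm (x /\<^sub>R norm x) = 1" using False by simp
  from kern_1_polar[OF False this] kern_unit_nonneg[OF this, of "norm x"] show ?thesis by simp
qed

lemma norm_powr_le_decay:
  fixes x :: "'a::euclidean_space"
  assumes "c \<le> norm x" "0 < c"
  shows "norm x powr (- (real DIM('a) + \<alpha>)) \<le> ((1 + c) / c) powr (real DIM('a) + \<alpha>) * decay \<alpha> x"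
proof -
  let ?p = "real DIM('a) + \<alpha>"
  have "(1 + norm x) powr ?p \<le> ((1 + c) / c * norm x) powr ?p"
    using assms \<alpha> by (intro powr_mono2) (auto simp: field_simps)
  then have "(1 + norm x) powr ?p \<le> ((1 + c) / c) powr ?p * norm x powr ?p"
    by (subst (asm) powr_mult) (use assms in auto)
  moreover have "0 < (1 + norm x) powr ?p" "0 < norm x powr ?p"
    using assms by (auto simp: powr_gt_zero)
  moreover have decay: "decay \<alpha> x = inverse ((1 + norm x) powr ?p)"
    by (simp add: decay_def powr_minus[symmetric])
  moreover have "inverse Q \<le> r * inverse P" if "P \<le> r * Q" "0 < P" "0 < Q" for P Q r :: real
    using that by (simp add: field_simps)
  ultimately show ?thesis unfolding powr_minus decay by blast
qed

text \<open>Far out the polar formula contributes |x|^(-d), which alone would not be integrable. The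
  missing factor |x|^(-\<alpha>) is the gain in \<open>kern_unit_le\<close>, due to the vanishing
  total integral of \<open>bump_jump\<close>.\<close>

lemma kern_1_decay: "\<exists>C>0. \<forall>x::'a::euclidean_space. \<bar>kern \<alpha> 1 x\<bar> \<le> C * decay \<alpha> x"
proof -
  let ?p = "real DIM('a) + \<alpha>"
  obtain L where L: "0 < L" "\<And>x y::'a. \<bar>kern \<alpha> 1 x - kern \<alpha> 1 y\<bar> \<le> L * norm (x - y)"
    using kern_1_Lipschitz by blast
  obtain C where C: "0 < C" "\<And>(u::'a) R. norm u = 1 \<Longrightarrow> 0 < R \<Longrightarrow> kern \<alpha> R u \<le> C * R powr (- \<alpha>)"
    using kern_unit_le by blast
  obtain u :: 'a where "u \<in> Basis" using nonempty_Basis by blast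
  then have u: "norm u = 1" by simp
  define M where "M = (kern \<alpha> 1 (0::'a) + L + C) * 2 powr ?p"
  have M0: "0 < M" unfolding M_def using L(1) C(1) kern_1_nonneg[of "0::'a"]
    by (intro mult_pos_pos add_nonneg_pos) auto
  have "kern \<alpha> 1 x \<le> M * decay \<alpha> x" for x :: 'a
  proof (cases "norm x \<le> 1")
    case True
    have "kern \<alpha> 1 x \<le> kern \<alpha> 1 (0::'a) + L"
    proof -
      have "L * norm x \<le> L * 1" using True L(1) by (intro mult_left_mono) auto
      with L(2)[of x 0] show ?thesis by simp
    qed
    also have "\<dots> \<le> M * 2 powr (- ?p)"
      using C(1) by (simp add: M_def powr_add[symmetric] mult.assoc)
    also have "\<dots> \<le> M * decay \<alpha> x"
    proof (rule mult_left_mono)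
      have "2 powr (- ?p) \<le> (1 + norm x) powr (- ?p)"
        using True \<alpha> by (intro powr_mono2') (auto intro: add_pos_nonneg)
      then show "2 powr (- ?p) \<le> decay \<alpha> x" by (simp add: decay_def)
    qed (use M0 in simp)
    finally show ?thesis .
  next
    case False
    then have x: "x \<noteq> 0" by auto
    have "kern \<alpha> 1 x = kern \<alpha> (norm x) u / norm x ^ DIM('a)" by (rule kern_1_polar[OF x u])
    also have "\<dots> \<le> C * norm x powr (- \<alpha>) / norm x ^ DIM('a)"
      using C(2)[OF u, of "norm x"] x by (intro divide_right_mono) auto
    also have "\<dots> = C * norm x powr (- ?p)"
    proof -
      have "norm x powr (- ?p) = norm x powr (- \<alpha>) / norm x powr real DIM('a)"
        using powr_diff[of "norm x" "- \<alpha>" "real DIM('a)"] by (simp add: algebra_simps)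
      then show ?thesis using x by (simp add: powr_realpow)
    qed
    also have "\<dots> \<le> C * (2 powr ?p * decay \<alpha> x)"
      using norm_powr_le_decay[of 1 x] False C(1) by (intro mult_left_mono) auto
    also have "\<dots> \<le> M * decay \<alpha> x"
      unfolding M_def mult.assoc[symmetric] using L(1) kern_1_nonneg[of "0::'a"] decay_pos[of \<alpha> x]
      by (intro mult_right_mono) auto
    finally show ?thesis .
  qed
  then show ?thesis using M0 by (intro exI[of _ M]) (simp add: kern_1_nonneg)
qed

lemma abs_inverse_power_diff_le:
  fixes a b :: real
  assumes "1 \<le> a" "a \<le> b"
  shows "\<bar>1 / a ^ n - 1 / b ^ n\<bar> \<le> real n * (b - a) / a ^ n"
proof -
  \<comment> \<open>One power of \<open>b\<close> more than the mean value theorem gives, affordable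
    because b \<ge> 1; it cancels against \<open>b ^ n\<close> in the denominator.\<close>
  have "b ^ n - a ^ n \<le> real n * (b - a) * b ^ n"
  proof (induction n)
    case (Suc n)
    have "b ^ Suc n - a ^ Suc n = b * (b ^ n - a ^ n) + (b - a) * a ^ n" by (simp add: algebra_simps)
    also have "\<dots> \<le> b * (real n * (b - a) * b ^ n) + (b - a) * b ^ Suc n"
    proof (intro add_mono mult_left_mono Suc)
      have "a ^ n \<le> b ^ n" using assms by (intro power_mono) auto
      also have "\<dots> \<le> b ^ Suc n" using assms by (intro power_increasing) auto
      finally show "a ^ n \<le> b ^ Suc n" .
    qed (use assms in auto)
    finally show ?case by (simp add: algebra_simps)
  qed simp
  moreover have "a ^ n \<le> b ^ n" using assms by (intro power_mono) auto
  moreover have "0 < a ^ n" "0 < b ^ n" using assms by auto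
  ultimately have "(b ^ n - a ^ n) / (a ^ n * b ^ n) \<le> (real n * (b - a) * b ^ n) / (a ^ n * b ^ n)"
    by (intro divide_right_mono) auto
  also have "\<dots> = real n * (b - a) / a ^ n" using assms by simp
  also have "(b ^ n - a ^ n) / (a ^ n * b ^ n) = \<bar>1 / a ^ n - 1 / b ^ n\<bar>"
  proof -
    have "a ^ n \<noteq> 0" "b ^ n \<noteq> 0" using \<open>0 < a ^ n\<close> \<open>0 < b ^ n\<close> by linarith+
    then have "1 / a ^ n - 1 / b ^ n = (b ^ n - a ^ n) / (a ^ n * b ^ n)"
      by (subst diff_frac_eq) auto
    moreover have "0 \<le> (b ^ n - a ^ n) / (a ^ n * b ^ n)"
      using \<open>0 < a ^ n\<close> \<open>0 < b ^ n\<close> \<open>a ^ n \<le> b ^ n\<close> by simp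
    ultimately show ?thesis by linarith
  qed
  finally show ?thesis .
qed

text \<open>A plain Lipschitz bound would not do: the increments are integrated against
  \<open>u\<close>, which is integrable only with the weight, so they have to decay like the
  kernel.\<close>

lemma kern_1_Lipschitz_decay:
  "\<exists>C>0. \<forall>x y::'a::euclidean_space. norm (x - y) \<le> 1 \<longrightarrow> \<bar>kern \<alpha> 1 x - kern \<alpha> 1 y\<bar> \<le> C * norm (x - y) * decay \<alpha> x"
proof -
  let ?p = "real DIM('a) + \<alpha>" and ?d = "DIM('a)"
  obtain L where L: "0 < L" "\<And>x y::'a. \<bar>kern \<alpha> 1 x - kern \<alpha> 1 y\<bar> \<le> L * norm (x - y)"
    using kern_1_Lipschitz by blast
  obtain C where C: "0 < C" "\<And>(u::'a) R. norm u = 1 \<Longrightarrow> 0 < R \<Longrightarrow> kern \<alpha> R u \<le> C * R powr (- \<alpha>)"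
    using kern_unit_le by blast
  obtain K where K: "0 < K" "\<And>(u::'a) R S. norm u = 1 \<Longrightarrow> 1 \<le> R \<Longrightarrow> R \<le> S \<Longrightarrow> \<bar>kern \<alpha> S u - kern \<alpha> R u\<bar> \<le> K * (S - R) * R powr (- \<alpha>)"
    using kern_unit_Lipschitz by blast
  obtain u :: 'a where "u \<in> Basis" using nonempty_Basis by blast
  then have u: "norm u = 1" by simp
  define B where "B = K + real ?d * C"
  have B: "0 < B" using K(1) C(1) by (simp add: B_def add_pos_pos)
  have far: "\<bar>kern \<alpha> 1 x - kern \<alpha> 1 y\<bar> \<le> B * (norm y - norm x) * norm x powr (- ?p)"
    if 1: "1 \<le> norm x" and 2: "norm x \<le> norm y" for x y :: 'a
  proof -
    let ?a = "norm x" and ?b = "norm y"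
    have xy: "x \<noteq> 0" "y \<noteq> 0" using 1 2 by auto
    \<comment> \<open>A discrete product rule for the radial profile times r^(-d). The profile in
      the first term and its increment in the second both carry |x|^(-\<alpha>), so each term has
      the order |x|^(-d-\<alpha>) times the difference of the radii.\<close>
    have "kern \<alpha> 1 x - kern \<alpha> 1 y = kern \<alpha> ?a u * (1 / ?a ^ ?d - 1 / ?b ^ ?d) - (kern \<alpha> ?b u - kern \<alpha> ?a u) / ?b ^ ?d"
      unfolding kern_1_polar[OF xy(1) u] kern_1_polar[OF xy(2) u] by (simp add: diff_divide_distrib right_diff_distrib)
    also have "\<bar>\<dots>\<bar> \<le> \<bar>kern \<alpha> ?a u\<bar> * \<bar>1 / ?a ^ ?d - 1 / ?b ^ ?d\<bar> + \<bar>kern \<alpha> ?b u - kern \<alpha> ?a u\<bar> / ?b ^ ?d"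
      by (rule order_trans[OF abs_triangle_ineq4]) (simp add: abs_mult abs_divide)
    also have "\<dots> \<le> (C * ?a powr (- \<alpha>)) * (real ?d * (?b - ?a) / ?a ^ ?d) + (K * (?b - ?a) * ?a powr (- \<alpha>)) / ?a ^ ?d"
    proof (intro add_mono mult_mono frac_le)
      show "\<bar>kern \<alpha> ?a u\<bar> \<le> C * ?a powr (- \<alpha>)"
        using C(2)[OF u, of ?a] kern_unit_nonneg[OF u, of ?a] xy by simp
      show "\<bar>1 / ?a ^ ?d - 1 / ?b ^ ?d\<bar> \<le> real ?d * (?b - ?a) / ?a ^ ?d"
        by (rule abs_inverse_power_diff_le[OF 1 2])
      show "\<bar>kern \<alpha> ?b u - kern \<alpha> ?a u\<bar> \<le> K * (?b - ?a) * ?a powr (- \<alpha>)"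
        by (rule K(2)[OF u 1 2])
      show "0 < ?a ^ ?d" using xy by simp
      show "?a ^ ?d \<le> ?b ^ ?d" using 2 by (intro power_mono) auto
      show "0 \<le> C * ?a powr (- \<alpha>)" using C by simp
      show "0 \<le> K * (?b - ?a) * ?a powr (- \<alpha>)" using K 2 by simp
    qed auto
    also have "\<dots> = B * (?b - ?a) * (?a powr (- \<alpha>) / ?a ^ ?d)"
      by (simp add: B_def algebra_simps add_divide_distrib diff_divide_distrib)
    also have "?a powr (- \<alpha>) / ?a ^ ?d = ?a powr (- ?p)"
    proof -
      have "norm x powr (- ?p) = norm x powr (- \<alpha>) / norm x powr real DIM('a)"
        using powr_diff[of "norm x" "- \<alpha>" "real DIM('a)"] by (simp add: algebra_simps)
      then show ?thesis using xy by (simp add: powr_realpow)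
    qed
    finally show ?thesis .
  qed
  define M where "M = L * 4 powr ?p + B * 2 powr ?p * 2 powr ?p"
  have M0: "0 < M" using L(1) B by (simp add: M_def add_pos_pos)
  have "\<bar>kern \<alpha> 1 x - kern \<alpha> 1 y\<bar> \<le> M * norm (x - y) * decay \<alpha> x" if le: "norm (x - y) \<le> 1" for x y :: 'a
  proof (cases "norm x \<le> 3")
    case True
    have "\<bar>kern \<alpha> 1 x - kern \<alpha> 1 y\<bar> \<le> L * norm (x - y)" by (rule L(2))
    also have "\<dots> = L * norm (x - y) * 4 powr ?p * 4 powr (- ?p)"
      by (simp add: powr_add[symmetric] mult.assoc)
    also have "\<dots> \<le> L * norm (x - y) * 4 powr ?p * decay \<alpha> x"
    proof (rule mult_left_mono)
      have "4 powr (- ?p) \<le> (1 + norm x) powr (- ?p)"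
        using True \<alpha> by (intro powr_mono2') (auto intro: add_pos_nonneg)
      then show "4 powr (- ?p) \<le> decay \<alpha> x" by (simp add: decay_def)
    qed (use L in simp)
    also have "\<dots> \<le> M * norm (x - y) * decay \<alpha> x"
      using B decay_pos[of \<alpha> x] by (simp add: M_def algebra_simps)
    finally show ?thesis .
  next
    case False
    \<comment> \<open>As |x| > 3 and |x - y| \<le> 1, the two norms are comparable; the roles of
      \<open>x\<close> and \<open>y\<close> in \<open>far\<close> may be exchanged at the price of
      2^(d+\<alpha>).\<close>
    have y: "norm x / 2 \<le> norm y" "1 \<le> norm y"
      using False le norm_triangle_ineq2[of x y] by auto
    have key: "norm z powr (- ?p) \<le> 2 powr ?p * norm x powr (- ?p)" if "norm x / 2 \<le> norm z" for z
    proof -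
      have "norm z powr (- ?p) \<le> (norm x / 2) powr (- ?p)"
        using that \<alpha> False by (intro powr_mono2') auto
      also have "\<dots> = 2 powr ?p * norm x powr (- ?p)"
        by (simp only: powr_divide powr_minus) (simp add: field_simps)
      finally show ?thesis .
    qed
    have "\<bar>kern \<alpha> 1 x - kern \<alpha> 1 y\<bar> \<le> B * norm (x - y) * (2 powr ?p * norm x powr (- ?p))"
    proof (cases "norm x \<le> norm y")
      case True
      have "\<bar>kern \<alpha> 1 x - kern \<alpha> 1 y\<bar> \<le> B * (norm y - norm x) * norm x powr (- ?p)"
        using True False by (intro far) auto
      also have "\<dots> \<le> B * norm (x - y) * (2 powr ?p * norm x powr (- ?p))"
        using B True norm_triangle_ineq3[of x y] key[of x] by (intro mult_mono) auto
      finally show ?thesis .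
    next
      case nle: False
      have "\<bar>kern \<alpha> 1 y - kern \<alpha> 1 x\<bar> \<le> B * (norm x - norm y) * norm y powr (- ?p)"
        using y nle by (intro far) auto
      also have "\<dots> \<le> B * norm (x - y) * (2 powr ?p * norm x powr (- ?p))"
        using B nle norm_triangle_ineq3[of x y] key[OF y(1)] by (intro mult_mono) auto
      finally show ?thesis by (simp add: abs_minus_commute)
    qed
    also have "\<dots> \<le> B * norm (x - y) * (2 powr ?p * (2 powr ?p * decay \<alpha> x))"
      using norm_powr_le_decay[of 1 x] False B by (intro mult_left_mono) auto
    also have "\<dots> \<le> M * norm (x - y) * decay \<alpha> x"
      using L(1) decay_pos[of \<alpha> x] by (simp add: M_def algebra_simps)
    finally show ?thesis .
  qed
  with M0 show ?thesis by blast
qed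

lemma integrable_kern_1: "integrable lborel (kern \<alpha> 1 :: 'a::euclidean_space \<Rightarrow> real)"
proof -
  obtain C where "0 < C" and C: "\<And>x::'a. \<bar>kern \<alpha> 1 x\<bar> \<le> C * decay \<alpha> x"
    using kern_1_decay by blast
  have "integrable lborel (\<lambda>x::'a. C * decay \<alpha> x)"
    using \<alpha> by (intro integrable_mult_right integrable_decay) auto
  then show ?thesis
    by (rule Bochner_Integration.integrable_bound)
       (use C in \<open>auto intro!: AE_I2 intro: order_trans[OF C abs_ge_self]\<close>)
qed

text \<open>A nonnegative function with integral 0 vanishes almost everywhere, and a continuous one
  then everywhere, since its zero set is closed; this contradicts positivity on the unit
  sphere.\<close>

lemma integral_kern_1_pos: "0 < (LINT x|lborel. kern \<alpha> 1 (x::'a::euclidean_space))"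
proof -
  obtain u :: 'a where "u \<in> Basis" using nonempty_Basis by blast
  then have u: "norm u = 1" by simp
  have "(LINT x|lborel. kern \<alpha> 1 (x::'a)) \<noteq> 0"
  proof
    assume "(LINT x|lborel. kern \<alpha> 1 (x::'a)) = 0"
    then have "AE x in lborel. kern \<alpha> 1 (x::'a) = 0"
      using integral_nonneg_eq_0_iff_AE[OF integrable_kern_1] kern_1_nonneg by auto
    then have "AE x in lebesgue. x \<in> {x::'a. kern \<alpha> 1 x = 0}"
      by (simp add: AE_completion)
    moreover have "closed {x::'a. kern \<alpha> 1 x = 0}"
      by (intro closed_Collect_eq continuous_on_kern_1 continuous_on_const)
    ultimately have "u \<in> {x::'a. kern \<alpha> 1 x = 0}"
      by (intro mem_closed_if_AE_lebesgue)
    with kern_1_pos[OF u] show False by simp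
  qed
  moreover have "0 \<le> (LINT x|lborel. kern \<alpha> 1 (x::'a))"
    by (intro Bochner_Integration.integral_nonneg kern_1_nonneg)
  ultimately show ?thesis by simp
qed

end

subsection \<open>Representation of weak solutions\<close>

lemma integrable_pair_mult:
  fixes f :: "'a::euclidean_space \<Rightarrow> real" and h :: "'b::euclidean_space \<Rightarrow> real"
  assumes f: "integrable lborel f" and h: "integrable lborel h"
  shows "integrable (lborel \<Otimes>\<^sub>M lborel) (\<lambda>(x, y). f x * h y)"
proof (rule lborel_pair.Fubini_integrable)
  have [measurable]: "f \<in> borel_measurable borel" "h \<in> borel_measurable borel" using f h by auto
  show "(\<lambda>(x, y). f x * h y) \<in> borel_measurable (lborel \<Otimes>\<^sub>M lborel)" by measurable
  show "integrable lborel (\<lambda>x. LINT y|lborel. norm (case (x, y) of (x, y) \<Rightarrow> f x * h y))"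
    using f by (simp add: abs_mult)
  show "AE x in lborel. integrable lborel (\<lambda>y. case (x, y) of (x, y) \<Rightarrow> f x * h y)"
    using h by simp
qed

lemma decay_scaleR_le:
  fixes z :: "'a::euclidean_space"
  assumes "0 < \<alpha>" "0 < c" "c \<le> s" "c \<le> 1"
  shows "decay \<alpha> (s *\<^sub>R z) \<le> c powr (- (real DIM('a) + \<alpha>)) * decay \<alpha> z"
proof -
  let ?p = "real DIM('a) + \<alpha>"
  have "c * (1 + norm z) \<le> 1 + norm (s *\<^sub>R z)"
    using assms mult_right_mono[OF assms(3), of "norm z"] by (simp add: distrib_left)
  moreover have "0 < c * (1 + norm z)" using assms by (intro mult_pos_pos add_pos_nonneg) auto
  ultimately have "(1 + norm (s *\<^sub>R z)) powr (- ?p) \<le> (c * (1 + norm z)) powr (- ?p)"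
    using assms by (intro powr_mono2') auto
  then show ?thesis by (simp add: decay_def powr_mult)
qed

text \<open>Over all s > 0 the integral would be a constant times the Riesz kernel |z|^(\<alpha>-d).
  The lower limit \<open>R\<close> restricts the support to |z| \<le> 1/R, the upper limit
  \<open>S\<close> removes the singularity at 0.\<close>

definition cutoff_riesz :: "real \<Rightarrow> real \<Rightarrow> real \<Rightarrow> 'a::euclidean_space \<Rightarrow> real" where
  "cutoff_riesz \<alpha> R S z = (LINT s:{R..S}|lborel. s powr (real DIM('a) - 1 - \<alpha>) * bump (s *\<^sub>R z))"

text \<open>Everything except the equation: \<open>g\<close> stands for u q and \<open>A\<close> for
  the Riesz constant. The separation makes the integrability facts available while the equation is
  still being derived from the weak formulation.\<close>

locale weak_pair_data =
  fixes \<alpha> A :: real and D :: "'a::euclidean_space set" and u g :: "'a \<Rightarrow> real"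
  assumes \<alpha>: "0 < \<alpha>" "\<alpha> < 1" and A: "0 < A" and open_D: "open D"
    and u_measurable [measurable]: "u \<in> borel_measurable borel"
    and u_integrable: "integrable lborel (\<lambda>x. \<bar>u x\<bar> * decay \<alpha> x)"
    and g_L1_loc: "g \<in> L1_loc D"
begin

lemmas [measurable] =
  bump_jump_measurable[OF \<alpha>, where 'a='a] kern_1_measurable[OF \<alpha>, where 'a='a]

lemma kern_measurable [measurable]: "0 < S \<Longrightarrow> (kern \<alpha> S :: 'a \<Rightarrow> real) \<in> borel_measurable borel"
proof -
  assume "0 < S"
  then have "(kern \<alpha> S :: 'a \<Rightarrow> real) = (\<lambda>z. S ^ DIM('a) * kern \<alpha> 1 (S *\<^sub>R z))"
    using kern_eq_scaled[OF \<alpha>] by blast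
  then show ?thesis by simp
qed

lemma u_mult_integrable:
  assumes [measurable]: "f \<in> borel_measurable borel" and f: "\<And>y. \<bar>f y\<bar> \<le> C * decay \<alpha> y"
  shows "integrable lborel (\<lambda>y. u y * f y)"
proof (rule Bochner_Integration.integrable_bound)
  show "integrable lborel (\<lambda>x. C * (\<bar>u x\<bar> * decay \<alpha> x))" using u_integrable by simp
  show "AE x in lborel. norm (u x * f x) \<le> norm (C * (\<bar>u x\<bar> * decay \<alpha> x))"
  proof (intro AE_I2)
    fix x
    have "\<bar>u x\<bar> * \<bar>f x\<bar> \<le> \<bar>u x\<bar> * (C * decay \<alpha> x)" by (intro mult_left_mono f) auto
    also have "\<dots> \<le> \<bar>C * (\<bar>u x\<bar> * decay \<alpha> x)\<bar>" by (simp add: mult_ac)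
    finally show "norm (u x * f x) \<le> norm (C * (\<bar>u x\<bar> * decay \<alpha> x))" by (simp add: abs_mult)
  qed
qed measurable

lemma scaled_decay_le:
  fixes x y :: 'a
  assumes "0 < c" "c \<le> s" "c \<le> 1"
  shows "decay \<alpha> (s *\<^sub>R (x - y)) \<le> c powr (- (real DIM('a) + \<alpha>)) * ((1 + norm x) powr (real DIM('a) + \<alpha>) * decay \<alpha> y)"
  by (rule order_trans[OF decay_scaleR_le[OF \<alpha>(1) assms] mult_left_mono[OF decay_diff_le[OF \<alpha>(1)]]]) simp

lemma scaled_bump_jump_le:
  assumes "0 < c"
  shows "\<exists>C>0. \<forall>s\<ge>c. \<forall>y. \<bar>bump_jump \<alpha> (s *\<^sub>R (x - y))\<bar> \<le> C * decay \<alpha> (y::'a)"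
proof -
  let ?p = "real DIM('a) + \<alpha>"
  obtain C where C: "0 < C" "\<And>x::'a. \<bar>bump_jump \<alpha> x\<bar> \<le> C * decay \<alpha> x"
    using bump_jump_decay[OF \<alpha>] by blast
  define c' where "c' = min c 1"
  have c': "0 < c'" "c' \<le> c" "c' \<le> 1" using assms by (auto simp: c'_def)
  define M where "M = C * (c' powr (- ?p) * (1 + norm x) powr ?p)"
  have "\<bar>bump_jump \<alpha> (s *\<^sub>R (x - y))\<bar> \<le> M * decay \<alpha> y" if "c \<le> s" for s y
  proof -
    have "\<bar>bump_jump \<alpha> (s *\<^sub>R (x - y))\<bar> \<le> C * decay \<alpha> (s *\<^sub>R (x - y))" by (rule C)
    also have "\<dots> \<le> C * (c' powr (- ?p) * ((1 + norm x) powr ?p * decay \<alpha> y))"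
      using c' that C(1) by (intro mult_left_mono scaled_decay_le) auto
    finally show ?thesis by (simp add: M_def mult_ac)
  qed
  moreover have "0 < M"
    unfolding M_def using C c' norm_ge_zero[of x] by (auto simp: add_nonneg_eq_0_iff)
  ultimately show ?thesis by blast
qed

lemma scaled_kern_le:
  assumes "0 < S"
  shows "\<exists>C>0. \<forall>x y. norm x \<le> R \<longrightarrow> \<bar>kern \<alpha> S (x - y)\<bar> \<le> C * decay \<alpha> (y::'a)"
proof -
  let ?p = "real DIM('a) + \<alpha>"
  obtain C where C: "0 < C" "\<And>x::'a. \<bar>kern \<alpha> 1 x\<bar> \<le> C * decay \<alpha> x"
    using kern_1_decay[OF \<alpha>] by blast
  define c' where "c' = min S 1"
  have c': "0 < c'" "c' \<le> S" "c' \<le> 1" using assms by (auto simp: c'_def)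
  define M where "M = S ^ DIM('a) * (C * (c' powr (- ?p) * (1 + \<bar>R\<bar>) powr ?p))"
  have "\<bar>kern \<alpha> S (x - y)\<bar> \<le> M * decay \<alpha> y" if R: "norm x \<le> R" for x y :: 'a
  proof -
    have "\<bar>kern \<alpha> S (x - y)\<bar> = S ^ DIM('a) * \<bar>kern \<alpha> 1 (S *\<^sub>R (x - y))\<bar>"
      using assms kern_eq_scaled[OF \<alpha> assms, of "x - y"] by (simp add: abs_mult)
    also have "\<dots> \<le> S ^ DIM('a) * (C * decay \<alpha> (S *\<^sub>R (x - y)))" using assms by (intro mult_left_mono C) auto
    also have "\<dots> \<le> S ^ DIM('a) * (C * (c' powr (- ?p) * ((1 + norm x) powr ?p * decay \<alpha> y)))"
      using c' C(1) assms by (intro mult_left_mono scaled_decay_le) auto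
    also have "\<dots> \<le> S ^ DIM('a) * (C * (c' powr (- ?p) * ((1 + \<bar>R\<bar>) powr ?p * decay \<alpha> y)))"
      using c' C(1) assms R \<alpha> decay_pos[of \<alpha> y] by (intro mult_left_mono mult_right_mono powr_mono2) auto
    finally show ?thesis by (simp add: M_def mult_ac)
  qed
  moreover have "0 < M"
    unfolding M_def using C c' assms by (auto simp: add_nonneg_eq_0_iff)
  ultimately show ?thesis by blast
qed

lemma integrable_u_bump_jump: "0 < s \<Longrightarrow> integrable lborel (\<lambda>y. u y * bump_jump \<alpha> (s *\<^sub>R (x - y)))"
  using scaled_bump_jump_le[of s x] by (auto intro!: u_mult_integrable)

lemma integrable_u_kern: "0 < S \<Longrightarrow> integrable lborel (\<lambda>y. u y * kern \<alpha> S (x - y))"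
proof -
  assume S: "0 < S"
  obtain C where "\<And>x' y. norm x' \<le> norm x \<Longrightarrow> \<bar>kern \<alpha> S (x' - y)\<bar> \<le> C * decay \<alpha> (y::'a)"
    using scaled_kern_le[OF S, of "norm x"] by blast
  then show ?thesis using S by (intro u_mult_integrable) auto
qed

lemma g_integrable: "compact K \<Longrightarrow> K \<subseteq> D \<Longrightarrow> integrable lborel (\<lambda>y. indicator K y * g y)"
  using g_L1_loc by (auto simp: L1_loc_def set_integrable_def)

text \<open>\<open>g\<close> is controlled, including its measurability, on compact subsets of D
  only. Since the bump has compact support, \<open>g\<close> may be replaced by
  \<open>indicator K y * g y\<close>, which is integrable on the whole space.\<close>

lemma g_bump_restrict:
  assumes "0 < s" "cball x (1 / s) \<subseteq> K"
  shows "g y * bump (s *\<^sub>R (x - y)) = indicator K y * g y * bump (s *\<^sub>R (x - y))"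
using scaled_bump_eq_0[OF assms(1), of y x] assms(2) by (cases "y \<in> cball x (1 / s)") auto

lemma integrable_bump_mult:
  assumes "integrable lborel h"
  shows "integrable lborel (\<lambda>y::'a. h y * bump (s *\<^sub>R (x - y)))"
proof (rule Bochner_Integration.integrable_bound[OF assms])
  have [measurable]: "h \<in> borel_measurable borel" using assms by auto
  show "(\<lambda>y. h y * bump (s *\<^sub>R (x - y))) \<in> borel_measurable lborel" by measurable
  have "\<bar>h y\<bar> * bump (s *\<^sub>R (x - y)) \<le> \<bar>h y\<bar> * 1" for y by (intro mult_left_mono bump_le_1) auto
  then show "AE y in lborel. norm (h y * bump (s *\<^sub>R (x - y))) \<le> norm (h y)"
    by (simp add: abs_mult bump_nonneg)
qed

end

text \<open>The weak formulation for the scaled bumps, with their fractional Laplacian already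
  evaluated. It consists of Lebesgue integrals, so it survives a change of \<open>u\<close> on a
  null set.\<close>

locale weak_pair = weak_pair_data +
  assumes weak: "\<And>x s. 0 < s \<Longrightarrow> cball x (1 / s) \<subseteq> D \<Longrightarrow>
      A * s powr \<alpha> * (LINT y|lborel. u y * bump_jump \<alpha> (s *\<^sub>R (x - y))) =
      - (LINT y|lborel. g y * bump (s *\<^sub>R (x - y)))"
begin

text \<open>The weak equation at all scales between \<open>R\<close> and \<open>S\<close>,
  integrated in the scale. The exponent d - 1 - \<alpha> is the d - 1 of \<open>kern\<close> minus
  the homogeneity \<alpha> of the operator.\<close>

lemma u_kern_diff:
  assumes R: "0 < R" "R \<le> S" and D: "cball x (1 / R) \<subseteq> D"
  shows "A * (LINT y|lborel. u y * kern \<alpha> S (x - y)) = A * (LINT y|lborel. u y * kern \<alpha> R (x - y)) +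
    (LINT s:{R..S}|lborel. s powr (real DIM('a) - 1 - \<alpha>) * (LINT y|lborel. g y * bump (s *\<^sub>R (x - y))))"
proof -
  let ?d = "DIM('a)"
  obtain C where C: "0 < C" "\<And>s y. R \<le> s \<Longrightarrow> \<bar>bump_jump \<alpha> (s *\<^sub>R (x - y))\<bar> \<le> C * decay \<alpha> (y::'a)"
    using scaled_bump_jump_le[OF R(1)] by blast
  let ?F = "\<lambda>y s. u y * (indicator {R..S} s * (s ^ (?d - 1) * bump_jump \<alpha> (s *\<^sub>R (x - y))))"
  have int: "integrable (lborel \<Otimes>\<^sub>M lborel) (\<lambda>(y, s). ?F y s)"
  proof (rule Bochner_Integration.integrable_bound)
    show "integrable (lborel \<Otimes>\<^sub>M lborel) (\<lambda>(y, s). (\<bar>u y\<bar> * decay \<alpha> y) * (C * S ^ (?d - 1) * indicator {R..S} s))"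
      by (rule integrable_pair_mult[OF u_integrable]) (simp add: R)
    show "AE p in lborel \<Otimes>\<^sub>M lborel. norm (case p of (y, s) \<Rightarrow> ?F y s) \<le> norm (case p of (y, s) \<Rightarrow> (\<bar>u y\<bar> * decay \<alpha> y) * (C * S ^ (?d - 1) * indicator {R..S} s))"
    proof (intro AE_I2, clarify)
      fix y :: 'a and s :: real
      show "norm (?F y s) \<le> norm ((\<bar>u y\<bar> * decay \<alpha> y) * (C * S ^ (?d - 1) * indicator {R..S} s))"
      proof (cases "s \<in> {R..S}")
        case True
        have "\<bar>u y\<bar> * (s ^ (?d - 1) * \<bar>bump_jump \<alpha> (s *\<^sub>R (x - y))\<bar>) \<le> \<bar>u y\<bar> * (S ^ (?d - 1) * (C * decay \<alpha> y))"
          using True R C by (intro mult_left_mono mult_mono power_mono) auto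
        then show ?thesis using True R C(1) decay_pos[of \<alpha> y] by (simp add: abs_mult mult_ac)
      qed simp
    qed
  qed measurable
  have "(LINT y|lborel. u y * kern \<alpha> S (x - y)) - (LINT y|lborel. u y * kern \<alpha> R (x - y)) =
    (LINT y|lborel. u y * kern \<alpha> S (x - y) - u y * kern \<alpha> R (x - y))"
    using R by (intro Bochner_Integration.integral_diff[symmetric] integrable_u_kern) auto
  also have "\<dots> = (LINT y|lborel. - (LINT s|lborel. ?F y s))"
  proof (rule Bochner_Integration.integral_cong)
    fix y
    have "u y * kern \<alpha> S (x - y) - u y * kern \<alpha> R (x - y) = u y * (kern \<alpha> S (x - y) - kern \<alpha> R (x - y))"
      by (simp add: right_diff_distrib)
    also have "\<dots> = - (LINT s|lborel. ?F y s)"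
      using R by (subst kern_diff[OF \<alpha>]) (auto simp: set_lebesgue_integral_def)
    finally show "u y * kern \<alpha> S (x - y) - u y * kern \<alpha> R (x - y) = - (LINT s|lborel. ?F y s)" .
  qed simp
  also have "\<dots> = - (LINT s|lborel. LINT y|lborel. ?F y s)"
    using lborel_pair.Fubini_integral[OF int] by simp
  finally have "A * (LINT y|lborel. u y * kern \<alpha> S (x - y)) - A * (LINT y|lborel. u y * kern \<alpha> R (x - y)) =
     (LINT s|lborel. - A * (LINT y|lborel. ?F y s))"
    by (simp add: right_diff_distrib[symmetric])
  also have "\<dots> = (LINT s:{R..S}|lborel. s powr (real ?d - 1 - \<alpha>) * (LINT y|lborel. g y * bump (s *\<^sub>R (x - y))))"
    unfolding set_lebesgue_integral_def
  proof (rule Bochner_Integration.integral_cong)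
    fix s :: real
    show "- A * (LINT y|lborel. ?F y s) = indicator {R..S} s *\<^sub>R (s powr (real ?d - 1 - \<alpha>) * (LINT y|lborel. g y * bump (s *\<^sub>R (x - y))))"
    proof (cases "s \<in> {R..S}")
      case True
      then have s: "0 < s" using R by auto
      \<comment> \<open>The supports shrink as the scale grows, so the inclusion at scale
        \<open>R\<close> covers all larger ones.\<close>
      have sub: "cball x (1 / s) \<subseteq> D"
        using D True R by (intro order_trans[OF subset_cball D]) (auto intro: frac_le)
      have "(LINT y|lborel. ?F y s) = (LINT y|lborel. s ^ (?d - 1) * (u y * bump_jump \<alpha> (s *\<^sub>R (x - y))))"
        using True by (intro Bochner_Integration.integral_cong) auto
      also have "\<dots> = s ^ (?d - 1) * (LINT y|lborel. u y * bump_jump \<alpha> (s *\<^sub>R (x - y)))"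
        by (rule integral_mult_right_zero)
      finally have "s powr \<alpha> * (- A * (LINT y|lborel. ?F y s)) = s ^ (?d - 1) * - (A * s powr \<alpha> * (LINT y|lborel. u y * bump_jump \<alpha> (s *\<^sub>R (x - y))))"
        by simp
      also have "\<dots> = s ^ (?d - 1) * (LINT y|lborel. g y * bump (s *\<^sub>R (x - y)))"
        unfolding weak[OF s sub] by simp
      finally have "s powr \<alpha> * (- A * (LINT y|lborel. ?F y s)) = s ^ (?d - 1) * (LINT y|lborel. g y * bump (s *\<^sub>R (x - y)))" .
      moreover have "s ^ (?d - 1) = s powr \<alpha> * s powr (real ?d - 1 - \<alpha>)"
        using s by (simp add: powr_add[symmetric] powr_realpow[symmetric] of_nat_diff)
      ultimately have "s powr \<alpha> * (- A * (LINT y|lborel. ?F y s)) = s powr \<alpha> * (s powr (real ?d - 1 - \<alpha>) * (LINT y|lborel. g y * bump (s *\<^sub>R (x - y))))"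
        by (simp only: mult.assoc)
      then have "- A * (LINT y|lborel. ?F y s) = s powr (real ?d - 1 - \<alpha>) * (LINT y|lborel. g y * bump (s *\<^sub>R (x - y)))"
        using s by (simp only: mult_cancel_left) simp
      then show ?thesis using True by simp
    qed simp
  qed simp
  finally show ?thesis by simp
qed

lemma cutoff_riesz_Fubini:
  assumes h: "integrable lborel h" and R: "0 < R" "R \<le> S"
  shows "(LINT s:{R..S}|lborel. s powr (real DIM('a) - 1 - \<alpha>) * (LINT y|lborel. h y * bump (s *\<^sub>R (x - y)))) =
    (LINT y|lborel. h y * cutoff_riesz \<alpha> R S (x - y :: 'a))"
proof -
  let ?e = "real DIM('a) - 1 - \<alpha>"
  have [measurable]: "h \<in> borel_measurable borel" using h by auto
  let ?F = "\<lambda>y s. h y * (indicator {R..S} s * (s powr ?e * bump (s *\<^sub>R (x - y))))"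
  have "set_integrable lborel {R..S} (\<lambda>s. s powr ?e)"
    using R by (intro borel_integrable_atLeastAtMost' continuous_intros) auto
  then have pw: "integrable lborel (\<lambda>s. indicator {R..S} s * s powr ?e)" by (simp add: set_integrable_def)
  have int: "integrable (lborel \<Otimes>\<^sub>M lborel) (\<lambda>(y, s). ?F y s)"
  proof (rule Bochner_Integration.integrable_bound[OF integrable_pair_mult[OF h pw]])
    show "AE p in lborel \<Otimes>\<^sub>M lborel. norm (case p of (y, s) \<Rightarrow> ?F y s) \<le> norm (case p of (y, s) \<Rightarrow> h y * (indicator {R..S} s * s powr ?e))"
    proof (intro AE_I2, clarify)
      fix y :: 'a and s :: real
      have "\<bar>h y\<bar> * (indicator {R..S} s * s powr ?e * bump (s *\<^sub>R (x - y))) \<le> \<bar>h y\<bar> * (indicator {R..S} s * s powr ?e * 1)"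
        by (intro mult_left_mono bump_le_1) auto
      then show "norm (?F y s) \<le> norm (h y * (indicator {R..S} s * s powr ?e))"
        by (simp add: abs_mult bump_nonneg mult_ac)
    qed
  qed measurable
  have "(LINT s:{R..S}|lborel. s powr ?e * (LINT y|lborel. h y * bump (s *\<^sub>R (x - y)))) = (LINT s|lborel. LINT y|lborel. ?F y s)"
    unfolding set_lebesgue_integral_def
  proof (rule Bochner_Integration.integral_cong)
    fix s :: real
    have "(LINT y|lborel. ?F y s) = (LINT y|lborel. (indicator {R..S} s * s powr ?e) * (h y * bump (s *\<^sub>R (x - y))))"
      by (intro Bochner_Integration.integral_cong) auto
    also have "\<dots> = (indicator {R..S} s * s powr ?e) * (LINT y|lborel. h y * bump (s *\<^sub>R (x - y)))"
      by (rule integral_mult_right_zero)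
    finally show "indicator {R..S} s *\<^sub>R (s powr ?e * (LINT y|lborel. h y * bump (s *\<^sub>R (x - y)))) = (LINT y|lborel. ?F y s)"
      by simp
  qed simp
  also have "\<dots> = (LINT y|lborel. LINT s|lborel. ?F y s)"
    by (rule lborel_pair.Fubini_integral[OF int])
  also have "\<dots> = (LINT y|lborel. h y * cutoff_riesz \<alpha> R S (x - y))"
    by (simp add: cutoff_riesz_def set_lebesgue_integral_def)
  finally show ?thesis .
qed

end

subsection \<open>Passing to the limit in the representation\<close>

text \<open>Boxes form an intersection-stable generator of the Borel sets. The step to complements
  needs the integral over the whole space, obtained as a limit over growing boxes.\<close>

lemma AE_eq_0_if_box_integrals_eq_0:
  fixes f :: "'a::euclidean_space \<Rightarrow> real"
  assumes f: "integrable lborel f" and box: "\<And>a b. (LINT x:box a b|lborel. f x) = 0"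
  shows "AE x in lborel. f x = 0"
proof -
  have si: "set_integrable lborel A f" if "A \<in> sets borel" for A
    unfolding set_integrable_def using f that by (intro integrable_mult_indicator) auto
  let ?A = "\<lambda>n::nat. box (- (real n *\<^sub>R One)) (real n *\<^sub>R One) :: 'a set"
  have UN: "(\<Union>i. ?A i) = UNIV" by (rule UN_box_eq_UNIV)
  have "incseq ?A"
    by (rule incseq_SucI) (auto simp: box_def algebra_simps inner_diff_left intro: less_le_trans le_less_trans)
  then have "(\<lambda>i. LINT x:?A i|lborel. f x) \<longlonglongrightarrow> (LINT x:(\<Union>i. ?A i)|lborel. f x)"
    by (intro set_integral_cont_up si) (auto simp: UN)
  then have tot: "(LINT x:UNIV|lborel. f x) = 0"
    by (simp add: box UN LIMSEQ_const_iff)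
  have "(LINT x:A|lborel. f x) = 0" if A: "A \<in> sets borel" for A
  proof -
    let ?G = "range (\<lambda>(a, b). box a b) :: 'a set set"
    have "Int_stable ?G" by (auto simp: Int_stable_def box_Int_box)
    moreover have "?G \<subseteq> Pow UNIV" by simp
    moreover have "A \<in> sigma_sets UNIV ?G" using A by (simp add: borel_eq_box)
    ultimately show ?thesis
    proof (induction rule: sigma_sets_induct_disjoint)
      case (basic A)
      then show ?case using box by auto
    next
      case (compl A)
      then have A: "A \<in> sets borel" by (simp add: borel_eq_box)
      have "(LINT x:UNIV|lborel. f x) = (LINT x:A \<union> (UNIV - A)|lborel. f x)" by simp
      also have "\<dots> = (LINT x:A|lborel. f x) + (LINT x:UNIV - A|lborel. f x)"
        using A by (intro set_integral_Un si) auto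
      finally show ?case using compl tot by simp
    next
      case (union A)
      then have A: "A i \<in> sets borel" for i by (auto simp: borel_eq_box)
      then show ?case
        using union.hyps union.IH
        by (subst lebesgue_integral_countable_add) (auto simp: disjoint_family_on_def intro!: si)
    qed (simp add: set_lebesgue_integral_def)
  qed
  then have "AE x in lborel. f x = (\<lambda>x. 0) x"
    by (intro density_unique_real f) auto
  then show ?thesis by simp
qed

lemma integrable_convolution:
  fixes f k :: "'a::euclidean_space \<Rightarrow> real"
  assumes f: "integrable lborel f" and k: "integrable lborel k"
  shows "integrable (lborel \<Otimes>\<^sub>M lborel) (\<lambda>(x, y). f y * k (x - y))"
proof -
  have [measurable]: "f \<in> borel_measurable borel" "k \<in> borel_measurable borel" using f k by auto
  have "integrable (lborel \<Otimes>\<^sub>M lborel) (\<lambda>(y, x). f y * k (x - y))"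
  proof (rule lborel_pair.Fubini_integrable)
    show "(\<lambda>(y, x). f y * k (x - y)) \<in> borel_measurable (lborel \<Otimes>\<^sub>M lborel)" by measurable
    have "(LINT x|lborel. norm (case (y, x) of (y, x) \<Rightarrow> f y * k (x - y))) = \<bar>f y\<bar> * (LINT x|lborel. \<bar>k x\<bar>)" for y
      using integral_lborel_shift[of "\<lambda>x. \<bar>k x\<bar>" y] by (simp add: abs_mult)
    then show "integrable lborel (\<lambda>y. LINT x|lborel. norm (case (y, x) of (y, x) \<Rightarrow> f y * k (x - y)))"
      using f by simp
    show "AE y in lborel. integrable lborel (\<lambda>x. case (y, x) of (y, x) \<Rightarrow> f y * k (x - y))"
      using k integrable_lborel_shift_iff[of k] by simp
  qed
  from lborel_pair.integrable_product_swap[OF this] show ?thesis by simp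
qed

definition riesz_kernel :: "real \<Rightarrow> real \<Rightarrow> 'a::euclidean_space \<Rightarrow> real" where
  "riesz_kernel \<alpha> r z = norm z powr (- (real DIM('a) - \<alpha>)) * indicator (cball 0 r) z"

lemma riesz_kernel_measurable [measurable]: "riesz_kernel \<alpha> r \<in> borel_measurable borel"
  unfolding riesz_kernel_def by measurable

lemma riesz_kernel_nonneg: "0 \<le> riesz_kernel \<alpha> r z"
  by (simp add: riesz_kernel_def)

lemma integrable_riesz_kernel: "0 < \<alpha> \<Longrightarrow> integrable lborel (riesz_kernel \<alpha> r :: 'a::euclidean_space \<Rightarrow> real)"
  using integrable_norm_powr_cball[where 'a='a, of "real DIM('a) - \<alpha>" 0 r]
  by (simp add: riesz_kernel_def[abs_def])

text \<open>The limit of \<open>cutoff_riesz\<close> as the upper scale tends to infinity. For each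
  \<open>z \<noteq> 0\<close> it is attained at a finite scale, as the bump vanishes once s |z|
  \<ge> 1.\<close>

definition riesz_tail :: "real \<Rightarrow> real \<Rightarrow> 'a::euclidean_space \<Rightarrow> real" where
  "riesz_tail \<alpha> R z = (LINT s:{R..}|lborel. s powr (real DIM('a) - 1 - \<alpha>) * bump (s *\<^sub>R z))"

text \<open>The bump is at most 1 and cuts the integral off at s = 1/|z|. As \<alpha> < d, the
  primitive of s^(d-1-\<alpha>) is a positive power, and its value at 1/|z| is |z|^(\<alpha>-d) /
  (d-\<alpha>), uniformly in \<open>S\<close>.\<close>

lemma cutoff_riesz_le:
  fixes z :: "'a::euclidean_space"
  assumes \<alpha>: "0 < \<alpha>" "\<alpha> < 1" and R: "0 < R" "R \<le> S" and z: "z \<noteq> 0"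
  shows "\<bar>cutoff_riesz \<alpha> R S z\<bar> \<le> riesz_kernel \<alpha> (1 / R) z / (real DIM('a) - \<alpha>)"
proof -
  let ?e = "real DIM('a) - 1 - \<alpha>"
  have "1 \<le> DIM('a)" by (simp add: Suc_leI)
  then have d: "\<alpha> < real DIM('a)" using \<alpha> by linarith
  have nz: "0 < norm z" using z by simp
  show ?thesis
  proof (cases "R * norm z \<le> 1")
    case True
    then have Rz: "R \<le> 1 / norm z" using nz by (simp add: field_simps)
    let ?F = "\<lambda>s. s powr (real DIM('a) - \<alpha>) / (real DIM('a) - \<alpha>)"
    have FTC: "has_bochner_integral lborel (\<lambda>s. s powr ?e * indicator {R .. 1 / norm z} s) (?F (1 / norm z) - ?F R)"
    proof (rule has_bochner_integral_FTC_Icc_real[OF Rz])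
      fix s assume "R \<le> s"
      then have s: "0 < s" using R by simp
      show "DERIV ?F s :> s powr ?e"
      proof -
        have "((\<lambda>s. s powr (real DIM('a) - \<alpha>)) has_real_derivative (real DIM('a) - \<alpha>) * s powr (real DIM('a) - \<alpha> - 1)) (at s)"
          using s by (rule has_real_derivative_powr)
        moreover have e: "?e = real DIM('a) - \<alpha> - 1" by simp
        ultimately show ?thesis
          unfolding e using d DERIV_cdivide[of _ _ s UNIV "real DIM('a) - \<alpha>"] by fastforce
      qed
      show "isCont (\<lambda>s. s powr ?e) s"
        using s by (intro continuous_intros) auto
    qed
    have "\<bar>cutoff_riesz \<alpha> R S z\<bar> \<le> (LINT s|lborel. \<bar>indicator {R..S} s *\<^sub>R (s powr ?e * bump (s *\<^sub>R z))\<bar>)"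
      unfolding cutoff_riesz_def set_lebesgue_integral_def by (rule integral_abs_bound)
    also have "\<dots> \<le> (LINT s|lborel. s powr ?e * indicator {R .. 1 / norm z} s)"
    proof (rule integral_mono)
      have "continuous_on {R..S} (\<lambda>s. s powr ?e * bump (s *\<^sub>R z))"
        using R by (intro continuous_intros) auto
      then have "set_integrable lborel {R..S} (\<lambda>s. s powr ?e * bump (s *\<^sub>R z))"
        by (rule borel_integrable_atLeastAtMost')
      then show "integrable lborel (\<lambda>s. \<bar>indicator {R..S} s *\<^sub>R (s powr ?e * bump (s *\<^sub>R z))\<bar>)"
        unfolding set_integrable_def by (rule integrable_abs)
      show "integrable lborel (\<lambda>s. s powr ?e * indicator {R .. 1 / norm z} s)"
        using FTC by (rule integrable.intros)
      fix s :: real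
      show "\<bar>indicator {R..S} s *\<^sub>R (s powr ?e * bump (s *\<^sub>R z))\<bar> \<le> s powr ?e * indicator {R .. 1 / norm z} s"
      proof (cases "R \<le> s \<and> s \<le> S")
        case sR: True
        have "bump (s *\<^sub>R z) = 0" if "1 / norm z < s"
          using that nz sR R by (intro bump_eq_0) (auto simp: field_simps)
        then show ?thesis
          using sR bump_nonneg[of "s *\<^sub>R z"] mult_left_mono[OF bump_le_1, of "s powr ?e" "s *\<^sub>R z"]
          by (auto simp: indicator_def abs_mult not_le)
      qed auto
    qed
    also have "\<dots> = ?F (1 / norm z) - ?F R" using FTC by (rule has_bochner_integral_integral_eq)
    also have "\<dots> \<le> ?F (1 / norm z)" using d by simp
    also have "(1 / norm z) powr (real DIM('a) - \<alpha>) = norm z powr (- (real DIM('a) - \<alpha>))"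
      using nz powr_divide[of 1 "norm z" "real DIM('a) - \<alpha>"] powr_minus_divide[of "norm z" "real DIM('a) - \<alpha>"] by simp
    also have "norm z powr (- (real DIM('a) - \<alpha>)) = riesz_kernel \<alpha> (1 / R) z"
      using True R by (simp add: riesz_kernel_def field_simps)
    finally show ?thesis .
  next
    case False
    have "bump (s *\<^sub>R z) = 0" if "R \<le> s" for s
    proof (rule bump_eq_0)
      have "1 \<le> R * norm z" using False by simp
      also have "\<dots> \<le> s * norm z" using that by (intro mult_right_mono) auto
      finally show "1 \<le> norm (s *\<^sub>R z)" using that R by simp
    qed
    then have "cutoff_riesz \<alpha> R S z = (LINT s|(lborel :: real measure). (0::real))"
      unfolding cutoff_riesz_def set_lebesgue_integral_def
      by (intro Bochner_Integration.integral_cong) (auto simp: indicator_def)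
    then show ?thesis using d riesz_kernel_nonneg[of \<alpha> "1 / R" z] by simp
  qed
qed

lemma cutoff_riesz_eq_tail:
  fixes z :: "'a::euclidean_space"
  assumes R: "0 < R" "R \<le> S" and S: "1 \<le> S * norm z"
  shows "cutoff_riesz \<alpha> R S z = riesz_tail \<alpha> R z"
  unfolding cutoff_riesz_def riesz_tail_def set_lebesgue_integral_def
proof (rule Bochner_Integration.integral_cong)
  fix s :: real
  have "bump (s *\<^sub>R z) = 0" if "S < s"
  proof (rule bump_eq_0)
    have "S * norm z \<le> s * norm z" using that by (intro mult_right_mono) auto
    with S show "1 \<le> norm (s *\<^sub>R z)" using that R by simp
  qed
  then show "indicator {R..S} s *\<^sub>R (s powr (real DIM('a) - 1 - \<alpha>) * bump (s *\<^sub>R z)) =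
    indicator {R..} s *\<^sub>R (s powr (real DIM('a) - 1 - \<alpha>) * bump (s *\<^sub>R z))"
    by (auto simp: indicator_def)
qed simp

lemma riesz_tail_le:
  fixes z :: "'a::euclidean_space"
  assumes \<alpha>: "0 < \<alpha>" "\<alpha> < 1" and R: "0 < R" and z: "z \<noteq> 0"
  shows "\<bar>riesz_tail \<alpha> R z\<bar> \<le> riesz_kernel \<alpha> (1 / R) z / (real DIM('a) - \<alpha>)"
proof -
  define S where "S = max R (1 / norm z)"
  have "1 = 1 / norm z * norm z" using z by simp
  also have "\<dots> \<le> S * norm z" by (intro mult_right_mono) (auto simp: S_def)
  finally have "cutoff_riesz \<alpha> R S z = riesz_tail \<alpha> R z"
    using R by (intro cutoff_riesz_eq_tail) (auto simp: S_def)
  with cutoff_riesz_le[OF \<alpha> R _ z, of S] show ?thesis by (simp add: S_def)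
qed

lemma cutoff_riesz_measurable [measurable]: "cutoff_riesz \<alpha> R S \<in> borel_measurable borel"
  unfolding cutoff_riesz_def[abs_def] set_lebesgue_integral_def by measurable

lemma riesz_tail_measurable [measurable]: "riesz_tail \<alpha> R \<in> borel_measurable borel"
  unfolding riesz_tail_def[abs_def] set_lebesgue_integral_def by measurable

text \<open>The kernel is not normalised; this factor accompanies every limit of the convolutions
  with it.\<close>

definition kern_mass :: "'a::euclidean_space itself \<Rightarrow> real \<Rightarrow> real" where
  "kern_mass _ \<alpha> = (LINT x|lborel. kern \<alpha> 1 (x::'a))"

context weak_pair
begin

lemma mass_pos: "0 < kern_mass TYPE('a) \<alpha>"
  unfolding kern_mass_def by (rule integral_kern_1_pos[OF \<alpha>])

lemma dim_gt: "\<alpha> < real DIM('a)"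
proof -
  have "1 \<le> DIM('a)" by (simp add: Suc_leI)
  then show ?thesis using \<alpha> by linarith
qed

text \<open>The scale is n + 1, hence never 0. The value at every single point depends only on the
  almost everywhere class of \<open>u\<close>.\<close>

definition approx :: "nat \<Rightarrow> 'a \<Rightarrow> real" where
  "approx n x = (LINT y|lborel. u y * kern \<alpha> (real (Suc n)) (x - y))"

text \<open>The right-hand side of the representation: a Lipschitz part that sees \<open>u\<close>
  on the whole space, and a localised Riesz potential of \<open>g\<close> that carries the singular
  behaviour.\<close>

definition limit :: "'a set \<Rightarrow> real \<Rightarrow> 'a \<Rightarrow> real" where
  "limit K R x = A * (LINT y|lborel. u y * kern \<alpha> R (x - y)) +
     (LINT y|lborel. indicator K y * g y * riesz_tail \<alpha> R (x - y))"

lemma approx_eq: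
  assumes R: "0 < R" "R \<le> real (Suc n)" and K: "compact K" "K \<subseteq> D" "cball x (1 / R) \<subseteq> K"
  shows "A * approx n x = A * (LINT y|lborel. u y * kern \<alpha> R (x - y)) +
    (LINT y|lborel. indicator K y * g y * cutoff_riesz \<alpha> R (real (Suc n)) (x - y))"
proof -
  have "A * approx n x = A * (LINT y|lborel. u y * kern \<alpha> R (x - y)) +
    (LINT s:{R..real (Suc n)}|lborel. s powr (real DIM('a) - 1 - \<alpha>) * (LINT y|lborel. g y * bump (s *\<^sub>R (x - y))))"
    unfolding approx_def using R K by (intro u_kern_diff) auto
  also have "(LINT s:{R..real (Suc n)}|lborel. s powr (real DIM('a) - 1 - \<alpha>) * (LINT y|lborel. g y * bump (s *\<^sub>R (x - y)))) =
    (LINT s:{R..real (Suc n)}|lborel. s powr (real DIM('a) - 1 - \<alpha>) * (LINT y|lborel. indicator K y * g y * bump (s *\<^sub>R (x - y))))"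
  proof (rule set_lebesgue_integral_cong)
    show "\<forall>s. s \<in> {R..real (Suc n)} \<longrightarrow> s powr (real DIM('a) - 1 - \<alpha>) * (LINT y|lborel. g y * bump (s *\<^sub>R (x - y))) =
      s powr (real DIM('a) - 1 - \<alpha>) * (LINT y|lborel. indicator K y * g y * bump (s *\<^sub>R (x - y)))"
    proof clarify
      fix s assume s: "s \<in> {R..real (Suc n)}"
      have "cball x (1 / s) \<subseteq> K"
        using K(3) s R by (intro order_trans[OF subset_cball K(3)]) (auto intro: frac_le)
      then have "g y * bump (s *\<^sub>R (x - y)) = indicator K y * g y * bump (s *\<^sub>R (x - y))" for y
        using s R by (intro g_bump_restrict) auto
      then have "(LINT y|lborel. g y * bump (s *\<^sub>R (x - y))) = (LINT y|lborel. indicator K y * g y * bump (s *\<^sub>R (x - y)))"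
        by (intro Bochner_Integration.integral_cong refl)
      then show "s powr (real DIM('a) - 1 - \<alpha>) * (LINT y|lborel. g y * bump (s *\<^sub>R (x - y))) =
        s powr (real DIM('a) - 1 - \<alpha>) * (LINT y|lborel. indicator K y * g y * bump (s *\<^sub>R (x - y)))" by (simp only:)
    qed
  qed simp
  also have "\<dots> = (LINT y|lborel. indicator K y * g y * cutoff_riesz \<alpha> R (real (Suc n)) (x - y))"
    by (rule cutoff_riesz_Fubini[OF g_integrable[OF K(1,2)] R])
  finally show ?thesis .
qed

lemma cutoff_riesz_dominated:
  assumes "0 < R" "R \<le> S" "x \<noteq> y"
  shows "\<bar>indicator K y * g y * cutoff_riesz \<alpha> R S (x - y)\<bar> \<le>
    \<bar>indicator K y * g y\<bar> * riesz_kernel \<alpha> (1 / R) (x - y) / (real DIM('a) - \<alpha>)"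
proof -
  have "\<bar>cutoff_riesz \<alpha> R S (x - y)\<bar> \<le> riesz_kernel \<alpha> (1 / R) (x - y) / (real DIM('a) - \<alpha>)"
    using assms by (intro cutoff_riesz_le[OF \<alpha>]) auto
  then have "\<bar>indicator K y * g y\<bar> * \<bar>cutoff_riesz \<alpha> R S (x - y)\<bar> \<le>
    \<bar>indicator K y * g y\<bar> * (riesz_kernel \<alpha> (1 / R) (x - y) / (real DIM('a) - \<alpha>))"
    by (rule mult_left_mono) simp
  then show ?thesis by (simp add: abs_mult)
qed

text \<open>A statement at a single point: whenever the truncated Riesz potential of |g| is finite
  at \<open>x\<close>, it provides the majorant. Almost every \<open>x\<close> qualifies by Fubini,
  and every \<open>x\<close> once \<open>g\<close> is locally bounded.\<close>

lemma approx_tendsto: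
  assumes R: "0 < R" and K: "compact K" "K \<subseteq> D" "cball x (1 / R) \<subseteq> K"
    and int: "integrable lborel (\<lambda>y. \<bar>indicator K y * g y\<bar> * riesz_kernel \<alpha> (1 / R) (x - y))"
  shows "(\<lambda>n. A * approx n x) \<longlonglongrightarrow> limit K R x"
proof -
  let ?h = "\<lambda>y. indicator K y * g y"
  have [measurable]: "?h \<in> borel_measurable borel" using g_integrable[OF K(1,2)] by auto
  \<comment> \<open>The maximum makes the cutoff estimates applicable to all \<open>n\<close>; it
    differs from n + 1 for finitely many \<open>n\<close> only.\<close>
  let ?S = "\<lambda>n. max R (real (Suc n))"
  have S: "R \<le> ?S n" for n by simp
  have lim: "(\<lambda>n. LINT y|lborel. ?h y * cutoff_riesz \<alpha> R (?S n) (x - y)) \<longlonglongrightarrow> (LINT y|lborel. ?h y * riesz_tail \<alpha> R (x - y))"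
  proof (rule integral_dominated_convergence)
    show "integrable lborel (\<lambda>y. \<bar>?h y\<bar> * riesz_kernel \<alpha> (1 / R) (x - y) / (real DIM('a) - \<alpha>))"
      using int by (rule integrable_divide)
    show "AE y in lborel. (\<lambda>n. ?h y * cutoff_riesz \<alpha> R (?S n) (x - y)) \<longlonglongrightarrow> ?h y * riesz_tail \<alpha> R (x - y)"
      using AE_lborel_singleton[of x]
    proof eventually_elim
      case (elim y)
      then have nz: "0 < norm (x - y)" by simp
      obtain N :: nat where N: "1 / norm (x - y) \<le> real N" using real_arch_simple by blast
      have "eventually (\<lambda>n. ?h y * cutoff_riesz \<alpha> R (?S n) (x - y) = ?h y * riesz_tail \<alpha> R (x - y)) sequentially"
        using eventually_ge_at_top[of N]
      proof eventually_elim
        case (elim n)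
        then have "1 / norm (x - y) \<le> ?S n" using N by simp
        then have 1: "1 \<le> ?S n * norm (x - y)" using nz by (simp only: divide_le_eq if_True)
        show ?case by (simp only: cutoff_riesz_eq_tail[OF R S 1])
      qed
      then show ?case by (rule tendsto_eventually)
    qed
    show "AE y in lborel. norm (?h y * cutoff_riesz \<alpha> R (?S n) (x - y)) \<le> \<bar>?h y\<bar> * riesz_kernel \<alpha> (1 / R) (x - y) / (real DIM('a) - \<alpha>)" for n
      using AE_lborel_singleton[of x]
    proof eventually_elim
      case (elim y)
      then have "x \<noteq> y" by simp
      from cutoff_riesz_dominated[OF R S this] show ?case by (simp only: real_norm_def)
    qed
  qed measurable
  obtain N :: nat where N: "R \<le> real N" using real_arch_simple by blast
  have "eventually (\<lambda>n. A * (LINT y|lborel. u y * kern \<alpha> R (x - y)) + (LINT y|lborel. ?h y * cutoff_riesz \<alpha> R (?S n) (x - y)) = A * approx n x) sequentially"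
    using eventually_ge_at_top[of N]
  proof eventually_elim
    case (elim n)
    then have "R \<le> real (Suc n)" using N by simp
    then show ?case using approx_eq[OF R _ K, of n] by (simp add: max_absorb2)
  qed
  moreover have "(\<lambda>n. A * (LINT y|lborel. u y * kern \<alpha> R (x - y)) + (LINT y|lborel. ?h y * cutoff_riesz \<alpha> R (?S n) (x - y))) \<longlonglongrightarrow> limit K R x"
    unfolding limit_def by (intro tendsto_intros lim)
  ultimately show ?thesis by (rule Lim_transform_eventually[rotated])
qed

text \<open>Scaling turns S^d (S |z|)^(-d-\<alpha>) into S^(-\<alpha>) |z|^(-d-\<alpha>), and
  S^(-\<alpha>) \<le> 1: the bound is uniform in the scale, as an approximate identity requires away
  from its centre.\<close>

lemma kern_large_le: "\<exists>C>0. \<forall>S\<ge>1. \<forall>z. z \<noteq> 0 \<longrightarrow> kern \<alpha> S (z::'a) \<le> C * norm z powr (- (real DIM('a) + \<alpha>))"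
proof -
  let ?p = "real DIM('a) + \<alpha>"
  obtain C where C: "0 < C" "\<And>x::'a. \<bar>kern \<alpha> 1 x\<bar> \<le> C * decay \<alpha> x"
    using kern_1_decay[OF \<alpha>] by blast
  have "kern \<alpha> S z \<le> C * norm z powr (- ?p)" if S: "1 \<le> S" and z: "z \<noteq> 0" for S and z :: 'a
  proof -
    have "kern \<alpha> S z = S ^ DIM('a) * kern \<alpha> 1 (S *\<^sub>R z)" using S by (intro kern_eq_scaled[OF \<alpha>]) auto
    also have "\<dots> \<le> S ^ DIM('a) * (C * decay \<alpha> (S *\<^sub>R z))"
      using C(2)[of "S *\<^sub>R z"] S by (intro mult_left_mono) auto
    also have "\<dots> \<le> S ^ DIM('a) * (C * norm (S *\<^sub>R z) powr (- ?p))"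
      using decay_le_powr[OF \<alpha>, of "S *\<^sub>R z"] S z C(1) by (intro mult_left_mono) auto
    also have "norm (S *\<^sub>R z) powr (- ?p) = S powr (- ?p) * norm z powr (- ?p)"
      using S powr_mult[of S "norm z" "- ?p"] by simp
    also have "S ^ DIM('a) * (C * (S powr (- ?p) * norm z powr (- ?p))) = (S powr real DIM('a) * S powr (- ?p)) * (C * norm z powr (- ?p))"
      using S by (simp add: powr_realpow)
    also have "S powr real DIM('a) * S powr (- ?p) = S powr (- \<alpha>)" by (simp add: powr_add[symmetric])
    also have "S powr (- \<alpha>) * (C * norm z powr (- ?p)) \<le> 1 * (C * norm z powr (- ?p))"
      using S \<alpha> C(1) powr_mono2'[of "- \<alpha>" 1 S] by (intro mult_right_mono) auto
    finally show ?thesis by simp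
  qed
  with C(1) show ?thesis by blast
qed

section \<open>Averages of the kernel over bounded sets\<close>

lemma kern_nonneg: "0 < S \<Longrightarrow> 0 \<le> kern \<alpha> S (z::'a)"
  using kern_eq_scaled[OF \<alpha>, of S z] kern_1_nonneg[OF \<alpha>, of "S *\<^sub>R z"] by simp

text \<open>The adjoint side of the convolution. Integrating \<open>approx n\<close> over
  \<open>K\<close> moves the kernel onto the indicator of \<open>K\<close>, where convergence is
  easy, whereas \<open>u\<close> offers no regularity to start from.\<close>

definition averaged :: "'a set \<Rightarrow> real \<Rightarrow> 'a \<Rightarrow> real" where
  "averaged K S y = (LINT x|lborel. indicator K x * kern \<alpha> S (x - y))"

lemma averaged_eq:
  assumes S: "0 < S"
  shows "averaged K S y = (LINT w|lborel. indicator K (y + (1 / S) *\<^sub>R w) * kern \<alpha> 1 w)"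
proof -
  have "averaged K S y = \<bar>1 / S\<bar> ^ DIM('a) * (LINT w|lborel. indicator K (y + (1 / S) *\<^sub>R w) * kern \<alpha> S (y + (1 / S) *\<^sub>R w - y))"
    unfolding averaged_def using S by (intro integral_affine_euclidean) auto
  also have "\<dots> = (LINT w|lborel. \<bar>1 / S\<bar> ^ DIM('a) * (indicator K (y + (1 / S) *\<^sub>R w) * kern \<alpha> S (y + (1 / S) *\<^sub>R w - y)))"
    by (rule integral_mult_right_zero[symmetric])
  also have "\<dots> = (LINT w|lborel. indicator K (y + (1 / S) *\<^sub>R w) * kern \<alpha> 1 w)"
  proof (rule Bochner_Integration.integral_cong)
    fix w :: 'a
    have "kern \<alpha> S (y + (1 / S) *\<^sub>R w - y) = S ^ DIM('a) * kern \<alpha> 1 w"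
      using S kern_eq_scaled[OF \<alpha> S, of "(1 / S) *\<^sub>R w"] by simp
    then show "\<bar>1 / S\<bar> ^ DIM('a) * (indicator K (y + (1 / S) *\<^sub>R w) * kern \<alpha> S (y + (1 / S) *\<^sub>R w - y)) = indicator K (y + (1 / S) *\<^sub>R w) * kern \<alpha> 1 w"
      using S by (simp add: power_one_over field_simps)
  qed simp
  finally show ?thesis .
qed

text \<open>Away from the frontier the indicator is constant near \<open>y\<close>; after rescaling,
  \<open>kern \<alpha> 1\<close> is the majorant.\<close>

lemma averaged_tendsto:
  assumes [measurable]: "K \<in> sets borel" and y: "y \<notin> frontier K"
  shows "(\<lambda>n. averaged K (real (Suc n)) y) \<longlonglongrightarrow> kern_mass TYPE('a) \<alpha> * indicator K y"
proof -
  have "(\<lambda>n. LINT w|lborel. indicator K (y + (1 / real (Suc n)) *\<^sub>R w) * kern \<alpha> 1 w) \<longlonglongrightarrow> (LINT w|lborel. indicator K y * kern \<alpha> 1 (w::'a))"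
  proof (rule integral_dominated_convergence)
    show "integrable lborel (kern \<alpha> 1 :: 'a \<Rightarrow> real)" by (rule integrable_kern_1[OF \<alpha>])
    show "AE w in lborel. (\<lambda>n. indicator K (y + (1 / real (Suc n)) *\<^sub>R w) * kern \<alpha> 1 w) \<longlonglongrightarrow> indicator K y * kern \<alpha> 1 w"
    proof (intro AE_I2)
      fix w :: 'a
      have "(\<lambda>n. y + (1 / real (Suc n)) *\<^sub>R w) \<longlonglongrightarrow> y + 0 *\<^sub>R w"
        by (intro tendsto_intros LIMSEQ_Suc lim_1_over_n)
      then have l: "(\<lambda>n. y + (1 / real (Suc n)) *\<^sub>R w) \<longlonglongrightarrow> y" by simp
      consider "y \<in> interior K" | "y \<in> - closure K" using y by (auto simp: frontier_def)
      then have "eventually (\<lambda>n. (indicator K (y + (1 / real (Suc n)) *\<^sub>R w) :: real) = indicator K y) sequentially"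
      proof cases
        case 1
        then have "y \<in> K" using interior_subset by blast
        moreover have "eventually (\<lambda>n. y + (1 / real (Suc n)) *\<^sub>R w \<in> interior K) sequentially"
          using topological_tendstoD[OF l open_interior 1] .
        ultimately show ?thesis
          by (auto elim!: eventually_mono simp: indicator_def subsetD[OF interior_subset])
      next
        case 2
        then have "y \<notin> K" using closure_subset by blast
        moreover have "eventually (\<lambda>n. y + (1 / real (Suc n)) *\<^sub>R w \<in> - closure K) sequentially"
          using topological_tendstoD[OF l _ 2] by auto
        ultimately show ?thesis
          by (auto elim!: eventually_mono simp: indicator_def dest: subsetD[OF closure_subset])
      qed
      then have "(\<lambda>n. indicator K (y + (1 / real (Suc n)) *\<^sub>R w) :: real) \<longlonglongrightarrow> indicator K y"
        by (rule tendsto_eventually)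
      then show "(\<lambda>n. indicator K (y + (1 / real (Suc n)) *\<^sub>R w) * kern \<alpha> 1 w) \<longlonglongrightarrow> indicator K y * kern \<alpha> 1 w"
        by (intro tendsto_intros)
    qed
    show "AE w in lborel. norm (indicator K (y + (1 / real (Suc n)) *\<^sub>R w) * kern \<alpha> 1 w) \<le> kern \<alpha> 1 w" for n
      using kern_1_nonneg[OF \<alpha>, where 'a='a] by (auto simp: indicator_def)
  qed measurable
  then show ?thesis by (simp add: averaged_eq kern_mass_def mult.commute)
qed

text \<open>The majorant against \<open>u\<close>, uniform in \<open>n\<close>. For |y| \<le> 2
  \<rho> the total mass is a bound; beyond, every \<open>x\<close> in \<open>K\<close> satisfies |x
  - y| \<ge> |y| / 2 and \<open>kern_large_le\<close> applies.\<close>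

lemma averaged_le:
  assumes [measurable]: "K \<in> sets borel" and K: "K \<subseteq> cball 0 \<rho>" and \<rho>: "0 < \<rho>"
  shows "\<exists>C>0. \<forall>n y. \<bar>averaged K (real (Suc n)) y\<bar> \<le> C * decay \<alpha> y"
proof -
  let ?p = "real DIM('a) + \<alpha>"
  obtain C where C: "0 < C" "\<And>S z::'a. 1 \<le> S \<Longrightarrow> z \<noteq> 0 \<Longrightarrow> kern \<alpha> S z \<le> C * norm z powr (- ?p)"
    using kern_large_le by blast
  let ?V = "measure lborel (cball (0::'a) \<rho>)"
  define r where "r = ((1 + \<rho>) / \<rho>) powr ?p"
  define M where "M = kern_mass TYPE('a) \<alpha> * (1 + 2 * \<rho>) powr ?p + C * (2 powr ?p * r) * ?V"
  have M: "0 < M"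
    unfolding M_def r_def using mass_pos C(1) \<rho> by (intro add_pos_nonneg mult_pos_pos) auto
  have nn: "0 \<le> averaged K (real (Suc n)) y" for n y
    unfolding averaged_def by (intro Bochner_Integration.integral_nonneg mult_nonneg_nonneg kern_nonneg) auto
  have "averaged K (real (Suc n)) y \<le> M * decay \<alpha> y" for n y
  proof (cases "norm y \<le> 2 * \<rho>")
    case True
    have eq: "averaged K (real (Suc n)) y = (LINT w|lborel. indicator K (y + (1 / real (Suc n)) *\<^sub>R w) * kern \<alpha> 1 w)"
      by (rule averaged_eq) simp
    have "averaged K (real (Suc n)) y \<le> kern_mass TYPE('a) \<alpha>"
      unfolding eq kern_mass_def
    proof (rule integral_mono)
      show "integrable lborel (kern \<alpha> 1 :: 'a \<Rightarrow> real)" by (rule integrable_kern_1[OF \<alpha>])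
      then show "integrable lborel (\<lambda>w. indicator K (y + (1 / real (Suc n)) *\<^sub>R w) * kern \<alpha> 1 w)"
        by (rule Bochner_Integration.integrable_bound) (auto simp: indicator_def)
    qed (auto simp: indicator_def kern_1_nonneg[OF \<alpha>])
    also have "kern_mass TYPE('a) \<alpha> = kern_mass TYPE('a) \<alpha> * (1 + 2 * \<rho>) powr ?p * (1 + 2 * \<rho>) powr (- ?p)"
      using \<rho> by (simp add: powr_add[symmetric] mult.assoc)
    also have "\<dots> \<le> M * (1 + 2 * \<rho>) powr (- ?p)"
      unfolding M_def r_def using C(1) by (intro mult_right_mono) auto
    also have "\<dots> \<le> M * (1 + norm y) powr (- ?p)"
      using M True \<alpha> by (intro mult_left_mono powr_mono2') (auto intro: add_pos_nonneg)
    also have "\<dots> = M * decay \<alpha> y" by (simp add: decay_def)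
    finally show ?thesis .
  next
    case False
    have le: "indicator K x * kern \<alpha> (real (Suc n)) (x - y) \<le> (C * (2 powr ?p * (r * decay \<alpha> y))) * indicator (cball 0 \<rho>) x" for x
    proof (cases "x \<in> K")
      case True
      then have x: "norm x \<le> \<rho>" using K by auto
      have xy: "norm y / 2 \<le> norm (x - y)"
        using x False norm_triangle_ineq2[of y x] by (simp add: norm_minus_commute)
      then have "x - y \<noteq> 0" using False \<rho> by auto
      then have "kern \<alpha> (real (Suc n)) (x - y) \<le> C * norm (x - y) powr (- ?p)" by (intro C) auto
      also have "\<dots> \<le> C * (norm y / 2) powr (- ?p)"
        using xy False \<rho> C(1) \<alpha> by (intro mult_left_mono powr_mono2') auto
      also have "(norm y / 2) powr (- ?p) = 2 powr ?p * norm y powr (- ?p)"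
        by (simp only: powr_divide powr_minus) (simp add: field_simps)
      also have "C * (2 powr ?p * norm y powr (- ?p)) \<le> C * (2 powr ?p * (r * decay \<alpha> y))"
        using norm_powr_le_decay[OF \<alpha>, of \<rho> y] False \<rho> C(1) unfolding r_def by (intro mult_left_mono) auto
      finally show ?thesis using True x by simp
    next
      case False
      then show ?thesis using C(1) decay_pos[of \<alpha> y] by (simp add: r_def)
    qed
    have "averaged K (real (Suc n)) y \<le> (LINT x|lborel. (C * (2 powr ?p * (r * decay \<alpha> y))) * indicator (cball 0 \<rho>) (x::'a))"
      unfolding averaged_def
    proof (rule integral_mono)
      show ind: "integrable lborel (\<lambda>x::'a. (C * (2 powr ?p * (r * decay \<alpha> y))) * indicator (cball 0 \<rho>) x)"
        using emeasure_lborel_cball_finite[of "0::'a" \<rho>] by (intro integrable_mult_right) (simp add: less_top)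
      show "integrable lborel (\<lambda>x. indicator K x * kern \<alpha> (real (Suc n)) (x - y))"
      proof (rule Bochner_Integration.integrable_bound[OF ind])
        show "AE x in lborel. norm (indicator K x * kern \<alpha> (real (Suc n)) (x - y)) \<le> norm ((C * (2 powr ?p * (r * decay \<alpha> y))) * indicator (cball 0 \<rho>) x)"
        proof (intro AE_I2)
          fix x
          have "0 \<le> indicator K x * kern \<alpha> (real (Suc n)) (x - y)" by (intro mult_nonneg_nonneg kern_nonneg) auto
          with le[of x] show "norm (indicator K x * kern \<alpha> (real (Suc n)) (x - y)) \<le> norm ((C * (2 powr ?p * (r * decay \<alpha> y))) * indicator (cball 0 \<rho>) x)"
            unfolding real_norm_def by linarith
        qed
      qed measurable
    qed (rule le)
    also have "\<dots> = C * (2 powr ?p * (r * decay \<alpha> y)) * ?V"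
      by simp
    also have "\<dots> \<le> M * decay \<alpha> y"
      using mass_pos \<rho> decay_pos[of \<alpha> y] by (simp add: M_def algebra_simps)
    finally show ?thesis .
  qed
  then show ?thesis using M nn by (intro exI[of _ M]) (auto simp: abs_le_iff intro: order_trans[of _ 0])
qed

lemma integral_approx_eq:
  assumes [measurable]: "K \<in> sets borel" and K: "K \<subseteq> cball 0 \<rho>"
  shows "(LINT x|lborel. indicator K x * approx n x) = (LINT y|lborel. u y * averaged K (real (Suc n)) y)"
    and "integrable lborel (\<lambda>x. indicator K x * approx n x)"
proof -
  obtain C where C: "0 < C" "\<And>x y. norm x \<le> \<rho> \<Longrightarrow> \<bar>kern \<alpha> (real (Suc n)) (x - y)\<bar> \<le> C * decay \<alpha> (y::'a)"
    using scaled_kern_le[of "real (Suc n)" \<rho>] by auto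
  let ?F = "\<lambda>x y. indicator K x * (u y * kern \<alpha> (real (Suc n)) (x - y))"
  have "emeasure lborel K < \<infinity>"
    using K by (intro emeasure_bounded_finite) (meson bounded_cball bounded_subset)
  then have iK: "integrable lborel (\<lambda>x. C * indicator K x)" by (intro integrable_mult_right) (simp add: less_top)
  have int: "integrable (lborel \<Otimes>\<^sub>M lborel) (\<lambda>(x, y). ?F x y)"
  proof (rule Bochner_Integration.integrable_bound[OF integrable_pair_mult[OF iK u_integrable]])
    show "AE p in lborel \<Otimes>\<^sub>M lborel. norm (case p of (x, y) \<Rightarrow> ?F x y) \<le> norm (case p of (x, y) \<Rightarrow> C * indicator K x * (\<bar>u y\<bar> * decay \<alpha> y))"
    proof (intro AE_I2, clarify)
      fix x y :: 'a
      have "\<bar>u y\<bar> * \<bar>kern \<alpha> (real (Suc n)) (x - y)\<bar> \<le> \<bar>u y\<bar> * (C * decay \<alpha> y)" if "x \<in> K"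
        using that K by (intro mult_left_mono C) auto
      then show "norm (?F x y) \<le> norm (C * indicator K x * (\<bar>u y\<bar> * decay \<alpha> y))"
        using C(1) decay_pos[of \<alpha> y] by (cases "x \<in> K") (auto simp: abs_mult mult_ac)
    qed
  qed measurable
  have eq: "indicator K x * approx n x = (LINT y|lborel. ?F x y)" for x
    by (simp add: approx_def)
  show "integrable lborel (\<lambda>x. indicator K x * approx n x)"
    unfolding eq using lborel_pair.integrable_fst[OF int] by simp
  have "(LINT x|lborel. indicator K x * approx n x) = (LINT y|lborel. LINT x|lborel. ?F x y)"
    unfolding eq by (rule lborel_pair.Fubini_integral[symmetric, OF int])
  also have "\<dots> = (LINT y|lborel. LINT x|lborel. u y * (indicator K x * kern \<alpha> (real (Suc n)) (x - y)))"
    by (simp add: mult_ac)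
  also have "\<dots> = (LINT y|lborel. u y * averaged K (real (Suc n)) y)"
    unfolding averaged_def by (simp only: integral_mult_right_zero)
  finally show "(LINT x|lborel. indicator K x * approx n x) = (LINT y|lborel. u y * averaged K (real (Suc n)) y)" .
qed

text \<open>Convexity enters through the frontier, which is then a null set. Boxes intersected with
  balls, to which the lemma is applied, are convex.\<close>

lemma integral_approx_tendsto:
  assumes K[measurable]: "K \<in> sets borel" and cK: "convex K" and bK: "bounded K"
  shows "(\<lambda>n. LINT x|lborel. indicator K x * approx n x) \<longlonglongrightarrow> kern_mass TYPE('a) \<alpha> * (LINT x|lborel. indicator K x * u x)"
proof -
  obtain \<rho> where \<rho>: "0 < \<rho>" "K \<subseteq> cball 0 \<rho>" using bK by (auto simp: bounded_pos subset_eq)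
  obtain C where C: "0 < C" "\<And>n y. \<bar>averaged K (real (Suc n)) y\<bar> \<le> C * decay \<alpha> y"
    using averaged_le[OF K \<rho>(2,1)] by blast
  have [measurable]: "averaged K (real (Suc n)) \<in> borel_measurable borel" for n
    unfolding averaged_def[abs_def] by measurable
  have "negligible (frontier K)" by (rule negligible_convex_frontier[OF cK])
  then have "frontier K \<in> null_sets lborel"
    by (simp add: negligible_iff_null_sets null_sets_completion_iff)
  then have AE: "AE y in lborel. y \<notin> frontier K" by (rule AE_not_in)
  have "(\<lambda>n. LINT y|lborel. u y * averaged K (real (Suc n)) y) \<longlonglongrightarrow> (LINT y|lborel. u y * (kern_mass TYPE('a) \<alpha> * indicator K y))"
  proof (rule integral_dominated_convergence)
    show "integrable lborel (\<lambda>y. C * (\<bar>u y\<bar> * decay \<alpha> y))" using u_integrable by simp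
    show "AE y in lborel. (\<lambda>n. u y * averaged K (real (Suc n)) y) \<longlonglongrightarrow> u y * (kern_mass TYPE('a) \<alpha> * indicator K y)"
      using AE by eventually_elim (intro tendsto_intros averaged_tendsto K)
    show "AE y in lborel. norm (u y * averaged K (real (Suc n)) y) \<le> C * (\<bar>u y\<bar> * decay \<alpha> y)" for n
      using mult_left_mono[OF C(2)[of n] abs_ge_zero[of "u _"]] by (intro AE_I2) (simp add: abs_mult mult_ac)
  qed measurable
  also have "(LINT y|lborel. u y * (kern_mass TYPE('a) \<alpha> * indicator K y)) = kern_mass TYPE('a) \<alpha> * (LINT x|lborel. indicator K x * u x)"
    by (subst integral_mult_right_zero[symmetric]) (simp add: mult_ac)
  finally show ?thesis
    using integral_approx_eq(1)[OF K \<rho>(2)] by simp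
qed

lemma u_kern_bound:
  assumes R: "0 < R"
  shows "\<exists>c\<ge>0. \<forall>x. norm x \<le> \<rho> \<longrightarrow> \<bar>LINT y|lborel. u y * kern \<alpha> R (x - y)\<bar> \<le> c"
proof -
  obtain C where C: "0 < C" "\<And>x y. norm x \<le> \<rho> \<Longrightarrow> \<bar>kern \<alpha> R (x - y)\<bar> \<le> C * decay \<alpha> (y::'a)"
    using scaled_kern_le[OF R, of \<rho>] by blast
  have "\<bar>LINT y|lborel. u y * kern \<alpha> R (x - y)\<bar> \<le> C * (LINT y|lborel. \<bar>u y\<bar> * decay \<alpha> y)" if x: "norm x \<le> \<rho>" for x
  proof -
    have "\<bar>LINT y|lborel. u y * kern \<alpha> R (x - y)\<bar> \<le> (LINT y|lborel. \<bar>u y * kern \<alpha> R (x - y)\<bar>)"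
      by (rule integral_abs_bound)
    also have "\<dots> \<le> (LINT y|lborel. C * (\<bar>u y\<bar> * decay \<alpha> y))"
    proof (rule integral_mono)
      show "integrable lborel (\<lambda>y. \<bar>u y * kern \<alpha> R (x - y)\<bar>)" using R by (intro integrable_abs integrable_u_kern)
      show "integrable lborel (\<lambda>y. C * (\<bar>u y\<bar> * decay \<alpha> y))" using u_integrable by simp
      fix y
      have "\<bar>u y\<bar> * \<bar>kern \<alpha> R (x - y)\<bar> \<le> \<bar>u y\<bar> * (C * decay \<alpha> y)"
        using x by (intro mult_left_mono C) auto
      then show "\<bar>u y * kern \<alpha> R (x - y)\<bar> \<le> C * (\<bar>u y\<bar> * decay \<alpha> y)" by (simp add: abs_mult mult_ac)
    qed
    also have "\<dots> = C * (LINT y|lborel. \<bar>u y\<bar> * decay \<alpha> y)" by (rule integral_mult_right_zero)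
    finally show ?thesis .
  qed
  moreover have "0 \<le> C * (LINT y|lborel. \<bar>u y\<bar> * decay \<alpha> y)"
    using C(1) by (intro mult_nonneg_nonneg Bochner_Integration.integral_nonneg) (auto intro: less_imp_le decay_pos)
  ultimately show ?thesis by blast
qed

lemma integrable_u_cball: "integrable lborel (\<lambda>x. indicator (cball x0 \<rho>) x * u x)"
proof -
  define b where "b = (1 + (norm x0 + \<bar>\<rho>\<bar>)) powr (- (real DIM('a) + \<alpha>))"
  have b: "0 < b" unfolding b_def by (simp add: add_pos_nonneg add_nonneg_eq_0_iff)
  have "b \<le> decay \<alpha> x" if "x \<in> cball x0 \<rho>" for x
  proof -
    have "norm x \<le> norm x0 + \<bar>\<rho>\<bar>" using that norm_triangle_ineq2[of x x0] by (simp add: dist_norm norm_minus_commute)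
    then have "b \<le> (1 + norm x) powr (- (real DIM('a) + \<alpha>))"
      unfolding b_def using \<alpha> by (intro powr_mono2') (auto intro: add_pos_nonneg)
    then show ?thesis by (simp add: decay_def)
  qed
  then have "\<bar>indicator (cball x0 \<rho>) x\<bar> \<le> (1 / b) * decay \<alpha> x" for x
    using b decay_pos[of \<alpha> x] by (cases "x \<in> cball x0 \<rho>") (auto simp: field_simps)
  from u_mult_integrable[OF _ this] show ?thesis by (simp add: mult.commute)
qed

text \<open>Two limits of the same sequence are compared. Pointwise almost everywhere it tends to
  \<open>limit K R\<close>, the potential of |g| being finite almost everywhere as a convolution of
  integrable functions; in the mean over boxes it tends to a multiple of \<open>u\<close>. So both
  have the same integrals over all boxes inside the ball.\<close>

lemma AE_approx_tendsto:
  assumes R: "0 < R" and \<rho>: "0 < \<rho>" and sub: "cball x0 (\<rho> + 1 / R) \<subseteq> D"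
  defines "K \<equiv> cball x0 (\<rho> + 1 / R)"
  shows "AE x in lborel. x \<in> ball x0 \<rho> \<longrightarrow>
    integrable lborel (\<lambda>y. \<bar>indicator K y * g y\<bar> * riesz_kernel \<alpha> (1 / R) (x - y)) \<and>
    A * kern_mass TYPE('a) \<alpha> * u x = limit K R x"
proof -
  let ?B = "ball x0 \<rho>"
  let ?h = "\<lambda>y. indicator K y * g y" and ?k = "riesz_kernel \<alpha> (1 / R) :: 'a \<Rightarrow> real"
  have K: "compact K" "K \<subseteq> D" using sub by (auto simp: K_def)
  have cb: "cball x (1 / R) \<subseteq> K" if "x \<in> ?B" for x
  proof
    fix z assume "z \<in> cball x (1 / R)"
    with that dist_triangle[of x0 z x] show "z \<in> K" by (simp add: K_def dist_commute)
  qed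
  have h: "integrable lborel ?h" by (rule g_integrable[OF K])
  then have [measurable]: "?h \<in> borel_measurable borel" by auto
  have k: "integrable lborel ?k" by (rule integrable_riesz_kernel[OF \<alpha>(1)])
  have conv: "integrable (lborel \<Otimes>\<^sub>M lborel) (\<lambda>(x, y). \<bar>?h y\<bar> * ?k (x - y))"
    by (rule integrable_convolution[OF integrable_abs[OF h] k])
  have AE1: "AE x in lborel. integrable lborel (\<lambda>y. \<bar>?h y\<bar> * ?k (x - y))"
    using lborel_pair.AE_integrable_fst'[OF conv] by simp
  have AE2: "AE x in lborel. x \<in> ?B \<longrightarrow> (\<lambda>n. A * approx n x) \<longlonglongrightarrow> limit K R x"
    using AE1 by eventually_elim (use approx_tendsto[OF R K cb] in blast)
  have [measurable]: "approx n \<in> borel_measurable borel" for n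
    unfolding approx_def[abs_def] by measurable
  have [measurable]: "limit K R \<in> borel_measurable borel"
    unfolding limit_def[abs_def] using R by measurable
  obtain \<rho>' where "?B \<subseteq> cball 0 \<rho>'" using bounded_ball[of x0 \<rho>] by (auto simp: bounded_pos subset_eq)
  then have bB: "?B \<subseteq> cball 0 (max 1 \<rho>')" by auto
  obtain c' where c': "0 \<le> c'" "\<And>x. norm x \<le> max 1 \<rho>' \<Longrightarrow> \<bar>LINT y|lborel. u y * kern \<alpha> R (x - y)\<bar> \<le> c'"
    using u_kern_bound[OF R] by blast
  define c where "c = A * c'"
  \<comment> \<open>A majorant of \<open>A * approx n\<close> on the ball: \<open>c\<close> bounds
    the part with \<open>kern \<alpha> R\<close>, and the Riesz potential of |g| bounds the rest for
    all scales at once.\<close>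
  define dom where "dom x = c * indicator ?B x + (LINT y|lborel. \<bar>?h y\<bar> * ?k (x - y)) / (real DIM('a) - \<alpha>)" for x
  have dom: "integrable lborel dom"
  proof -
    have "integrable lborel (\<lambda>x. LINT y|lborel. \<bar>?h y\<bar> * ?k (x - y))"
      using lborel_pair.integrable_fst[OF conv] by simp
    moreover have "integrable lborel (\<lambda>x. c * indicator ?B x)"
      using emeasure_lborel_ball_finite[of x0 \<rho>] by (intro integrable_mult_right) (simp add: less_top)
    ultimately show ?thesis unfolding dom_def[abs_def] by (intro Bochner_Integration.integrable_add integrable_divide)
  qed
  have bound1: "\<bar>A * (LINT y|lborel. u y * kern \<alpha> R (x - y))\<bar> \<le> c" if x: "x \<in> ?B" for x
    using c'(2)[of x] x bB A by (auto simp: c_def abs_mult)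
  have bound: "AE x in lborel. x \<in> ?B \<longrightarrow> (\<forall>n. R \<le> real (Suc n) \<longrightarrow> \<bar>A * approx n x\<bar> \<le> dom x)"
    using AE1
  proof eventually_elim
    case (elim x)
    show ?case
    proof clarify
      fix n assume x: "x \<in> ?B" and n: "R \<le> real (Suc n)"
      have "\<bar>LINT y|lborel. ?h y * cutoff_riesz \<alpha> R (real (Suc n)) (x - y)\<bar> \<le> (LINT y|lborel. \<bar>?h y\<bar> * ?k (x - y) / (real DIM('a) - \<alpha>))"
      proof (rule order_trans[OF integral_abs_bound integral_mono_AE])
        have AEb: "AE y in lborel. \<bar>?h y * cutoff_riesz \<alpha> R (real (Suc n)) (x - y)\<bar> \<le> \<bar>?h y\<bar> * ?k (x - y) / (real DIM('a) - \<alpha>)"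
          using AE_lborel_singleton[of x] by eventually_elim (rule cutoff_riesz_dominated[OF R n], auto)
        then show "AE y in lborel. \<bar>?h y * cutoff_riesz \<alpha> R (real (Suc n)) (x - y)\<bar> \<le> \<bar>?h y\<bar> * ?k (x - y) / (real DIM('a) - \<alpha>)" .
        show i: "integrable lborel (\<lambda>y. \<bar>?h y\<bar> * ?k (x - y) / (real DIM('a) - \<alpha>))"
          using elim by (rule integrable_divide)
        show "integrable lborel (\<lambda>y. \<bar>?h y * cutoff_riesz \<alpha> R (real (Suc n)) (x - y)\<bar>)"
        proof (rule Bochner_Integration.integrable_bound[OF i])
          show "AE y in lborel. norm \<bar>?h y * cutoff_riesz \<alpha> R (real (Suc n)) (x - y)\<bar> \<le> norm (\<bar>?h y\<bar> * ?k (x - y) / (real DIM('a) - \<alpha>))"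
            using AEb
          proof eventually_elim
            case (elim y)
            then show ?case unfolding real_norm_def abs_abs by (rule order_trans[OF _ abs_ge_self])
          qed
        qed measurable
      qed
      also have "\<dots> = (LINT y|lborel. \<bar>?h y\<bar> * ?k (x - y)) / (real DIM('a) - \<alpha>)"
        by (rule integral_divide_zero)
      finally show "\<bar>A * approx n x\<bar> \<le> dom x"
        using bound1[OF x] x unfolding approx_eq[OF R n K cb[OF x]] dom_def by simp
    qed
  qed
  obtain N :: nat where N: "R \<le> real N" using real_arch_simple by blast
  \<comment> \<open>A shift of the index, after which every scale is at least \<open>R\<close> and
    the bound \<open>dom\<close> holds for the whole sequence.\<close>
  define S where "S n = n + N" for n
  have S: "R \<le> real (Suc (S n))" for n using N by (simp add: S_def)
  have S_lim: "filterlim S at_top sequentially" unfolding S_def by (rule filterlim_add_const_nat_at_top)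
  let ?f = "\<lambda>x. indicator ?B x * (A * kern_mass TYPE('a) \<alpha> * u x - limit K R x)"
  have iu: "integrable lborel (\<lambda>x. indicator ?B x * u x)"
    by (rule Bochner_Integration.integrable_bound[OF integrable_u_cball[of x0 \<rho>]]) (auto simp: indicator_def)
  have il: "integrable lborel (\<lambda>x. indicator ?B x * limit K R x)"
  proof (rule Bochner_Integration.integrable_bound[OF dom])
    show "AE x in lborel. norm (indicator ?B x * limit K R x) \<le> norm (dom x)"
      using AE2 bound
    proof eventually_elim
      case (elim x)
      show ?case
      proof (cases "x \<in> ?B")
        case True
        have "(\<lambda>n. \<bar>A * approx (S n) x\<bar>) \<longlonglongrightarrow> \<bar>limit K R x\<bar>"
          using elim(1) True S_lim by (intro tendsto_rabs) (auto intro: filterlim_compose)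
        then have "\<bar>limit K R x\<bar> \<le> dom x"
          by (rule LIMSEQ_le_const2) (use elim(2) True S in blast)
        then show ?thesis using True by simp
      qed simp
    qed
  qed measurable
  \<comment> \<open>The test sets are boxes cut by the ball: \<open>limit K R\<close> represents
    \<open>u\<close> only inside, and the intersections remain convex.\<close>
  have "AE x in lborel. ?f x = 0"
  proof (rule AE_eq_0_if_box_integrals_eq_0)
    have "integrable lborel (\<lambda>x. A * kern_mass TYPE('a) \<alpha> * (indicator ?B x * u x) - indicator ?B x * limit K R x)"
      using iu il by (intro Bochner_Integration.integrable_diff integrable_mult_right)
    then show f: "integrable lborel ?f" by (simp add: algebra_simps)
    fix a b :: 'a
    let ?X = "box a b \<inter> ?B"
    have X[measurable]: "?X \<in> sets borel" by auto
    have "(\<lambda>n. A * (LINT x|lborel. indicator ?X x * approx n x)) \<longlonglongrightarrow> A * (kern_mass TYPE('a) \<alpha> * (LINT x|lborel. indicator ?X x * u x))"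
      by (intro tendsto_intros integral_approx_tendsto X convex_Int convex_box convex_ball) (auto intro: bounded_Int)
    then have l1: "(\<lambda>n. A * (LINT x|lborel. indicator ?X x * approx (S n) x)) \<longlonglongrightarrow> A * (kern_mass TYPE('a) \<alpha> * (LINT x|lborel. indicator ?X x * u x))"
      using S_lim by (rule filterlim_compose)
    have "(\<lambda>n. LINT x|lborel. indicator ?X x * (A * approx (S n) x)) \<longlonglongrightarrow> (LINT x|lborel. indicator ?X x * limit K R x)"
    proof (rule integral_dominated_convergence[OF _ _ dom])
      show "AE x in lborel. (\<lambda>n. indicator ?X x * (A * approx (S n) x)) \<longlonglongrightarrow> indicator ?X x * limit K R x"
        using AE2
      proof eventually_elim
        case (elim x)
        show ?case
        proof (cases "x \<in> ?B")
          case True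
          then have "(\<lambda>n. A * approx (S n) x) \<longlonglongrightarrow> limit K R x"
            using elim S_lim by (auto intro: filterlim_compose)
          then show ?thesis by (intro tendsto_intros)
        qed simp
      qed
      show "AE x in lborel. norm (indicator ?X x * (A * approx (S n) x)) \<le> dom x" for n
        using bound
      proof eventually_elim
        case (elim x)
        have "0 \<le> dom x"
          using A c'(1) dim_gt riesz_kernel_nonneg
          unfolding dom_def c_def
          by (intro add_nonneg_nonneg mult_nonneg_nonneg divide_nonneg_nonneg Bochner_Integration.integral_nonneg) auto
        with elim S[of n] show ?case by (auto simp: indicator_def)
      qed
    qed measurable
    also have "(\<lambda>n. LINT x|lborel. indicator ?X x * (A * approx (S n) x)) = (\<lambda>n. A * (LINT x|lborel. indicator ?X x * approx (S n) x))"
      by (subst integral_mult_right_zero[symmetric]) (simp add: mult_ac)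
    finally have eq: "A * (kern_mass TYPE('a) \<alpha> * (LINT x|lborel. indicator ?X x * u x)) = (LINT x|lborel. indicator ?X x * limit K R x)"
      using LIMSEQ_unique[OF l1] by simp
    have "(LINT x:box a b|lborel. ?f x) = (LINT x|lborel. A * kern_mass TYPE('a) \<alpha> * (indicator ?X x * u x) - indicator ?X x * limit K R x)"
      unfolding set_lebesgue_integral_def
      by (intro Bochner_Integration.integral_cong) (auto simp: indicator_def)
    also have "\<dots> = (LINT x|lborel. A * kern_mass TYPE('a) \<alpha> * (indicator ?X x * u x)) - (LINT x|lborel. indicator ?X x * limit K R x)"
    proof (rule Bochner_Integration.integral_diff)
      show "integrable lborel (\<lambda>x. A * kern_mass TYPE('a) \<alpha> * (indicator ?X x * u x))"
        by (rule integrable_mult_right, rule Bochner_Integration.integrable_bound[OF iu]) (auto simp: indicator_def)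
      show "integrable lborel (\<lambda>x. indicator ?X x * limit K R x)"
        by (rule Bochner_Integration.integrable_bound[OF il]) (auto simp: indicator_def)
    qed
    also have "(LINT x|lborel. A * kern_mass TYPE('a) \<alpha> * (indicator ?X x * u x)) = A * kern_mass TYPE('a) \<alpha> * (LINT x|lborel. indicator ?X x * u x)"
      by (rule integral_mult_right_zero)
    finally show "(LINT x:box a b|lborel. ?f x) = 0" using eq by simp
  qed
  with AE1 show ?thesis by eventually_elim auto
qed

end

subsection \<open>Local boundedness\<close>

text \<open>Pointwise core of the composition of Riesz kernels, with p = |x - y|, q = |y - z| and
  \<rho> = |x - z|. The larger of \<open>p\<close> and \<open>q\<close> is at least \<rho>/2 and
  pays the power a - s; its remaining power \<open>s\<close> is passed to the smaller one.\<close>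

lemma riesz_composition_le:
  fixes p q \<rho> a b s :: real
  assumes "0 < p" "0 < q" "0 < \<rho>" "\<rho> \<le> p + q" "0 \<le> s" "s \<le> a" "a \<le> b"
  shows "p powr (-a) * q powr (-b) \<le> (\<rho> / 2) powr (-(a - s)) * (p powr (-(b + s)) + q powr (-(b + s)))"
proof -
  have main: "M powr (-a) * m powr (-b) \<le> (\<rho> / 2) powr (-(a - s)) * m powr (-(b + s))"
    if "0 < m" "m \<le> M" "\<rho> / 2 \<le> M" for M m
  proof -
    have "M powr (-a) = M powr (-(a - s)) * M powr (-s)" by (simp add: powr_add[symmetric])
    also have "\<dots> \<le> (\<rho> / 2) powr (-(a - s)) * m powr (-s)"
      using that assms by (intro mult_mono powr_mono2') auto
    finally have "M powr (-a) * m powr (-b) \<le> (\<rho> / 2) powr (-(a - s)) * m powr (-s) * m powr (-b)"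
      by (rule mult_right_mono) simp
    then show ?thesis by (simp add: powr_add[symmetric] mult.assoc add.commute)
  qed
  show ?thesis
  proof (cases "q \<le> p")
    case True
    have "p powr (-a) * q powr (-b) \<le> (\<rho> / 2) powr (-(a - s)) * q powr (-(b + s))"
      using True assms by (intro main) auto
    also have "\<dots> \<le> (\<rho> / 2) powr (-(a - s)) * (p powr (-(b + s)) + q powr (-(b + s)))"
      by (intro mult_left_mono) auto
    finally show ?thesis .
  next
    case False
    \<comment> \<open>If \<open>q\<close> is the larger one, the excess b - a \<ge> 0 of its
      exponent is first moved to \<open>p\<close>; then \<open>main\<close> applies with the roles
      exchanged.\<close>
    have "p powr (-a) * q powr (-b) = p powr (-a) * (q powr (-a) * q powr (-(b - a)))"
      by (simp add: powr_add[symmetric])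
    also have "\<dots> \<le> p powr (-a) * (q powr (-a) * p powr (-(b - a)))"
      using False assms by (intro mult_left_mono powr_mono2') auto
    also have "\<dots> = q powr (-a) * (p powr (-a) * p powr (-(b - a)))" by simp
    also have "p powr (-a) * p powr (-(b - a)) = p powr (-b)" by (simp add: powr_add[symmetric])
    also have "q powr (-a) * p powr (-b) \<le> (\<rho> / 2) powr (-(a - s)) * p powr (-(b + s))"
      using False assms by (intro main) auto
    also have "\<dots> \<le> (\<rho> / 2) powr (-(a - s)) * (p powr (-(b + s)) + q powr (-(b + s)))"
      by (intro mult_left_mono) auto
    finally show ?thesis .
  qed
qed

lemma nn_integral_norm_powr_cball_le:
  fixes x0 :: "'a::euclidean_space" and c P :: real
  assumes "c < real DIM('a)" "0 < P"
  shows "\<exists>K\<ge>0. \<forall>w\<in>cball x0 P. (\<integral>\<^sup>+y. indicator (cball x0 P) y * ennreal (norm (y - w) powr (-c)) \<partial>lborel) \<le> ennreal K"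
proof -
  define K where "K = real DIM('a) * unit_ball_vol DIM('a) * ((2 * P) powr (real DIM('a) - c) / (real DIM('a) - c))"
  have "(\<integral>\<^sup>+y. indicator (cball x0 P) y * ennreal (norm (y - w) powr (-c)) \<partial>lborel) \<le> ennreal K" if w: "w \<in> cball x0 P" for w
  proof -
    have "(\<integral>\<^sup>+y. indicator (cball x0 P) y * ennreal (norm (y - w) powr (-c)) \<partial>lborel) \<le>
      (\<integral>\<^sup>+y. ennreal (norm (y - w) powr (-c)) * indicator (cball 0 (2 * P)) (y - w) \<partial>lborel)"
    proof (intro nn_integral_mono)
      fix y
      have "norm (y - w) \<le> 2 * P" if "y \<in> cball x0 P"
        using that w dist_triangle[of y w x0] by (simp add: dist_norm norm_minus_commute)
      then show "indicator (cball x0 P) y * ennreal (norm (y - w) powr (-c)) \<le> ennreal (norm (y - w) powr (-c)) * indicator (cball 0 (2 * P)) (y - w)"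
        by (auto simp: indicator_def)
    qed
    also have "\<dots> = (\<integral>\<^sup>+y. ennreal (norm (y::'a) powr (-c)) * indicator (cball 0 (2 * P)) y \<partial>lborel)"
      by (rule nn_integral_lborel_shift[of "\<lambda>y. ennreal (norm y powr (-c)) * indicator (cball 0 (2 * P)) y"]) measurable
    also have "\<dots> = ennreal K"
      unfolding K_def using assms by (intro nn_integral_norm_powr_cball) auto
    finally show ?thesis .
  qed
  moreover have "0 \<le> K" unfolding K_def using assms by (intro mult_nonneg_nonneg divide_nonneg_nonneg) auto
  ultimately show ?thesis by blast
qed

text \<open>For g = u q with |q| \<le> Q. The inequality closes the bootstrap: the Riesz potential
  of \<open>g\<close>, which represents \<open>u\<close>, is in turn controlled by that of
  |u|.\<close>

locale weak_pair_bounded = weak_pair +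
  fixes Q :: real
  assumes g_le: "\<And>y. y \<in> D \<Longrightarrow> \<bar>g y\<bar> \<le> Q * \<bar>u y\<bar>"
begin

text \<open>Extended real values allow the iteration to be carried out before any finiteness is
  known.\<close>

definition potential :: "'a \<Rightarrow> real \<Rightarrow> real \<Rightarrow> 'a \<Rightarrow> ennreal" where
  "potential x0 \<rho> a x = (\<integral>\<^sup>+y. indicator (cball x0 \<rho>) y * ennreal (\<bar>u y\<bar> * norm (x - y) powr (-a)) \<partial>lborel)"

lemma u_le_potential:
  assumes \<rho>: "0 < \<rho>" "0 < r" and sub: "cball x0 (\<rho> + r) \<subseteq> D"
  shows "\<exists>C0\<ge>0. \<exists>C1\<ge>0. AE x in lborel. x \<in> cball x0 \<rho> \<longrightarrow> ennreal \<bar>u x\<bar> \<le> ennreal C0 + ennreal C1 * potential x0 (\<rho> + r) (real DIM('a) - \<alpha>) x"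
proof -
  \<comment> \<open>One half of the gap \<open>r\<close> pays for the support radius 1/R of the
    kernel, the other half for passing from the closed ball to a larger open one.\<close>
  define R where "R = 2 / r"
  have R: "0 < R" "1 / R = r / 2" using \<rho> by (auto simp: R_def)
  have sum: "\<rho> + r / 2 + 1 / R = \<rho> + r" using R by simp
  let ?K = "cball x0 (\<rho> + r)" and ?m = "kern_mass TYPE('a) \<alpha>"
  let ?h = "\<lambda>y. indicator ?K y * g y" and ?k = "riesz_kernel \<alpha> (1 / R) :: 'a \<Rightarrow> real"
  have Am: "0 < A * ?m" using A mass_pos by simp
  obtain c where c: "0 \<le> c" "\<And>x. norm x \<le> norm x0 + \<rho> \<Longrightarrow> \<bar>LINT y|lborel. u y * kern \<alpha> R (x - y)\<bar> \<le> c"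
    using u_kern_bound[OF R(1)] by blast
  define C0 where "C0 = A * c / (A * ?m)"
  define C1 where "C1 = \<bar>Q\<bar> / ((real DIM('a) - \<alpha>) * (A * ?m))"
  have C: "0 \<le> C0" "0 \<le> C1" using c(1) A Am dim_gt mass_pos by (auto simp: C0_def C1_def)
  have "AE x in lborel. x \<in> ball x0 (\<rho> + r / 2) \<longrightarrow>
    integrable lborel (\<lambda>y. \<bar>?h y\<bar> * ?k (x - y)) \<and> A * ?m * u x = limit ?K R x"
    using AE_approx_tendsto[OF R(1), of "\<rho> + r / 2" x0] \<rho> sub unfolding sum by simp
  then have "AE x in lborel. x \<in> cball x0 \<rho> \<longrightarrow> ennreal \<bar>u x\<bar> \<le> ennreal C0 + ennreal C1 * potential x0 (\<rho> + r) (real DIM('a) - \<alpha>) x"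
  proof eventually_elim
    case (elim x)
    show ?case
    proof
      assume x: "x \<in> cball x0 \<rho>"
      then have "x \<in> ball x0 (\<rho> + r / 2)" using \<rho> by simp
      with elim have int: "integrable lborel (\<lambda>y. \<bar>?h y\<bar> * ?k (x - y))" and eq: "A * ?m * u x = limit ?K R x"
        by auto
      have nx: "norm x \<le> norm x0 + \<rho>"
        using x norm_triangle_ineq2[of x x0] by (simp add: dist_norm norm_minus_commute)
      have tail: "\<bar>LINT y|lborel. ?h y * riesz_tail \<alpha> R (x - y)\<bar> \<le> (LINT y|lborel. \<bar>?h y\<bar> * ?k (x - y) / (real DIM('a) - \<alpha>))"
      proof -
        have [measurable]: "?h \<in> borel_measurable borel"
          using g_integrable[OF compact_cball sub] by auto
        have AEb: "AE y in lborel. \<bar>?h y * riesz_tail \<alpha> R (x - y)\<bar> \<le> \<bar>?h y\<bar> * ?k (x - y) / (real DIM('a) - \<alpha>)"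
          using AE_lborel_singleton[of x]
        proof eventually_elim
          case (elim y)
          then have "x - y \<noteq> 0" by simp
          from mult_left_mono[OF riesz_tail_le[OF \<alpha> R(1) this] abs_ge_zero[of "?h y"]]
          show ?case by (simp add: abs_mult)
        qed
        have i: "integrable lborel (\<lambda>y. \<bar>?h y\<bar> * ?k (x - y) / (real DIM('a) - \<alpha>))" using int by (rule integrable_divide)
        have "integrable lborel (\<lambda>y. \<bar>?h y * riesz_tail \<alpha> R (x - y)\<bar>)"
        proof (rule Bochner_Integration.integrable_bound[OF i])
          show "AE y in lborel. norm \<bar>?h y * riesz_tail \<alpha> R (x - y)\<bar> \<le> norm (\<bar>?h y\<bar> * ?k (x - y) / (real DIM('a) - \<alpha>))"
            using AEb
          proof eventually_elim
            case (elim y)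
            then show ?case unfolding real_norm_def abs_abs by (rule order_trans[OF _ abs_ge_self])
          qed
        qed measurable
        then show ?thesis
          by (intro order_trans[OF integral_abs_bound integral_mono_AE[OF _ i AEb]])
      qed
      let ?I = "LINT y|lborel. \<bar>?h y\<bar> * ?k (x - y)"
      have I0: "0 \<le> ?I" by (intro Bochner_Integration.integral_nonneg mult_nonneg_nonneg riesz_kernel_nonneg) auto
      have Au: "A * ?m * \<bar>u x\<bar> = \<bar>limit ?K R x\<bar>"
        using eq Am by (metis abs_mult abs_of_pos)
      also have "\<dots> \<le> A * c + ?I / (real DIM('a) - \<alpha>)"
      proof -
        have "\<bar>A * (LINT y|lborel. u y * kern \<alpha> R (x - y))\<bar> \<le> A * c"
          using c(2)[OF nx] A by (simp add: abs_mult)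
        moreover have "(LINT y|lborel. \<bar>?h y\<bar> * ?k (x - y) / (real DIM('a) - \<alpha>)) = ?I / (real DIM('a) - \<alpha>)" by (rule integral_divide_zero)
        ultimately show ?thesis unfolding limit_def using tail by linarith
      qed
      finally have "\<bar>u x\<bar> \<le> (A * c + ?I / (real DIM('a) - \<alpha>)) / (A * ?m)" using Am by (simp add: field_simps)
      also have "\<dots> = C0 + ?I / ((real DIM('a) - \<alpha>) * (A * ?m))" by (simp add: C0_def add_divide_distrib)
      finally have "ennreal \<bar>u x\<bar> \<le> ennreal (C0 + ?I / ((real DIM('a) - \<alpha>) * (A * ?m)))" by (rule ennreal_leI)
      also have "\<dots> = ennreal C0 + ennreal (1 / ((real DIM('a) - \<alpha>) * (A * ?m))) * ennreal ?I"
        using C I0 Am dim_gt by (simp add: ennreal_mult[symmetric] mult.commute)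
      also have "ennreal ?I = (\<integral>\<^sup>+y. ennreal (\<bar>?h y\<bar> * ?k (x - y)) \<partial>lborel)"
        by (rule nn_integral_eq_integral[OF int, symmetric]) (auto intro!: AE_I2 mult_nonneg_nonneg riesz_kernel_nonneg)
      also have "\<dots> \<le> (\<integral>\<^sup>+y. ennreal \<bar>Q\<bar> * (indicator ?K y * ennreal (\<bar>u y\<bar> * norm (x - y) powr (-(real DIM('a) - \<alpha>)))) \<partial>lborel)"
      proof (intro nn_integral_mono)
        fix y
        show "ennreal (\<bar>?h y\<bar> * ?k (x - y)) \<le> ennreal \<bar>Q\<bar> * (indicator ?K y * ennreal (\<bar>u y\<bar> * norm (x - y) powr (-(real DIM('a) - \<alpha>))))"
        proof (cases "y \<in> ?K")
          case True
          then have "y \<in> D" using sub by blast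
          then have "\<bar>g y\<bar> \<le> \<bar>Q\<bar> * \<bar>u y\<bar>"
            using g_le[of y] mult_right_mono[OF abs_ge_self[of Q], of "\<bar>u y\<bar>"] by simp
          moreover have "?k (x - y) \<le> norm (x - y) powr (-(real DIM('a) - \<alpha>))"
            by (simp add: riesz_kernel_def indicator_def)
          ultimately have "\<bar>g y\<bar> * ?k (x - y) \<le> (\<bar>Q\<bar> * \<bar>u y\<bar>) * norm (x - y) powr (-(real DIM('a) - \<alpha>))"
            by (intro mult_mono) (auto intro: riesz_kernel_nonneg)
          then have "ennreal (\<bar>g y\<bar> * ?k (x - y)) \<le> ennreal (\<bar>Q\<bar> * (\<bar>u y\<bar> * norm (x - y) powr (-(real DIM('a) - \<alpha>))))"
            by (intro ennreal_leI) (simp add: mult.assoc)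
          also have "\<dots> = ennreal \<bar>Q\<bar> * ennreal (\<bar>u y\<bar> * norm (x - y) powr (-(real DIM('a) - \<alpha>)))"
            by (intro ennreal_mult) auto
          finally show ?thesis using True by simp
        qed simp
      qed
      also have "\<dots> = ennreal \<bar>Q\<bar> * potential x0 (\<rho> + r) (real DIM('a) - \<alpha>) x"
        unfolding potential_def by (rule nn_integral_cmult) measurable
      finally have "ennreal \<bar>u x\<bar> \<le> ennreal C0 + ennreal (1 / ((real DIM('a) - \<alpha>) * (A * ?m))) * (ennreal \<bar>Q\<bar> * potential x0 (\<rho> + r) (real DIM('a) - \<alpha>) x)"
        by (simp add: add_left_mono mult_left_mono)
      also have "ennreal (1 / ((real DIM('a) - \<alpha>) * (A * ?m))) * (ennreal \<bar>Q\<bar> * potential x0 (\<rho> + r) (real DIM('a) - \<alpha>) x) = ennreal C1 * potential x0 (\<rho> + r) (real DIM('a) - \<alpha>) x"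
      proof -
        have "0 < (real DIM('a) - \<alpha>) * (A * ?m)" using A mass_pos dim_gt by (intro mult_pos_pos) auto
        then have "ennreal (1 / ((real DIM('a) - \<alpha>) * (A * ?m))) * ennreal \<bar>Q\<bar> = ennreal C1"
          unfolding C1_def by (subst ennreal_mult[symmetric]) auto
        then show ?thesis by (simp only: mult.assoc[symmetric])
      qed
      finally show "ennreal \<bar>u x\<bar> \<le> ennreal C0 + ennreal C1 * potential x0 (\<rho> + r) (real DIM('a) - \<alpha>) x" .
    qed
  qed
  with C show ?thesis by blast
qed

text \<open>Inserting \<open>u_le_potential\<close> for |u| composes |x - y|^(-a) with |y -
  z|^(-(d-\<alpha>)), and the composition is bounded by a multiple of |x - z|^(-(a-s)) as long as s
  < \<alpha>. So boundedness climbs from exponent a - s to a, at the cost of a smaller domain of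
  integration; the points \<open>x\<close> range over a fixed ball throughout.\<close>

lemma potential_step:
  assumes \<rho>: "0 < \<rho>" "0 < r" "\<rho> + r \<le> P" and sub: "cball x0 P \<subseteq> D"
    and s: "0 \<le> s" "s \<le> a" "a \<le> (real DIM('a) - \<alpha>)" "s < \<alpha>"
    and IH: "\<exists>C\<ge>0. \<forall>x\<in>cball x0 P. potential x0 (\<rho> + r) (a - s) x \<le> ennreal C"
  shows "\<exists>C\<ge>0. \<forall>x\<in>cball x0 P. potential x0 \<rho> a x \<le> ennreal C"
proof -
  have P: "0 < P" using \<rho> by simp
  have sub': "cball x0 (\<rho> + r) \<subseteq> cball x0 P" "cball x0 \<rho> \<subseteq> cball x0 P" using \<rho> by (auto intro: subset_cball)
  obtain C where C: "0 \<le> C" "\<And>x. x \<in> cball x0 P \<Longrightarrow> potential x0 (\<rho> + r) (a - s) x \<le> ennreal C"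
    using IH by blast
  obtain C0 C1 where C01: "0 \<le> C0" "0 \<le> C1"
    and AE: "AE x in lborel. x \<in> cball x0 \<rho> \<longrightarrow> ennreal \<bar>u x\<bar> \<le> ennreal C0 + ennreal C1 * potential x0 (\<rho> + r) (real DIM('a) - \<alpha>) x"
    using u_le_potential[OF \<rho>(1,2)] sub sub' by blast
  \<comment> \<open>Both leftover singularities are integrable; the second one because s <
    \<alpha>.\<close>
  have ab: "a < real DIM('a)" "(real DIM('a) - \<alpha>) + s < real DIM('a)" using s \<alpha> by auto
  obtain Ka where Ka: "0 \<le> Ka" "\<And>w. w \<in> cball x0 P \<Longrightarrow>
      (\<integral>\<^sup>+y. indicator (cball x0 P) y * ennreal (norm (y - w) powr (-a)) \<partial>lborel) \<le> ennreal Ka"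
    using nn_integral_norm_powr_cball_le[OF ab(1) P, of x0] by blast
  obtain K where K: "0 \<le> K" "\<And>w. w \<in> cball x0 P \<Longrightarrow>
      (\<integral>\<^sup>+y. indicator (cball x0 P) y * ennreal (norm (y - w) powr (-((real DIM('a) - \<alpha>) + s))) \<partial>lborel) \<le> ennreal K"
    using nn_integral_norm_powr_cball_le[OF ab(2) P, of x0] by blast
  have [measurable]: "(\<lambda>y. potential x0 (\<rho> + r) (real DIM('a) - \<alpha>) y) \<in> borel_measurable borel"
    unfolding potential_def by measurable
  define T where "T = 2 powr (a - s)"
  have T: "0 < T" by (simp add: T_def)
  have "potential x0 \<rho> a x \<le> ennreal (C0 * Ka + C1 * (T * (2 * K) * C))" if x: "x \<in> cball x0 P" for x
  proof -
    let ?X = "\<lambda>y. indicator (cball x0 \<rho>) y :: ennreal" and ?Z = "\<lambda>z. indicator (cball x0 (\<rho> + r)) z :: ennreal"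
    let ?na = "\<lambda>y. ennreal (norm (x - y) powr (-a))"
    have inner: "(\<integral>\<^sup>+y. ?X y * ?na y * ennreal (norm (y - z) powr (-(real DIM('a) - \<alpha>))) \<partial>lborel) \<le> ennreal (T * (2 * K) * norm (x - z) powr (-(a - s)))"
      if z: "z \<in> cball x0 P" "z \<noteq> x" for z
    proof -
      let ?c = "T * norm (x - z) powr (-(a - s))"
      let ?Y = "\<lambda>y. indicator (cball x0 P) y :: ennreal"
      let ?e = "\<lambda>w y. ennreal (norm (y - w) powr (-((real DIM('a) - \<alpha>) + s)))"
      have "(\<integral>\<^sup>+y. ?X y * ?na y * ennreal (norm (y - z) powr (-(real DIM('a) - \<alpha>))) \<partial>lborel) \<le> (\<integral>\<^sup>+y. ennreal ?c * (?Y y * ?e x y + ?Y y * ?e z y) \<partial>lborel)"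
        using AE_lborel_singleton[of x] AE_lborel_singleton[of z]
      proof (intro nn_integral_mono_AE, eventually_elim)
        case (elim y)
        show ?case
        proof (cases "y \<in> cball x0 \<rho>")
          case True
          have "norm (x - y) powr (-a) * norm (y - z) powr (-(real DIM('a) - \<alpha>)) \<le> (norm (x - z) / 2) powr (-(a - s)) * (norm (x - y) powr (-((real DIM('a) - \<alpha>) + s)) + norm (y - z) powr (-((real DIM('a) - \<alpha>) + s)))"
            using elim z s norm_triangle_ineq[of "x - y" "y - z"] by (intro riesz_composition_le) auto
          also have "(norm (x - z) / 2) powr (-(a - s)) = ?c"
            unfolding T_def by (simp only: powr_divide powr_minus) (simp add: field_simps)
          finally have le: "norm (x - y) powr (-a) * norm (y - z) powr (-(real DIM('a) - \<alpha>)) \<le> ?c * (norm (y - x) powr (-((real DIM('a) - \<alpha>) + s)) + norm (y - z) powr (-((real DIM('a) - \<alpha>) + s)))"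
            by (simp add: norm_minus_commute)
          have "?X y * ?na y * ennreal (norm (y - z) powr (-(real DIM('a) - \<alpha>))) = ennreal (norm (x - y) powr (-a) * norm (y - z) powr (-(real DIM('a) - \<alpha>)))"
            using True by (simp add: ennreal_mult)
          also have "\<dots> \<le> ennreal (?c * (norm (y - x) powr (-((real DIM('a) - \<alpha>) + s)) + norm (y - z) powr (-((real DIM('a) - \<alpha>) + s))))"
            using le by (rule ennreal_leI)
          also have "\<dots> = ennreal ?c * (?e x y + ?e z y)"
            using T by (subst ennreal_mult) (auto intro: ennreal_plus)
          also have "\<dots> = ennreal ?c * (?Y y * ?e x y + ?Y y * ?e z y)"
            using True sub' by auto
          finally show ?thesis .
        qed simp
      qed
      also have "\<dots> = ennreal ?c * ((\<integral>\<^sup>+y. ?Y y * ?e x y \<partial>lborel) + (\<integral>\<^sup>+y. ?Y y * ?e z y \<partial>lborel))"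
        by (simp add: nn_integral_cmult nn_integral_add)
      also have "\<dots> \<le> ennreal ?c * (ennreal K + ennreal K)"
        using K(2)[OF x] K(2)[OF z(1)] by (intro mult_left_mono add_mono) auto
      also have "\<dots> = ennreal (T * (2 * K) * norm (x - z) powr (-(a - s)))"
        using K(1) T by (simp add: ennreal_plus[symmetric] ennreal_mult[symmetric] mult_ac del: ennreal_plus)
      finally show ?thesis .
    qed
    have "potential x0 \<rho> a x = (\<integral>\<^sup>+y. ?X y * ?na y * ennreal \<bar>u y\<bar> \<partial>lborel)"
      unfolding potential_def by (intro nn_integral_cong) (simp add: ennreal_mult mult_ac)
    also have "\<dots> \<le> (\<integral>\<^sup>+y. ennreal C0 * (?X y * ?na y) + ennreal C1 * (?X y * ?na y * potential x0 (\<rho> + r) (real DIM('a) - \<alpha>) y) \<partial>lborel)"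
      using AE
    proof (intro nn_integral_mono_AE, eventually_elim)
      case (elim y)
      show ?case
      proof (cases "y \<in> cball x0 \<rho>")
        case True
        with elim have "?na y * ennreal \<bar>u y\<bar> \<le> ?na y * (ennreal C0 + ennreal C1 * potential x0 (\<rho> + r) (real DIM('a) - \<alpha>) y)"
          by (intro mult_left_mono) auto
        then show ?thesis using True by (simp add: distrib_left mult_ac)
      qed simp
    qed
    also have "\<dots> = ennreal C0 * (\<integral>\<^sup>+y. ?X y * ?na y \<partial>lborel) + ennreal C1 * (\<integral>\<^sup>+y. ?X y * ?na y * potential x0 (\<rho> + r) (real DIM('a) - \<alpha>) y \<partial>lborel)"
      by (simp add: nn_integral_cmult nn_integral_add)
    also have "(\<integral>\<^sup>+y. ?X y * ?na y \<partial>lborel) \<le> (\<integral>\<^sup>+y. indicator (cball x0 P) y * ennreal (norm (y - x) powr (-a)) \<partial>lborel)"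
      using sub' by (intro nn_integral_mono) (auto simp: indicator_def norm_minus_commute)
    also have "\<dots> \<le> ennreal Ka" by (rule Ka(2)[OF x])
    also have "(\<integral>\<^sup>+y. ?X y * ?na y * potential x0 (\<rho> + r) (real DIM('a) - \<alpha>) y \<partial>lborel) =
      (\<integral>\<^sup>+y. \<integral>\<^sup>+z. ?Z z * ennreal \<bar>u z\<bar> * (?X y * ?na y * ennreal (norm (y - z) powr (-(real DIM('a) - \<alpha>)))) \<partial>lborel \<partial>lborel)"
      unfolding potential_def
      by (intro nn_integral_cong, subst nn_integral_cmult[symmetric]) (auto intro!: nn_integral_cong simp: ennreal_mult mult_ac)
    also have "\<dots> = (\<integral>\<^sup>+z. \<integral>\<^sup>+y. ?Z z * ennreal \<bar>u z\<bar> * (?X y * ?na y * ennreal (norm (y - z) powr (-(real DIM('a) - \<alpha>)))) \<partial>lborel \<partial>lborel)"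
      by (rule lborel_pair.Fubini') measurable
    also have "\<dots> = (\<integral>\<^sup>+z. ?Z z * ennreal \<bar>u z\<bar> * (\<integral>\<^sup>+y. ?X y * ?na y * ennreal (norm (y - z) powr (-(real DIM('a) - \<alpha>))) \<partial>lborel) \<partial>lborel)"
      by (intro nn_integral_cong nn_integral_cmult) measurable
    also have "\<dots> \<le> (\<integral>\<^sup>+z. ennreal (T * (2 * K)) * (?Z z * ennreal (\<bar>u z\<bar> * norm (x - z) powr (-(a - s)))) \<partial>lborel)"
      using AE_lborel_singleton[of x]
    proof (intro nn_integral_mono_AE, eventually_elim)
      case (elim z)
      show ?case
      proof (cases "z \<in> cball x0 (\<rho> + r)")
        case True
        then have "ennreal \<bar>u z\<bar> * (\<integral>\<^sup>+y. ?X y * ?na y * ennreal (norm (y - z) powr (-(real DIM('a) - \<alpha>))) \<partial>lborel) \<le> ennreal \<bar>u z\<bar> * ennreal (T * (2 * K) * norm (x - z) powr (-(a - s)))"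
          using elim sub' by (intro mult_left_mono inner) auto
        also have "\<dots> = ennreal (T * (2 * K)) * ennreal (\<bar>u z\<bar> * norm (x - z) powr (-(a - s)))"
          using T K(1) by (simp add: ennreal_mult[symmetric] mult_ac)
        finally show ?thesis using True by simp
      qed simp
    qed
    also have "\<dots> = ennreal (T * (2 * K)) * potential x0 (\<rho> + r) (a - s) x"
      unfolding potential_def by (rule nn_integral_cmult) measurable
    also have "\<dots> \<le> ennreal (T * (2 * K)) * ennreal C" by (intro mult_left_mono C x) auto
    finally have "potential x0 \<rho> a x \<le> ennreal C0 * ennreal Ka + ennreal C1 * (ennreal (T * (2 * K)) * ennreal C)"
      by (simp add: add_mono mult_left_mono)
    also have "\<dots> = ennreal (C0 * Ka + C1 * (T * (2 * K) * C))"
      using C01 Ka(1) K(1) T C(1) by (simp add: ennreal_mult[symmetric] ennreal_plus[symmetric] del: ennreal_plus)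
    finally show ?thesis .
  qed
  moreover have "0 \<le> C0 * Ka + C1 * (T * (2 * K) * C)"
    using C01 Ka(1) K(1) T C(1) by (intro add_nonneg_nonneg mult_nonneg_nonneg) auto
  ultimately show ?thesis by blast
qed

text \<open>The potential of exponent 0 is at most the integral of |u| over a ball, finite from the
  outset. \<open>potential_step\<close> raises the exponent to d - \<alpha>, and a bounded potential
  of that exponent bounds \<open>u\<close>.\<close>

lemma u_locally_bounded:
  assumes x0: "x0 \<in> D"
  shows "\<exists>r>0. \<exists>M. cball x0 r \<subseteq> D \<and> (AE x in lborel. x \<in> cball x0 r \<longrightarrow> \<bar>u x\<bar> \<le> M)"
proof -
  obtain P where P: "0 < P" "cball x0 P \<subseteq> D"
    using open_D x0 by (auto simp: open_contains_cball)
  have b0: "0 < (real DIM('a) - \<alpha>)" using dim_gt by simp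
  \<comment> \<open>The exponent climbs from 0 to d - \<alpha> in \<open>N\<close> equal steps; this
    choice keeps each step below \<alpha>.\<close>
  obtain N :: nat where N: "(real DIM('a) - \<alpha>) / \<alpha> < real N" using reals_Archimedean2 by blast
  have N0: "0 < real N" using N b0 \<alpha> by (smt (verit) divide_pos_pos)
  define s where "s = (real DIM('a) - \<alpha>) / real N"
  have s: "0 \<le> s" "s < \<alpha>" "real N * s = (real DIM('a) - \<alpha>)"
    using N N0 b0 \<alpha> by (auto simp: s_def field_simps)
  \<comment> \<open>Each of the \<open>N\<close> steps costs \<open>r\<close> of the radius. A ball
    of radius 2 r remains, of which the final use of \<open>u_le_potential\<close> spends another
    \<open>r\<close>.\<close>
  define r where "r = P / (real N + 2)"
  have r: "0 < r" "real N * r + 2 * r = P" using P N0 unfolding distrib_right[symmetric] by (auto simp: r_def)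
  have "\<exists>C\<ge>0. \<forall>x\<in>cball x0 P. potential x0 (P - real j * r) (real j * s) x \<le> ennreal C" if "j \<le> N" for j
    using that
  proof (induction j)
    case 0
    let ?I = "LINT y|lborel. \<bar>indicator (cball x0 P) y * u y\<bar>"
    have "potential x0 P 0 x \<le> ennreal ?I" for x
    proof -
      have "potential x0 P 0 x \<le> (\<integral>\<^sup>+y. ennreal \<bar>indicator (cball x0 P) y * u y\<bar> \<partial>lborel)"
        unfolding potential_def by (intro nn_integral_mono) (auto simp: indicator_def)
      also have "\<dots> = ennreal ?I"
        by (intro nn_integral_eq_integral integrable_abs integrable_u_cball) auto
      finally show ?thesis .
    qed
    then show ?case by (intro exI[of _ ?I]) auto
  next
    case (Suc j)
    have Nr: "real (Suc j) * r \<le> real N * r" "real (Suc j) * s \<le> real N * s"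
    proof -
      have "real (Suc j) \<le> real N" using Suc.prems by simp
      then show "real (Suc j) * r \<le> real N * r" "real (Suc j) * s \<le> real N * s"
        using r(1) s(1) by (auto intro: mult_right_mono)
    qed
    show ?case
    proof (rule potential_step[where r=r and s=s])
      show "\<exists>C\<ge>0. \<forall>x\<in>cball x0 P. potential x0 (P - real (Suc j) * r + r) (real (Suc j) * s - s) x \<le> ennreal C"
        using Suc by (simp add: algebra_simps)
      show "0 < P - real (Suc j) * r" using Nr r by linarith
      show "P - real (Suc j) * r + r \<le> P" using r by (simp add: algebra_simps)
      show "s \<le> real (Suc j) * s" using s by (simp add: algebra_simps)
      show "real (Suc j) * s \<le> (real DIM('a) - \<alpha>)" using Nr s by linarith
    qed (use r s P in auto)
  qed
  from this[of N] obtain C where C: "0 \<le> C" "\<And>x. x \<in> cball x0 P \<Longrightarrow> potential x0 (2 * r) (real DIM('a) - \<alpha>) x \<le> ennreal C"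
    using r s by (metis add_diff_cancel_left' order_refl)
  have rP: "r + r \<le> P" using r N0 by (smt (verit) mult_nonneg_nonneg)
  have sub: "cball x0 (r + r) \<subseteq> D" "cball x0 r \<subseteq> D" "cball x0 r \<subseteq> cball x0 P"
    using P(2) rP r(1) subset_cball[of "r + r" P x0] subset_cball[of r P x0] by auto
  obtain C0 C1 where C01: "0 \<le> C0" "0 \<le> C1"
    and AE: "AE x in lborel. x \<in> cball x0 r \<longrightarrow> ennreal \<bar>u x\<bar> \<le> ennreal C0 + ennreal C1 * potential x0 (r + r) (real DIM('a) - \<alpha>) x"
    using u_le_potential[OF r(1) r(1) sub(1)] by blast
  have "AE x in lborel. x \<in> cball x0 r \<longrightarrow> \<bar>u x\<bar> \<le> C0 + C1 * C"
    using AE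
  proof eventually_elim
    case (elim x)
    show ?case
    proof
      assume x: "x \<in> cball x0 r"
      with elim have "ennreal \<bar>u x\<bar> \<le> ennreal C0 + ennreal C1 * potential x0 (2 * r) (real DIM('a) - \<alpha>) x" by simp
      also have "\<dots> \<le> ennreal C0 + ennreal C1 * ennreal C"
        using x sub(3) by (intro add_left_mono mult_left_mono C) auto
      also have "\<dots> = ennreal (C0 + C1 * C)"
        using C01 C(1) by (simp add: ennreal_mult[symmetric] ennreal_plus[symmetric] del: ennreal_plus)
      finally show "\<bar>u x\<bar> \<le> C0 + C1 * C"
        using C01 C(1) by (subst (asm) ennreal_le_iff) auto
    qed
  qed
  with r(1) sub(2) show ?thesis by blast
qed

end

subsection \<open>The scaled jump integral of the bump\<close>

lemma integrable_bump: "integrable lborel (bump :: 'a::euclidean_space \<Rightarrow> real)"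
proof (rule Bochner_Integration.integrable_bound)
  show "integrable lborel (indicator (cball (0::'a) 1) :: 'a \<Rightarrow> real)"
    using emeasure_lborel_cball_finite[of "0::'a" 1] by (simp add: less_top)
  have "\<bar>bump x\<bar> \<le> indicator (cball 0 1) x" for x :: 'a
    using bump_nonneg[of x] bump_le_1[of x] bump_eq_0[of x] by (auto simp: indicator_def)
  then show "AE x in lborel. norm (bump x) \<le> norm (indicator (cball (0::'a) 1) x :: real)"
    by (auto intro!: AE_I2 intro: order_trans[OF _ abs_ge_self])
qed simp

definition bump_mass :: "'a::euclidean_space itself \<Rightarrow> real" where
  "bump_mass _ = (LINT x|lborel. bump (x::'a))"

lemma bump_mass_pos: "0 < bump_mass TYPE('a::euclidean_space)"
proof -
  have "(LINT x|lborel. bump (x::'a)) \<noteq> 0"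
  proof
    assume "(LINT x|lborel. bump (x::'a)) = 0"
    then have "AE x in lborel. bump (x::'a) = 0"
      using integral_nonneg_eq_0_iff_AE[OF integrable_bump] bump_nonneg by auto
    then have "AE x in lebesgue. x \<in> {x::'a. bump x = 0}" by (simp add: AE_completion)
    moreover have "closed {x::'a. bump x = 0}"
      by (intro closed_Collect_eq continuous_intros)
    ultimately have "0 \<in> {x::'a. bump x = 0}" by (intro mem_closed_if_AE_lebesgue)
    with bump_pos[of "0::'a"] show False by simp
  qed
  moreover have "0 \<le> (LINT x|lborel. bump (x::'a))"
    by (intro Bochner_Integration.integral_nonneg bump_nonneg)
  ultimately show ?thesis by (simp add: bump_mass_def)
qed

lemma integral_scaled_bump:
  fixes x :: "'a::euclidean_space"
  assumes "0 < s"
  shows "(LINT y|lborel. bump (s *\<^sub>R (x - y))) = bump_mass TYPE('a) / s ^ DIM('a)"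
    and "integrable lborel (\<lambda>y. bump (s *\<^sub>R (x - y)))"
proof -
  have s0: "s \<noteq> 0" using assms by simp
  have "(LINT y|lborel. bump (s *\<^sub>R (x - y))) = (LINT y|lborel. bump (s *\<^sub>R (y::'a)))"
    by (rule integral_lborel_minus[of "\<lambda>y. bump (s *\<^sub>R y)"])
  moreover have "bump_mass TYPE('a) = s ^ DIM('a) * (LINT y|lborel. bump (s *\<^sub>R (y::'a)))"
    using integral_affine_euclidean[OF s0, of bump "0::'a"] assms by (simp add: bump_mass_def)
  ultimately show "(LINT y|lborel. bump (s *\<^sub>R (x - y))) = bump_mass TYPE('a) / s ^ DIM('a)"
    using assms by simp
  have "integrable lborel (\<lambda>y::'a. bump (s *\<^sub>R y))"
    using integrable_affine_euclidean[OF integrable_bump s0, of 0] by simp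
  then show "integrable lborel (\<lambda>y. bump (s *\<^sub>R (x - y)))"
    using integrable_lborel_minus_iff[of "\<lambda>y. bump (s *\<^sub>R y)" x] by simp
qed

text \<open>Seen from \<open>z \<noteq> 0\<close>, the rescaled bump concentrates at the origin: it
  no longer covers \<open>z\<close> itself, and its jump integral at \<open>z\<close> becomes the
  integral of \<theta>(y) |y/S - z|^(-d-\<alpha>), where y/S tends to 0.\<close>

lemma scaled_bump_jump_tendsto:
  fixes z :: "'a::euclidean_space"
  assumes \<alpha>: "0 < \<alpha>" "\<alpha> < 1" and z: "z \<noteq> 0"
  shows "(\<lambda>n. real (Suc n) powr (real DIM('a) + \<alpha>) * bump_jump \<alpha> (real (Suc n) *\<^sub>R z)) \<longlonglongrightarrow>
    bump_mass TYPE('a) / norm z powr (real DIM('a) + \<alpha>)"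
proof -
  let ?p = "real DIM('a) + \<alpha>"
  \<comment> \<open>The factor 2 ensures |y/S| \<le> |z|/2 on the support of the bump, which keeps
    the denominators away from 0 for all remaining indices.\<close>
  obtain N :: nat where N: "2 / norm z \<le> real N" using real_arch_simple by blast
  let ?S = "\<lambda>n. real (Suc (n + N))"
  have S: "2 \<le> ?S n * norm z" "0 < ?S n" for n
  proof -
    have "2 / norm z \<le> ?S n" using N by simp
    then show "2 \<le> ?S n * norm z" using z by (simp only: divide_le_eq) simp
  qed simp
  have eq: "?S n powr ?p * bump_jump \<alpha> (?S n *\<^sub>R z) = (LINT y|lborel. bump y / norm ((1 / ?S n) *\<^sub>R y - z) powr ?p)" for n
  proof -
    have "norm (?S n *\<^sub>R z) = ?S n * norm z" unfolding norm_scaleR abs_of_nat ..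
    then have "1 \<le> norm (?S n *\<^sub>R z)" using S(1)[of n] by linarith
    then have "bump (?S n *\<^sub>R z) = 0" by (rule bump_eq_0)
    then have "?S n powr ?p * bump_kern \<alpha> (?S n *\<^sub>R z) y = bump y / norm ((1 / ?S n) *\<^sub>R y - z) powr ?p" for y
    proof -
      have "norm (y - ?S n *\<^sub>R z) = ?S n * norm ((1 / ?S n) *\<^sub>R y - z)"
      proof -
        have "y - ?S n *\<^sub>R z = ?S n *\<^sub>R ((1 / ?S n) *\<^sub>R y - z)" using S(2)[of n] by (simp only: scaleR_right_diff_distrib scaleR_scaleR) simp
        then show ?thesis using S(2)[of n] by (simp only: norm_scaleR)
      qed
      then have "norm (y - ?S n *\<^sub>R z) powr ?p = ?S n powr ?p * norm ((1 / ?S n) *\<^sub>R y - z) powr ?p"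
        by (simp only: powr_mult)
      then show ?thesis
        using \<open>bump (?S n *\<^sub>R z) = 0\<close> S(2)[of n] by (simp only: bump_kern_def) simp
    qed
    then show ?thesis
      unfolding bump_jump_eq by (subst integral_mult_right_zero[symmetric]) (simp only:)
  qed
  have "(\<lambda>n. LINT y|lborel. bump y / norm ((1 / ?S n) *\<^sub>R y - z) powr ?p) \<longlonglongrightarrow> (LINT y|lborel. bump (y::'a) / norm z powr ?p)"
  proof (rule integral_dominated_convergence)
    show "integrable lborel (\<lambda>y::'a. bump y * (norm z / 2) powr (- ?p))" by (intro integrable_mult_left integrable_bump)
    show "AE y in lborel. (\<lambda>n. bump y / norm ((1 / ?S n) *\<^sub>R y - z) powr ?p) \<longlonglongrightarrow> bump y / norm z powr ?p"
    proof (intro AE_I2)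
      fix y :: 'a
      have "(\<lambda>n. 1 / real (Suc n)) \<longlonglongrightarrow> 0" by (intro LIMSEQ_Suc lim_1_over_n)
      then have "(\<lambda>n. 1 / ?S n) \<longlonglongrightarrow> 0" using LIMSEQ_ignore_initial_segment[of "\<lambda>n. 1 / real (Suc n)" 0 N] by simp
      then have "(\<lambda>n. norm ((1 / ?S n) *\<^sub>R y - z)) \<longlonglongrightarrow> norm (0 *\<^sub>R y - z)" by (intro tendsto_intros)
      then have "(\<lambda>n. norm ((1 / ?S n) *\<^sub>R y - z)) \<longlonglongrightarrow> norm z" by simp
      then have "(\<lambda>n. norm ((1 / ?S n) *\<^sub>R y - z) powr ?p) \<longlonglongrightarrow> norm z powr ?p"
        by (rule tendsto_powr) (use z in auto)
      then show "(\<lambda>n. bump y / norm ((1 / ?S n) *\<^sub>R y - z) powr ?p) \<longlonglongrightarrow> bump y / norm z powr ?p"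
        by (rule tendsto_divide[OF tendsto_const]) (use z in auto)
    qed
    show "AE y in lborel. norm (bump y / norm ((1 / ?S n) *\<^sub>R y - z) powr ?p) \<le> bump (y::'a) * (norm z / 2) powr (- ?p)" for n
    proof (intro AE_I2)
      fix y :: 'a
      show "norm (bump y / norm ((1 / ?S n) *\<^sub>R y - z) powr ?p) \<le> bump y * (norm z / 2) powr (- ?p)"
      proof (cases "norm y \<le> 1")
        case True
        have "norm ((1 / ?S n) *\<^sub>R y) = norm y / ?S n" using S(2)[of n] by (simp only: norm_scaleR) simp
        also have "\<dots> \<le> 1 / ?S n" using True S(2)[of n] by (intro divide_right_mono) auto
        also have "\<dots> \<le> norm z / 2" using S[of n] by (simp only: divide_le_eq) (simp add: mult.commute)
        finally have "norm z / 2 \<le> norm ((1 / ?S n) *\<^sub>R y - z)"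
          using norm_triangle_ineq2[of z "(1 / ?S n) *\<^sub>R y"] norm_minus_commute[of z "(1 / ?S n) *\<^sub>R y"] by linarith
        then have "norm ((1 / ?S n) *\<^sub>R y - z) powr (- ?p) \<le> (norm z / 2) powr (- ?p)"
          using z \<alpha> by (intro powr_mono2') auto
        then have "bump y * norm ((1 / ?S n) *\<^sub>R y - z) powr (- ?p) \<le> bump y * (norm z / 2) powr (- ?p)"
          by (intro mult_left_mono bump_nonneg)
        then show ?thesis
          unfolding powr_minus_divide real_norm_def by (simp only: abs_divide abs_of_nonneg[OF bump_nonneg] abs_of_nonneg[OF powr_ge_zero]) simp
      next
        case False
        then show ?thesis by (simp add: bump_eq_0)
      qed
    qed
  qed measurable
  also have "(LINT y|lborel. bump (y::'a) / norm z powr ?p) = bump_mass TYPE('a) / norm z powr ?p"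
    unfolding bump_mass_def by (rule integral_divide_zero)
  finally have "(\<lambda>n. ?S n powr ?p * bump_jump \<alpha> (?S n *\<^sub>R z)) \<longlonglongrightarrow> bump_mass TYPE('a) / norm z powr ?p"
    by (simp only: eq)
  then show ?thesis
    by (rule LIMSEQ_offset[where k=N])
qed

subsection \<open>Hoelder estimates\<close>

context weak_pair
begin

text \<open>The increments of the kernel keep its decay and are thus integrable against
  \<open>u\<close>. The restriction on |x - x'| is the one in \<open>kern_1_Lipschitz_decay\<close>
  after scaling.\<close>

lemma u_kern_Lipschitz:
  assumes R: "0 < R"
  shows "\<exists>C\<ge>0. \<forall>x x'. norm x \<le> \<rho> \<longrightarrow> R * norm (x - x') \<le> 1 \<longrightarrow>
    \<bar>(LINT y|lborel. u y * kern \<alpha> R (x - y)) - (LINT y|lborel. u y * kern \<alpha> R (x' - y))\<bar> \<le> C * norm (x - x')"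
proof -
  let ?p = "real DIM('a) + \<alpha>"
  obtain L where L: "0 < L" "\<And>x y::'a. norm (x - y) \<le> 1 \<Longrightarrow> \<bar>kern \<alpha> 1 x - kern \<alpha> 1 y\<bar> \<le> L * norm (x - y) * decay \<alpha> x"
    using kern_1_Lipschitz_decay[OF \<alpha>] by blast
  define c' where "c' = min R 1"
  have c': "0 < c'" "c' \<le> R" "c' \<le> 1" using R by (auto simp: c'_def)
  define M where "M = R ^ DIM('a) * (L * R) * (c' powr (- ?p) * (1 + \<bar>\<rho>\<bar>) powr ?p)"
  have M: "0 \<le> M" using L R by (simp add: M_def)
  let ?I = "LINT y|lborel. \<bar>u y\<bar> * decay \<alpha> y"
  have "\<bar>(LINT y|lborel. u y * kern \<alpha> R (x - y)) - (LINT y|lborel. u y * kern \<alpha> R (x' - y))\<bar> \<le> M * ?I * norm (x - x')"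
    if x: "norm x \<le> \<rho>" and h: "R * norm (x - x') \<le> 1" for x x'
  proof -
    have le: "\<bar>kern \<alpha> R (x - y) - kern \<alpha> R (x' - y)\<bar> \<le> M * norm (x - x') * decay \<alpha> y" for y
    proof -
      have n: "norm (R *\<^sub>R (x - y) - R *\<^sub>R (x' - y)) = R * norm (x - x')"
      proof -
        have "R *\<^sub>R (x - y) - R *\<^sub>R (x' - y) = R *\<^sub>R (x - x')" by (simp add: algebra_simps)
        then show ?thesis using R by (simp only: norm_scaleR)
      qed
      have "\<bar>kern \<alpha> R (x - y) - kern \<alpha> R (x' - y)\<bar> = R ^ DIM('a) * \<bar>kern \<alpha> 1 (R *\<^sub>R (x - y)) - kern \<alpha> 1 (R *\<^sub>R (x' - y))\<bar>"
        unfolding kern_eq_scaled[OF \<alpha> R, of "x - y"] kern_eq_scaled[OF \<alpha> R, of "x' - y"] right_diff_distrib[symmetric]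
        using R by (simp only: abs_mult) simp
      also have "\<dots> \<le> R ^ DIM('a) * (L * (R * norm (x - x')) * decay \<alpha> (R *\<^sub>R (x - y)))"
        using L(2)[of "R *\<^sub>R (x - y)" "R *\<^sub>R (x' - y)"] h R unfolding n by (intro mult_left_mono) auto
      also have "\<dots> \<le> R ^ DIM('a) * (L * (R * norm (x - x')) * (c' powr (- ?p) * ((1 + norm x) powr ?p * decay \<alpha> y)))"
        using c' L(1) R by (intro mult_left_mono scaled_decay_le) auto
      also have "\<dots> \<le> R ^ DIM('a) * (L * (R * norm (x - x')) * (c' powr (- ?p) * ((1 + \<bar>\<rho>\<bar>) powr ?p * decay \<alpha> y)))"
        using c' L(1) R x \<alpha> decay_pos[of \<alpha> y] by (intro mult_left_mono mult_right_mono powr_mono2) auto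
      finally show ?thesis by (simp add: M_def mult_ac)
    qed
    have "(LINT y|lborel. u y * kern \<alpha> R (x - y)) - (LINT y|lborel. u y * kern \<alpha> R (x' - y)) =
      (LINT y|lborel. u y * kern \<alpha> R (x - y) - u y * kern \<alpha> R (x' - y))"
      using R by (intro Bochner_Integration.integral_diff[symmetric] integrable_u_kern)
    also have "\<bar>\<dots>\<bar> \<le> (LINT y|lborel. \<bar>u y * kern \<alpha> R (x - y) - u y * kern \<alpha> R (x' - y)\<bar>)"
      by (rule integral_abs_bound)
    also have "\<dots> \<le> (LINT y|lborel. (M * norm (x - x')) * (\<bar>u y\<bar> * decay \<alpha> y))"
    proof (rule integral_mono)
      show "integrable lborel (\<lambda>y. \<bar>u y * kern \<alpha> R (x - y) - u y * kern \<alpha> R (x' - y)\<bar>)"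
        using R by (intro integrable_abs Bochner_Integration.integrable_diff integrable_u_kern)
      show "integrable lborel (\<lambda>y. (M * norm (x - x')) * (\<bar>u y\<bar> * decay \<alpha> y))"
        using u_integrable by (rule integrable_mult_right)
      fix y
      have "\<bar>u y * kern \<alpha> R (x - y) - u y * kern \<alpha> R (x' - y)\<bar> = \<bar>u y\<bar> * \<bar>kern \<alpha> R (x - y) - kern \<alpha> R (x' - y)\<bar>"
        by (simp only: right_diff_distrib[symmetric] abs_mult)
      also have "\<dots> \<le> \<bar>u y\<bar> * (M * norm (x - x') * decay \<alpha> y)" by (intro mult_left_mono le) auto
      finally show "\<bar>u y * kern \<alpha> R (x - y) - u y * kern \<alpha> R (x' - y)\<bar> \<le> (M * norm (x - x')) * (\<bar>u y\<bar> * decay \<alpha> y)"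
        by (simp only: mult_ac)
    qed
    also have "\<dots> = (M * norm (x - x')) * ?I" by (rule integral_mult_right_zero)
    finally show ?thesis by (simp only: mult_ac)
  qed
  moreover have "0 \<le> M * ?I"
    using M by (intro mult_nonneg_nonneg Bochner_Integration.integral_nonneg) (auto intro: less_imp_le decay_pos)
  ultimately show ?thesis by blast
qed

text \<open>For increments smaller than the scale \<open>1 / s\<close> one subtracts the constant \<open>g x\<close>, which
  both bumps integrate to the same value.\<close>

lemma g_bump_diff_le:
  assumes K: "compact K" "K \<subseteq> D"
    and H: "0 \<le> C" "0 \<le> \<beta>" "\<And>y y'. y \<in> K \<Longrightarrow> y' \<in> K \<Longrightarrow> \<bar>g y - g y'\<bar> \<le> C * norm (y - y') powr \<beta>"
    and \<tau>: "0 \<le> \<tau>" "\<tau> \<le> 1 - \<beta>"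
    and L: "0 \<le> L" "\<And>x y::'a. \<bar>bump x - bump y\<bar> \<le> L * norm (x - y)"
    and s: "0 < s" and x: "cball x (1 / s) \<subseteq> K" "cball x' (1 / s) \<subseteq> K"
  shows "\<bar>(LINT y|lborel. g y * bump (s *\<^sub>R (x - y))) - (LINT y|lborel. g y * bump (s *\<^sub>R (x' - y)))\<bar> \<le>
    C * (bump_mass TYPE('a) + L * 2 * (unit_ball_vol DIM('a) * 2 ^ DIM('a))) * s powr (\<tau> - real DIM('a)) * norm (x - x') powr (\<beta> + \<tau>)"
proof (cases "x = x'")
  case False
  let ?h = "norm (x - x')" and ?d = "DIM('a)" and ?m = "bump_mass TYPE('a)"
  let ?V = "unit_ball_vol ?d * 2 ^ ?d"
  have h: "0 < ?h" using False by simp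
  have V: "0 \<le> ?V" by simp
  have m: "0 < ?m" by (rule bump_mass_pos)
  have int: "integrable lborel (\<lambda>y. g y * bump (s *\<^sub>R (z - y)))" if "cball z (1 / s) \<subseteq> K" for z
  proof -
    have "(\<lambda>y. g y * bump (s *\<^sub>R (z - y))) = (\<lambda>y. indicator K y * g y * bump (s *\<^sub>R (z - y)))"
      by (intro ext g_bump_restrict s that)
    then show ?thesis by (simp only: integrable_bump_mult[OF g_integrable[OF K]])
  qed
  have sd: "s powr (- real ?d) = 1 / s ^ ?d" using s by (simp add: powr_minus_divide powr_realpow)
  show ?thesis
  proof (cases "1 \<le> s * ?h")
    case True
    \<comment> \<open>Increments not below the bump radius 1/s: both integrals are moved to a bump
      at the origin, and the values of \<open>g\<close> are compared at points that differ by x -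
      x'.\<close>
    have shift: "(LINT y|lborel. g y * bump (s *\<^sub>R (z - y))) = (LINT w|lborel. g (z - w) * bump (s *\<^sub>R w))"
      and shint: "cball z (1 / s) \<subseteq> K \<Longrightarrow> integrable lborel (\<lambda>w. g (z - w) * bump (s *\<^sub>R w))" for z
      using integral_lborel_minus[of "\<lambda>y. g y * bump (s *\<^sub>R (z - y))" z]
        integrable_lborel_minus_iff[of "\<lambda>y. g y * bump (s *\<^sub>R (z - y))" z] int[of z] by auto
    have le: "\<bar>g (x - w) * bump (s *\<^sub>R w) - g (x' - w) * bump (s *\<^sub>R w)\<bar> \<le> C * ?h powr \<beta> * bump (s *\<^sub>R (0 - w))" for w
    proof (cases "norm w \<le> 1 / s")
      case True
      then have "x - w \<in> K" "x' - w \<in> K" using x by (auto simp: dist_norm)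
      from H(3)[OF this] have "\<bar>g (x - w) - g (x' - w)\<bar> \<le> C * ?h powr \<beta>" by simp
      then have "\<bar>g (x - w) - g (x' - w)\<bar> * bump (s *\<^sub>R w) \<le> C * ?h powr \<beta> * bump (s *\<^sub>R w)"
        by (rule mult_right_mono) (rule bump_nonneg)
      then show ?thesis
        by (simp add: left_diff_distrib[symmetric] abs_mult bump_nonneg)
    next
      case False
      then have "1 < s * norm w" using s by (simp add: field_simps)
      then have "bump (s *\<^sub>R w) = 0" using s by (intro bump_eq_0) simp
      then show ?thesis by simp
    qed
    have "\<bar>(LINT y|lborel. g y * bump (s *\<^sub>R (x - y))) - (LINT y|lborel. g y * bump (s *\<^sub>R (x' - y)))\<bar> =
      \<bar>LINT w|lborel. g (x - w) * bump (s *\<^sub>R w) - g (x' - w) * bump (s *\<^sub>R w)\<bar>"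
      unfolding shift using shint x by (subst Bochner_Integration.integral_diff) auto
    also have "\<dots> \<le> (LINT w|lborel. \<bar>g (x - w) * bump (s *\<^sub>R w) - g (x' - w) * bump (s *\<^sub>R w)\<bar>)"
      by (rule integral_abs_bound)
    also have "\<dots> \<le> (LINT w|lborel. C * ?h powr \<beta> * bump (s *\<^sub>R (0 - w :: 'a)))"
      by (intro integral_mono[OF _ _ le] integrable_abs Bochner_Integration.integrable_diff integrable_mult_right integral_scaled_bump(2) s shint x)
    also have "\<dots> = C * ?h powr \<beta> * (LINT w|lborel. bump (s *\<^sub>R (0 - w :: 'a)))" by (rule integral_mult_right_zero)
    also have "\<dots> = C * ?h powr \<beta> * ?m * s powr (- real ?d)"
      unfolding integral_scaled_bump(1)[OF s] sd by simp
    also have "\<dots> \<le> C * ?h powr \<beta> * (?m + L * 2 * ?V) * s powr (- real ?d)"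
      using H(1) L(1) V by (intro mult_right_mono mult_left_mono) auto
    \<comment> \<open>Here s h \<ge> 1, so the factor (s h)^\<tau> may be inserted; it trades powers
      of \<open>s\<close> for powers of h.\<close>
    also have "\<dots> \<le> C * ?h powr \<beta> * (?m + L * 2 * ?V) * s powr (- real ?d) * (s * ?h) powr \<tau>"
    proof -
      have "1 \<le> (s * ?h) powr \<tau>" using True \<tau> by (simp add: ge_one_powr_ge_zero)
      moreover have "0 \<le> C * ?h powr \<beta> * (?m + L * 2 * ?V) * s powr (- real ?d)"
        using H(1) L(1) V m by (intro mult_nonneg_nonneg add_nonneg_nonneg) auto
      ultimately show ?thesis using mult_left_mono[of 1 "(s * ?h) powr \<tau>"] by fastforce
    qed
    also have "\<dots> = C * (?m + L * 2 * ?V) * s powr (\<tau> - real ?d) * ?h powr (\<beta> + \<tau>)"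
      using s h by (simp add: powr_mult powr_add powr_diff powr_minus_divide mult_ac)
    finally show ?thesis .
  next
    case sh: False
    \<comment> \<open>Both bumps live within 2/s of \<open>x\<close>, where \<open>g\<close>
      deviates from \<open>g x\<close> by at most C (2/s)^\<beta>, while the two bumps differ by at
      most L s h.\<close>
    have le: "\<bar>(g y - g x) * (bump (s *\<^sub>R (x - y)) - bump (s *\<^sub>R (x' - y)))\<bar> \<le> C * (2 / s) powr \<beta> * (L * (s * ?h)) * indicator (cball x (2 / s)) y" for y
    proof (cases "y \<in> cball x (1 / s) \<union> cball x' (1 / s)")
      case True
      have xK: "x \<in> K" "y \<in> K" using True x s by (auto intro: subsetD[OF x(1)])
      have yx: "norm (y - x) \<le> 2 / s"
      proof (cases "y \<in> cball x (1 / s)")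
        case True
        then have "norm (y - x) \<le> 1 / s" by (simp add: dist_norm norm_minus_commute)
        also have "\<dots> \<le> 2 / s" using s by (simp add: divide_right_mono)
        finally show ?thesis .
      next
        case False
        then have "norm (y - x') \<le> 1 / s" using True by (simp add: dist_norm norm_minus_commute)
        moreover have "norm (x' - x) \<le> 1 / s" using sh s by (simp add: field_simps norm_minus_commute)
        moreover have "1 / s + 1 / s = 2 / s" by simp
        ultimately show ?thesis using norm_triangle_ineq[of "y - x'" "x' - x"] by simp
      qed
      have "\<bar>g y - g x\<bar> \<le> C * norm (y - x) powr \<beta>" by (rule H(3)[OF xK(2,1)])
      also have "\<dots> \<le> C * (2 / s) powr \<beta>" using yx H by (intro mult_left_mono powr_mono2) auto
      finally have 1: "\<bar>g y - g x\<bar> \<le> C * (2 / s) powr \<beta>" .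
      have "\<bar>bump (s *\<^sub>R (x - y)) - bump (s *\<^sub>R (x' - y))\<bar> \<le> L * norm (s *\<^sub>R (x - y) - s *\<^sub>R (x' - y))" by (rule L(2))
      also have "s *\<^sub>R (x - y) - s *\<^sub>R (x' - y) = s *\<^sub>R (x - x')" by (simp add: algebra_simps)
      also have "norm (s *\<^sub>R (x - x')) = s * ?h" using s by (simp only: norm_scaleR)
      finally have 2: "\<bar>bump (s *\<^sub>R (x - y)) - bump (s *\<^sub>R (x' - y))\<bar> \<le> L * (s * ?h)" .
      have "\<bar>g y - g x\<bar> * \<bar>bump (s *\<^sub>R (x - y)) - bump (s *\<^sub>R (x' - y))\<bar> \<le> C * (2 / s) powr \<beta> * (L * (s * ?h))"
        using H(1) by (intro mult_mono 1 2) auto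
      then show ?thesis using yx by (simp add: abs_mult dist_norm norm_minus_commute)
    next
      case False
      then have "bump (s *\<^sub>R (x - y)) = 0" "bump (s *\<^sub>R (x' - y)) = 0" using scaled_bump_eq_0[OF s] by auto
      then show ?thesis using False H(1) L(1) s by simp
    qed
    have ind: "integrable lborel (\<lambda>y. C * (2 / s) powr \<beta> * (L * (s * ?h)) * indicator (cball x (2 / s)) y)"
      using emeasure_lborel_cball_finite[of x "2 / s"] by (intro integrable_mult_right) (simp add: less_top)
    have "(LINT y|lborel. g y * bump (s *\<^sub>R (x - y))) - (LINT y|lborel. g y * bump (s *\<^sub>R (x' - y))) =
      ((LINT y|lborel. g y * bump (s *\<^sub>R (x - y))) - g x * (LINT y|lborel. bump (s *\<^sub>R (x - y))))
      - ((LINT y|lborel. g y * bump (s *\<^sub>R (x' - y))) - g x * (LINT y|lborel. bump (s *\<^sub>R (x' - y))))"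
      unfolding integral_scaled_bump(1)[OF s] by simp
    also have "\<dots> = (LINT y|lborel. (g y * bump (s *\<^sub>R (x - y)) - g x * bump (s *\<^sub>R (x - y)))
      - (g y * bump (s *\<^sub>R (x' - y)) - g x * bump (s *\<^sub>R (x' - y))))"
      by (simp add: int[OF x(1)] int[OF x(2)] integral_scaled_bump(2)[OF s, of x] integral_scaled_bump(2)[OF s, of x'])
    also have "\<dots> = (LINT y|lborel. (g y - g x) * (bump (s *\<^sub>R (x - y)) - bump (s *\<^sub>R (x' - y))))"
      by (simp add: left_diff_distrib right_diff_distrib)
    also have "\<bar>\<dots>\<bar> \<le> (LINT y|lborel. \<bar>(g y - g x) * (bump (s *\<^sub>R (x - y)) - bump (s *\<^sub>R (x' - y)))\<bar>)"
      by (rule integral_abs_bound)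
    also have "\<dots> \<le> (LINT y|lborel. C * (2 / s) powr \<beta> * (L * (s * ?h)) * indicator (cball x (2 / s)) y)"
    proof (rule integral_mono[OF _ ind le])
      have "integrable lborel (\<lambda>y. (g y * bump (s *\<^sub>R (x - y)) - g x * bump (s *\<^sub>R (x - y)))
      - (g y * bump (s *\<^sub>R (x' - y)) - g x * bump (s *\<^sub>R (x' - y))))"
        by (intro Bochner_Integration.integrable_diff integrable_mult_right int x integral_scaled_bump(2) s)
      then have "integrable lborel (\<lambda>y. (g y - g x) * (bump (s *\<^sub>R (x - y)) - bump (s *\<^sub>R (x' - y))))"
        by (simp add: left_diff_distrib right_diff_distrib)
      then show "integrable lborel (\<lambda>y. \<bar>(g y - g x) * (bump (s *\<^sub>R (x - y)) - bump (s *\<^sub>R (x' - y)))\<bar>)"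
        by (rule integrable_abs)
    qed
    also have "\<dots> = C * (2 / s) powr \<beta> * (L * (s * ?h)) * measure lborel (cball x (2 / s))"
      by (subst integral_mult_right_zero) simp
    also have "measure lborel (cball x (2 / s)) = ?V * s powr (- real ?d)"
      using s emeasure_cball[of "2 / s" x] by (simp add: measure_def power_divide sd)
    also have "C * (2 / s) powr \<beta> * (L * (s * ?h)) * (?V * s powr (- real ?d)) \<le> C * (2 * s powr (- \<beta>)) * (L * (s * ?h)) * (?V * s powr (- real ?d))"
    proof (intro mult_right_mono mult_left_mono)
      have "(2::real) powr \<beta> \<le> 2 powr 1" using \<tau> by (intro powr_mono) auto
      then show "(2 / s) powr \<beta> \<le> 2 * s powr (- \<beta>)"
        using s by (simp add: powr_divide powr_minus_divide divide_right_mono)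
    qed (use H(1) L(1) s V in auto)
    also have "\<dots> = C * (L * 2 * ?V) * s powr (- real ?d) * ?h powr \<beta> * (s * ?h) powr (1 - \<beta>)"
      using s h by (simp add: powr_mult powr_diff powr_minus_divide mult_ac)
    \<comment> \<open>As s h < 1, the exponent 1 - \<beta> may be lowered to \<tau>; this is where
      \<tau> \<le> 1 - \<beta> is used, and both cases end with the same powers.\<close>
    also have "\<dots> \<le> C * (L * 2 * ?V) * s powr (- real ?d) * ?h powr \<beta> * (s * ?h) powr \<tau>"
      using sh \<tau> H(1) L(1) V s h by (intro mult_left_mono powr_mono') (auto intro!: mult_nonneg_nonneg)
    also have "\<dots> \<le> C * (?m + L * 2 * ?V) * s powr (- real ?d) * ?h powr \<beta> * (s * ?h) powr \<tau>"
      using m H(1) by (intro mult_right_mono mult_left_mono) auto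
    also have "\<dots> = C * (?m + L * 2 * ?V) * s powr (\<tau> - real ?d) * ?h powr (\<beta> + \<tau>)"
      using s h by (simp add: powr_mult powr_add powr_diff powr_minus_divide mult_ac)
    finally show ?thesis .
  qed
qed simp

text \<open>After \<open>g_bump_diff_le\<close> the scale integral has the integrand
  s^(\<tau>-\<alpha>-1), which converges at infinity precisely for \<tau> < \<alpha>: this is the
  regularity gained in one application. The constant does not depend on \<open>n\<close>.\<close>

lemma approx_Hoelder:
  assumes r: "0 < r" "r \<le> 1" and sub: "cball x0 r \<subseteq> D"
    and H: "0 \<le> C" "0 \<le> \<beta>" "\<And>y y'. y \<in> cball x0 r \<Longrightarrow> y' \<in> cball x0 r \<Longrightarrow> \<bar>g y - g y'\<bar> \<le> C * norm (y - y') powr \<beta>"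
    and \<tau>: "0 \<le> \<tau>" "\<tau> < \<alpha>" "\<tau> \<le> 1 - \<beta>"
  shows "\<exists>M\<ge>0. \<exists>N. \<forall>n\<ge>N. \<forall>x\<in>cball x0 (r / 4). \<forall>x'\<in>cball x0 (r / 4).
    \<bar>A * approx n x - A * approx n x'\<bar> \<le> M * norm (x - x') powr (\<beta> + \<tau>)"
proof -
  let ?d = "DIM('a)" and ?K = "cball x0 r"
  \<comment> \<open>Bumps of radius r/2 around points of the quarter ball stay inside the ball, and
    two such points satisfy R |x - x'| \<le> 1, as \<open>u_kern_Lipschitz\<close> demands.\<close>
  define R where "R = 2 / r"
  have R: "0 < R" "1 / R = r / 2" using r by (auto simp: R_def)
  obtain L where L: "0 \<le> L" "\<And>x y::'a. \<bar>bump x - bump y\<bar> \<le> L * norm (x - y)"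
    using bump_Lipschitz(1) by blast
  obtain C1 where C1: "0 \<le> C1" "\<And>x x'. norm x \<le> norm x0 + r \<Longrightarrow> R * norm (x - x') \<le> 1 \<Longrightarrow>
    \<bar>(LINT y|lborel. u y * kern \<alpha> R (x - y)) - (LINT y|lborel. u y * kern \<alpha> R (x' - y))\<bar> \<le> C1 * norm (x - x')"
    using u_kern_Lipschitz[OF R(1)] by blast
  define C2 where "C2 = C * (bump_mass TYPE('a) + L * 2 * (unit_ball_vol ?d * 2 ^ ?d))"
  have C2: "0 \<le> C2"
    unfolding C2_def using H(1) L(1) bump_mass_pos[where 'a='a] by (intro mult_nonneg_nonneg add_nonneg_nonneg) auto
  \<comment> \<open>The value of \<integral> s^(\<tau>-\<alpha>-1) ds over s > R.\<close>
  define C3 where "C3 = R powr (\<tau> - \<alpha>) / (\<alpha> - \<tau>)"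
  have C3: "0 \<le> C3" using \<tau> by (simp add: C3_def)
  define M where "M = A * C1 + C2 * C3"
  have M: "0 \<le> M" using A C1(1) C2 C3 by (simp add: M_def)
  obtain N :: nat where N: "R \<le> real N" using real_arch_simple by blast
  have "\<bar>A * approx n x - A * approx n x'\<bar> \<le> M * norm (x - x') powr (\<beta> + \<tau>)"
    if n: "N \<le> n" and x: "x \<in> cball x0 (r / 4)" "x' \<in> cball x0 (r / 4)" for n x x'
  proof -
    let ?h = "norm (x - x')" and ?S = "real (Suc n)" and ?e = "real ?d - 1 - \<alpha>"
    have S: "R \<le> ?S" using N n by simp
    have hr: "?h \<le> r / 2" using x dist_triangle2[of x x' x0] by (simp add: dist_norm norm_minus_commute)
    have nx: "norm x \<le> norm x0 + r"
      using x(1) r norm_triangle_ineq2[of x x0] by (simp add: dist_norm norm_minus_commute)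
    have cb: "cball z (1 / R) \<subseteq> ?K" if "z \<in> cball x0 (r / 4)" for z
    proof
      fix w assume "w \<in> cball z (1 / R)"
      with that r dist_triangle[of x0 w z] show "w \<in> ?K" unfolding R(2) by simp
    qed
    let ?G = "\<lambda>z s. LINT y|lborel. g y * bump (s *\<^sub>R (z - y))"
    have eq: "A * approx n z = A * (LINT y|lborel. u y * kern \<alpha> R (z - y)) + (LINT s:{R..?S}|lborel. s powr ?e * ?G z s)"
      if "z \<in> cball x0 (r / 4)" for z
      unfolding approx_def using cb[OF that] sub by (intro u_kern_diff R S) auto
    have le: "\<bar>?G x s - ?G x' s\<bar> \<le> C2 * s powr (\<tau> - real ?d) * ?h powr (\<beta> + \<tau>)" if s: "R \<le> s" for s
    proof -
      have "1 / s \<le> 1 / R" using s R by (intro frac_le) auto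
      then have "cball z (1 / s) \<subseteq> cball z (1 / R)" for z :: 'a by (rule subset_cball)
      then show ?thesis
        unfolding C2_def using cb[OF x(1)] cb[OF x(2)] s R
        by (intro g_bump_diff_le[OF compact_cball sub H \<tau>(1,3) L]) auto
    qed
    have pw: "set_integrable lborel {R..?S} (\<lambda>s. s powr ?e * ?G z s)" if "z \<in> cball x0 (r / 4)" for z
    proof -
      let ?g = "\<lambda>y. indicator ?K y * g y"
      have gi: "integrable lborel ?g" by (rule g_integrable[OF compact_cball sub])
      then have [measurable]: "?g \<in> borel_measurable borel" by auto
      have Geq: "?G z s = (LINT y|lborel. ?g y * bump (s *\<^sub>R (z - y)))" if "R \<le> s" for s
      proof -
        have "1 / s \<le> 1 / R" using that R by (intro frac_le) auto
        then have "cball z (1 / s) \<subseteq> ?K" using cb[OF \<open>z \<in> cball x0 (r / 4)\<close>] subset_cball[of "1 / s" "1 / R" z] by auto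
        then have "g y * bump (s *\<^sub>R (z - y)) = ?g y * bump (s *\<^sub>R (z - y))" for y
          using that R by (intro g_bump_restrict) auto
        then show ?thesis by (intro Bochner_Integration.integral_cong refl)
      qed
      have b: "\<bar>LINT y|lborel. ?g y * bump (s *\<^sub>R (z - y))\<bar> \<le> (LINT y|lborel. \<bar>?g y\<bar>)" for s
      proof (rule order_trans[OF integral_abs_bound integral_mono])
        show "integrable lborel (\<lambda>y. \<bar>?g y * bump (s *\<^sub>R (z - y))\<bar>)" by (intro integrable_abs integrable_bump_mult gi)
        show "integrable lborel (\<lambda>y. \<bar>?g y\<bar>)" by (intro integrable_abs gi)
        fix y
        have "\<bar>?g y\<bar> * bump (s *\<^sub>R (z - y)) \<le> \<bar>?g y\<bar> * 1" by (intro mult_left_mono bump_le_1) auto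
        then show "\<bar>?g y * bump (s *\<^sub>R (z - y))\<bar> \<le> \<bar>?g y\<bar>" by (simp only: abs_mult abs_of_nonneg[OF bump_nonneg])
      qed
      have base: "set_integrable lborel {R..?S} (\<lambda>s. s powr ?e * (LINT y|lborel. \<bar>?g y\<bar>))"
        using R by (intro borel_integrable_atLeastAtMost' continuous_intros) auto
      have "set_integrable lborel {R..?S} (\<lambda>s. s powr ?e * (LINT y|lborel. ?g y * bump (s *\<^sub>R (z - y))))"
      proof (rule set_integrable_bound[OF base])
        show "set_borel_measurable lborel {R..?S} (\<lambda>s. s powr ?e * (LINT y|lborel. ?g y * bump (s *\<^sub>R (z - y))))"
          unfolding set_borel_measurable_def by measurable
        show "AE s in lborel. s \<in> {R..?S} \<longrightarrow> norm (s powr ?e * (LINT y|lborel. ?g y * bump (s *\<^sub>R (z - y)))) \<le> norm (s powr ?e * (LINT y|lborel. \<bar>?g y\<bar>))"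
          using b by (intro AE_I2) (auto simp: abs_mult intro!: mult_left_mono intro: order_trans[OF _ abs_ge_self])
      qed
      then show ?thesis
        by (rule iffD1[OF set_integrable_cong, rotated -1]) (auto simp: Geq)
    qed
    have "\<bar>(LINT s:{R..?S}|lborel. s powr ?e * ?G x s) - (LINT s:{R..?S}|lborel. s powr ?e * ?G x' s)\<bar> =
      \<bar>LINT s:{R..?S}|lborel. s powr ?e * ?G x s - s powr ?e * ?G x' s\<bar>"
      using pw x by (subst set_integral_diff(2)) auto
    also have "\<dots> \<le> (LINT s:{R..?S}|lborel. \<bar>s powr ?e * ?G x s - s powr ?e * ?G x' s\<bar>)"
      unfolding set_lebesgue_integral_def by (rule order_trans[OF integral_abs_bound]) (auto simp: abs_mult)
    also have "\<dots> \<le> (LINT s:{R..?S}|lborel. C2 * ?h powr (\<beta> + \<tau>) * s powr (\<tau> - \<alpha> - 1))"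
    proof (rule set_integral_mono)
      show "set_integrable lborel {R..?S} (\<lambda>s. \<bar>s powr ?e * ?G x s - s powr ?e * ?G x' s\<bar>)"
        using pw x by (intro set_integrable_abs set_integral_diff(1)) auto
      show "set_integrable lborel {R..?S} (\<lambda>s. C2 * ?h powr (\<beta> + \<tau>) * s powr (\<tau> - \<alpha> - 1))"
        using R by (intro borel_integrable_atLeastAtMost' continuous_intros) auto
      fix s assume s: "s \<in> {R..?S}"
      then have s0: "0 < s" "R \<le> s" using R by auto
      have "\<bar>s powr ?e * ?G x s - s powr ?e * ?G x' s\<bar> = s powr ?e * \<bar>?G x s - ?G x' s\<bar>"
        by (simp only: right_diff_distrib[symmetric] abs_mult) simp
      also have "\<dots> \<le> s powr ?e * (C2 * s powr (\<tau> - real ?d) * ?h powr (\<beta> + \<tau>))"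
        by (intro mult_left_mono le s0) auto
      also have "\<dots> = C2 * ?h powr (\<beta> + \<tau>) * (s powr ?e * s powr (\<tau> - real ?d))" by (simp only: mult_ac)
      also have "s powr ?e * s powr (\<tau> - real ?d) = s powr (\<tau> - \<alpha> - 1)" by (simp add: powr_add[symmetric])
      finally show "\<bar>s powr ?e * ?G x s - s powr ?e * ?G x' s\<bar> \<le> C2 * ?h powr (\<beta> + \<tau>) * s powr (\<tau> - \<alpha> - 1)" .
    qed
    also have "\<dots> = C2 * ?h powr (\<beta> + \<tau>) * (LINT s:{R..?S}|lborel. s powr (\<tau> - \<alpha> - 1))"
      by (rule set_integral_mult_right)
    also have "(LINT s:{R..?S}|lborel. s powr (\<tau> - \<alpha> - 1)) \<le> C3"
    proof -
      let ?F = "\<lambda>s. s powr (\<tau> - \<alpha>) / (\<tau> - \<alpha>)"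
      have "(\<integral>s. s powr (\<tau> - \<alpha> - 1) * indicator {R .. ?S} s \<partial>lborel) = ?F ?S - ?F R"
      proof (rule integral_FTC_Icc_real[OF S])
        fix s assume "R \<le> s"
        then have s: "0 < s" using R by simp
        have "((\<lambda>s. s powr (\<tau> - \<alpha>)) has_real_derivative (\<tau> - \<alpha>) * s powr (\<tau> - \<alpha> - 1)) (at s)"
          using s by (rule has_real_derivative_powr)
        from DERIV_cdivide[OF this, of "\<tau> - \<alpha>"] show "DERIV ?F s :> s powr (\<tau> - \<alpha> - 1)"
          using \<tau> by simp
        show "isCont (\<lambda>s. s powr (\<tau> - \<alpha> - 1)) s" using s by (intro continuous_intros) auto
      qed
      then have "(LINT s:{R..?S}|lborel. s powr (\<tau> - \<alpha> - 1)) = ?F ?S - ?F R"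
        by (simp add: set_lebesgue_integral_def mult.commute)
      also have "\<dots> = C3 - ?S powr (\<tau> - \<alpha>) / (\<alpha> - \<tau>)"
        using \<tau> minus_divide_right[of "R powr (\<tau> - \<alpha>)" "\<tau> - \<alpha>"] minus_divide_right[of "?S powr (\<tau> - \<alpha>)" "\<tau> - \<alpha>"]
        by (simp only: C3_def minus_diff_eq)
      also have "\<dots> \<le> C3" using \<tau> by simp
      finally show ?thesis .
    qed
    finally have 2: "\<bar>(LINT s:{R..?S}|lborel. s powr ?e * ?G x s) - (LINT s:{R..?S}|lborel. s powr ?e * ?G x' s)\<bar> \<le> C2 * ?h powr (\<beta> + \<tau>) * C3"
      using C2 by (simp add: mult_left_mono)
    have "R * ?h \<le> R * (r / 2)" using hr R by (intro mult_left_mono) auto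
    also have "\<dots> = 1" using r by (simp add: R_def)
    finally have "\<bar>(LINT y|lborel. u y * kern \<alpha> R (x - y)) - (LINT y|lborel. u y * kern \<alpha> R (x' - y))\<bar> \<le> C1 * ?h"
      using nx by (intro C1(2))
    also have "\<dots> \<le> C1 * ?h powr (\<beta> + \<tau>)"
    proof (intro mult_left_mono)
      have "?h powr 1 \<le> ?h powr (\<beta> + \<tau>)" using hr r \<tau> by (intro powr_mono') auto
      then show "?h \<le> ?h powr (\<beta> + \<tau>)" by simp
    qed (rule C1(1))
    finally have "A * \<bar>(LINT y|lborel. u y * kern \<alpha> R (x - y)) - (LINT y|lborel. u y * kern \<alpha> R (x' - y))\<bar> \<le> A * (C1 * ?h powr (\<beta> + \<tau>))"
      using A by (intro mult_left_mono) auto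
    then have 1: "\<bar>A * (LINT y|lborel. u y * kern \<alpha> R (x - y)) - A * (LINT y|lborel. u y * kern \<alpha> R (x' - y))\<bar> \<le> A * (C1 * ?h powr (\<beta> + \<tau>))"
      using A by (simp only: right_diff_distrib[symmetric] abs_mult abs_of_pos)
    have "\<bar>A * approx n x - A * approx n x'\<bar> \<le> A * (C1 * ?h powr (\<beta> + \<tau>)) + C2 * ?h powr (\<beta> + \<tau>) * C3"
      unfolding eq[OF x(1)] eq[OF x(2)] using 1 2 by linarith
    then show ?thesis by (simp add: M_def algebra_simps)
  qed
  with M show ?thesis by blast
qed

end

subsection \<open>The regular version of a weak solution\<close>

context weak_pair_bounded
begin

text \<open>With \<open>u\<close> essentially bounded near \<open>x0\<close>, the truncated Riesz
  potential of |g| is finite at every point and not just at almost every one, so the convolutions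
  converge everywhere on a smaller ball, with limits bounded uniformly there.\<close>

lemma approx_convergent:
  assumes "x0 \<in> D"
  shows "\<exists>r>0. r \<le> 1 \<and> cball x0 r \<subseteq> D \<and>
    (\<exists>M\<ge>0. \<forall>x\<in>cball x0 r. \<exists>l. (\<lambda>n. A * approx n x) \<longlonglongrightarrow> l \<and> \<bar>l\<bar> \<le> M)"
proof -
  obtain r0 M0 where r0: "0 < r0" "cball x0 r0 \<subseteq> D" and AE: "AE x in lborel. x \<in> cball x0 r0 \<longrightarrow> \<bar>u x\<bar> \<le> M0"
    using u_locally_bounded[OF assms] by blast
  define r where "r = min r0 1"
  have r: "0 < r" "r \<le> r0" "r \<le> 1" using r0 by (auto simp: r_def)
  define R where "R = 2 / r"
  have R: "0 < R" "1 / R = r / 2" using r by (auto simp: R_def)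
  let ?K = "cball x0 r"
  have Kr: "?K \<subseteq> cball x0 r0" using r by (intro subset_cball)
  then have KD: "?K \<subseteq> D" using r0 by blast
  let ?h = "\<lambda>y. indicator ?K y * g y" and ?k = "riesz_kernel \<alpha> (1 / R) :: 'a \<Rightarrow> real"
  define B where "B = \<bar>Q\<bar> * \<bar>M0\<bar>"
  have B: "0 \<le> B" by (simp add: B_def)
  have [measurable]: "?h \<in> borel_measurable borel" using g_integrable[OF compact_cball KD] by auto
  have hB: "AE y in lborel. \<bar>?h y\<bar> \<le> B"
    using AE
  proof eventually_elim
    case (elim y)
    show ?case
    proof (cases "y \<in> ?K")
      case True
      then have "y \<in> D" "\<bar>u y\<bar> \<le> \<bar>M0\<bar>" using elim Kr KD by auto
      then have "\<bar>g y\<bar> \<le> Q * \<bar>u y\<bar>" "\<bar>u y\<bar> \<le> \<bar>M0\<bar>" using g_le by auto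
      moreover have "Q * \<bar>u y\<bar> \<le> \<bar>Q\<bar> * \<bar>M0\<bar>" using \<open>\<bar>u y\<bar> \<le> \<bar>M0\<bar>\<close> by (intro mult_mono) auto
      ultimately show ?thesis using True by (simp add: B_def)
    qed (simp add: B)
  qed
  obtain c where c: "0 \<le> c" "\<And>x. norm x \<le> norm x0 + r \<Longrightarrow> \<bar>LINT y|lborel. u y * kern \<alpha> R (x - y)\<bar> \<le> c"
    using u_kern_bound[OF R(1)] by blast
  let ?b = "real DIM('a) - \<alpha>"
  let ?I = "LINT y|lborel. ?k y"
  define M where "M = A * c + B * ?I / ?b"
  have I: "0 \<le> ?I" by (intro Bochner_Integration.integral_nonneg riesz_kernel_nonneg)
  have M: "0 \<le> M" unfolding M_def using A c(1) B I dim_gt by (intro add_nonneg_nonneg mult_nonneg_nonneg divide_nonneg_nonneg) auto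
  have "\<exists>l. (\<lambda>n. A * approx n x) \<longlonglongrightarrow> l \<and> \<bar>l\<bar> \<le> M" if x: "x \<in> cball x0 (r / 2)" for x
  proof -
    have cb: "cball x (1 / R) \<subseteq> ?K"
    proof
      fix w assume "w \<in> cball x (1 / R)"
      with x dist_triangle[of x0 w x] show "w \<in> ?K" unfolding R(2) by simp
    qed
    have nx: "norm x \<le> norm x0 + r"
      using x r norm_triangle_ineq2[of x x0] by (simp add: dist_norm norm_minus_commute)
    have k: "integrable lborel (\<lambda>y. B * ?k (x - y))"
      using integrable_riesz_kernel[OF \<alpha>(1), where 'a='a, of "1 / R"] integrable_lborel_minus_iff[of ?k x]
      by (intro integrable_mult_right) simp
    have AEk: "AE y in lborel. \<bar>?h y\<bar> * ?k (x - y) \<le> B * ?k (x - y)"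
      using hB by eventually_elim (intro mult_right_mono riesz_kernel_nonneg)
    have int: "integrable lborel (\<lambda>y. \<bar>?h y\<bar> * ?k (x - y))"
    proof (rule Bochner_Integration.integrable_bound[OF k])
      show "AE y in lborel. norm (\<bar>?h y\<bar> * ?k (x - y)) \<le> norm (B * ?k (x - y))"
        using AEk
      proof eventually_elim
        case (elim y)
        have "norm (\<bar>?h y\<bar> * ?k (x - y)) = \<bar>?h y\<bar> * ?k (x - y)"
          using riesz_kernel_nonneg[of \<alpha> "1 / R" "x - y"] by (simp add: abs_mult)
        moreover have "B * ?k (x - y) \<le> norm (B * ?k (x - y))" by simp
        ultimately show ?case using elim by linarith
      qed
    qed measurable
    have lim: "(\<lambda>n. A * approx n x) \<longlonglongrightarrow> limit ?K R x"
      by (rule approx_tendsto[OF R(1) compact_cball KD cb int])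
    have tail: "\<bar>LINT y|lborel. ?h y * riesz_tail \<alpha> R (x - y)\<bar> \<le> (LINT y|lborel. B * ?k (x - y) / ?b)"
    proof -
      have AEb: "AE y in lborel. \<bar>?h y * riesz_tail \<alpha> R (x - y)\<bar> \<le> B * ?k (x - y) / ?b"
        using AE_lborel_singleton[of x] AEk
      proof eventually_elim
        case (elim y)
        then have "x - y \<noteq> 0" by simp
        from mult_left_mono[OF riesz_tail_le[OF \<alpha> R(1) this] abs_ge_zero[of "?h y"]]
        have "\<bar>?h y * riesz_tail \<alpha> R (x - y)\<bar> \<le> \<bar>?h y\<bar> * ?k (x - y) / ?b" by (simp add: abs_mult)
        also have "\<dots> \<le> B * ?k (x - y) / ?b" using elim(2) dim_gt by (intro divide_right_mono) auto
        finally show ?case .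
      qed
      have i: "integrable lborel (\<lambda>y. B * ?k (x - y) / ?b)" using k by (rule integrable_divide)
      have "integrable lborel (\<lambda>y. \<bar>?h y * riesz_tail \<alpha> R (x - y)\<bar>)"
      proof (rule Bochner_Integration.integrable_bound[OF i])
        show "AE y in lborel. norm \<bar>?h y * riesz_tail \<alpha> R (x - y)\<bar> \<le> norm (B * ?k (x - y) / ?b)"
          using AEb
        proof eventually_elim
          case (elim y)
          then show ?case unfolding real_norm_def abs_abs by (rule order_trans[OF _ abs_ge_self])
        qed
      qed measurable
      then show ?thesis
        by (intro order_trans[OF integral_abs_bound integral_mono_AE[OF _ i AEb]])
    qed
    also have "\<dots> = B * ?I / ?b"
      using integral_lborel_minus[of ?k x] by simp
    finally have "\<bar>limit ?K R x\<bar> \<le> M"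
      unfolding limit_def M_def using c(2)[OF nx] A mult_left_mono[OF c(2)[OF nx], of A]
      by (intro order_trans[OF abs_triangle_ineq add_mono]) (auto simp: abs_mult)
    with lim show ?thesis by blast
  qed
  moreover have "cball x0 (r / 2) \<subseteq> ?K" using r by (intro subset_cball) simp
  ultimately show ?thesis
    using M r KD by (intro exI[of _ "r / 2"] conjI exI[of _ M]) auto
qed

text \<open>Each point of D has a ball on which the representation holds almost everywhere;
  countably many such balls cover D by the Lindelof property.\<close>

lemma AE_approx_lim:
  "AE x in lborel. x \<in> D \<longrightarrow> u x = lim (\<lambda>n. approx n x) / kern_mass TYPE('a) \<alpha>"
proof -
  let ?m = "kern_mass TYPE('a) \<alpha>"
  have "\<exists>\<rho>>0. AE x in lborel. x \<in> ball x0 \<rho> \<longrightarrow> u x = lim (\<lambda>n. approx n x) / ?m" if "x0 \<in> D" for x0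
  proof -
    obtain P where P: "0 < P" "cball x0 P \<subseteq> D"
      using open_D \<open>x0 \<in> D\<close> by (auto simp: open_contains_cball)
    define R where "R = 2 / P"
    have R: "0 < R" "P / 2 + 1 / R = P" using P by (auto simp: R_def)
    have cb: "cball x (1 / R) \<subseteq> cball x0 P" if "x \<in> ball x0 (P / 2)" for x
    proof
      fix w assume "w \<in> cball x (1 / R)"
      with that R dist_triangle[of x0 w x] show "w \<in> cball x0 P" by simp
    qed
    have "AE x in lborel. x \<in> ball x0 (P / 2) \<longrightarrow>
      integrable lborel (\<lambda>y. \<bar>indicator (cball x0 P) y * g y\<bar> * riesz_kernel \<alpha> (1 / R) (x - y)) \<and> A * ?m * u x = limit (cball x0 P) R x"
      using AE_approx_tendsto[OF R(1), of "P / 2" x0] P unfolding R(2) by simp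
    then have "AE x in lborel. x \<in> ball x0 (P / 2) \<longrightarrow> u x = lim (\<lambda>n. approx n x) / ?m"
    proof eventually_elim
      case (elim x)
      show ?case
      proof
        assume x: "x \<in> ball x0 (P / 2)"
        have "(\<lambda>n. A * approx n x) \<longlonglongrightarrow> A * ?m * u x"
          using elim x approx_tendsto[OF R(1) compact_cball P(2) cb[OF x]] by auto
        then have "(\<lambda>n. A * approx n x / A) \<longlonglongrightarrow> A * ?m * u x / A"
          using A by (intro tendsto_divide tendsto_const) auto
        then have "(\<lambda>n. approx n x) \<longlonglongrightarrow> ?m * u x" using A by simp
        then show "u x = lim (\<lambda>n. approx n x) / ?m" using mass_pos by (simp add: limI)
      qed
    qed
    with P show ?thesis by (intro exI[of _ "P / 2"]) auto
  qed
  then obtain \<rho> where \<rho>: "\<And>x0. x0 \<in> D \<Longrightarrow> 0 < \<rho> x0"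
    "\<And>x0. x0 \<in> D \<Longrightarrow> AE x in lborel. x \<in> ball x0 (\<rho> x0) \<longrightarrow> u x = lim (\<lambda>n. approx n x) / ?m"
    by metis
  let ?F = "(\<lambda>x0. ball x0 (\<rho> x0)) ` D"
  obtain F where F: "F \<subseteq> ?F" "countable F" "\<Union>F = \<Union>?F"
    using Lindelof[of ?F] by auto
  have "AE x in lborel. \<forall>S\<in>F. x \<in> S \<longrightarrow> u x = lim (\<lambda>n. approx n x) / ?m"
    using F \<rho>(2) by (subst AE_ball_countable) auto
  then show ?thesis
  proof eventually_elim
    case (elim x)
    show ?case
    proof
      assume "x \<in> D"
      then have "x \<in> \<Union>?F" using \<rho>(1)[of x] by force
      then show "u x = lim (\<lambda>n. approx n x) / ?m" using elim F(3) by auto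
    qed
  qed
qed

end

text \<open>\<open>u_eq_lim\<close> is demanded at every point of D: it selects one function from
  the almost everywhere class, and all estimates from here on are pointwise.\<close>

locale regular_pair = weak_pair_bounded +
  fixes q :: "'a \<Rightarrow> real" and \<eta> H :: real
  assumes g_eq: "\<And>y. y \<in> D \<Longrightarrow> g y = u y * q y"
    and q_le: "\<And>y. y \<in> D \<Longrightarrow> \<bar>q y\<bar> \<le> Q"
    and H: "0 \<le> H" and \<eta>: "0 < \<eta>"
    and q_Hoelder: "\<And>y y'. y \<in> D \<Longrightarrow> y' \<in> D \<Longrightarrow> \<bar>q y - q y'\<bar> \<le> H * norm (y - y') powr \<eta>"
    and u_eq_lim: "\<And>x. x \<in> D \<Longrightarrow> u x = lim (\<lambda>n. approx n x) / kern_mass TYPE('a) \<alpha>"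
begin

lemma approx_tendsto_u:
  assumes "x \<in> D"
  shows "(\<lambda>n. A * approx n x) \<longlonglongrightarrow> A * kern_mass TYPE('a) \<alpha> * u x"
proof -
  obtain r where "0 < r" and "\<forall>x\<in>cball x r. \<exists>l. (\<lambda>n. A * approx n x) \<longlonglongrightarrow> l"
    using approx_convergent[OF assms] by blast
  then obtain l where l: "(\<lambda>n. A * approx n x) \<longlonglongrightarrow> l" by force
  then have "(\<lambda>n. A * approx n x / A) \<longlonglongrightarrow> l / A" using A by (intro tendsto_divide tendsto_const) auto
  then have "(\<lambda>n. approx n x) \<longlonglongrightarrow> l / A" using A by simp
  then have "u x = l / A / kern_mass TYPE('a) \<alpha>" using u_eq_lim[OF assms] by (simp add: limI)
  then have "A * kern_mass TYPE('a) \<alpha> * u x = l" using A mass_pos by simp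
  with l show ?thesis by simp
qed

section \<open>Hoelder continuity of the regular version\<close>

lemma u_bounded_near:
  assumes "x0 \<in> D"
  shows "\<exists>r>0. r \<le> 1 \<and> cball x0 r \<subseteq> D \<and> (\<exists>M\<ge>0. \<forall>x\<in>cball x0 r. \<bar>u x\<bar> \<le> M)"
proof -
  let ?m = "kern_mass TYPE('a) \<alpha>"
  obtain r M where r: "0 < r" "r \<le> 1" "cball x0 r \<subseteq> D" and M: "0 \<le> M"
    "\<And>x. x \<in> cball x0 r \<Longrightarrow> \<exists>l. (\<lambda>n. A * approx n x) \<longlonglongrightarrow> l \<and> \<bar>l\<bar> \<le> M"
    using approx_convergent[OF assms] by blast
  have Am: "0 < A * ?m" using A mass_pos by simp
  have "\<bar>u x\<bar> \<le> M / (A * ?m)" if x: "x \<in> cball x0 r" for x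
  proof -
    have "x \<in> D" using x r by auto
    obtain l where l: "(\<lambda>n. A * approx n x) \<longlonglongrightarrow> l" "\<bar>l\<bar> \<le> M" using M(2)[OF x] by blast
    have "l = A * ?m * u x" by (rule LIMSEQ_unique[OF l(1) approx_tendsto_u[OF \<open>x \<in> D\<close>]])
    then have "A * ?m * \<bar>u x\<bar> \<le> M" using l(2) Am by (metis abs_mult abs_of_pos)
    then show ?thesis using Am by (simp add: pos_le_divide_eq mult.commute)
  qed
  moreover have "0 \<le> M / (A * ?m)" using M Am by simp
  ultimately show ?thesis using r by blast
qed

text \<open>The bound in \<open>approx_Hoelder\<close> is uniform in \<open>n\<close> and therefore
  passes to the pointwise limit.\<close>

lemma u_Hoelder_gain:
  assumes r: "0 < r" "r \<le> 1" and sub: "cball x0 r \<subseteq> D"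
    and C: "0 \<le> C" "0 \<le> \<beta>" "\<And>y y'. y \<in> cball x0 r \<Longrightarrow> y' \<in> cball x0 r \<Longrightarrow> \<bar>g y - g y'\<bar> \<le> C * norm (y - y') powr \<beta>"
    and \<tau>: "0 \<le> \<tau>" "\<tau> < \<alpha>" "\<tau> \<le> 1 - \<beta>"
  shows "\<exists>M\<ge>0. \<forall>x\<in>cball x0 (r / 4). \<forall>x'\<in>cball x0 (r / 4). \<bar>u x - u x'\<bar> \<le> M * norm (x - x') powr (\<beta> + \<tau>)"
proof -
  let ?m = "kern_mass TYPE('a) \<alpha>"
  have Am: "0 < A * ?m" using A mass_pos by simp
  obtain M N where M: "0 \<le> M" "\<And>n x x'. N \<le> n \<Longrightarrow> x \<in> cball x0 (r / 4) \<Longrightarrow> x' \<in> cball x0 (r / 4) \<Longrightarrow>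
    \<bar>A * approx n x - A * approx n x'\<bar> \<le> M * norm (x - x') powr (\<beta> + \<tau>)"
    using approx_Hoelder[OF r sub C \<tau>] by blast
  have "\<bar>u x - u x'\<bar> \<le> M / (A * ?m) * norm (x - x') powr (\<beta> + \<tau>)"
    if x: "x \<in> cball x0 (r / 4)" "x' \<in> cball x0 (r / 4)" for x x'
  proof -
    have "cball x0 (r / 4) \<subseteq> cball x0 r" using r by (intro subset_cball) simp
    then have D: "x \<in> D" "x' \<in> D" using x sub by auto
    have "(\<lambda>n. \<bar>A * approx n x - A * approx n x'\<bar>) \<longlonglongrightarrow> \<bar>A * ?m * u x - A * ?m * u x'\<bar>"
      by (intro tendsto_rabs tendsto_diff approx_tendsto_u D)
    then have "\<bar>A * ?m * u x - A * ?m * u x'\<bar> \<le> M * norm (x - x') powr (\<beta> + \<tau>)"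
      by (rule LIMSEQ_le_const2) (use M(2) x in blast)
    then have "A * ?m * \<bar>u x - u x'\<bar> \<le> M * norm (x - x') powr (\<beta> + \<tau>)"
      unfolding right_diff_distrib[symmetric] abs_mult[of "A * ?m"] using Am by (simp only: abs_of_pos)
    then show ?thesis using Am by (simp add: pos_le_divide_eq mult.commute)
  qed
  moreover have "0 \<le> M / (A * ?m)" using M Am by simp
  ultimately show ?thesis by blast
qed

text \<open>Two applications of \<open>u_Hoelder_gain\<close> suffice: the first starts from boundedness, that is
  \<open>\<beta> = 0\<close>, and the second already passes the exponent \<open>\<alpha>\<close>.\<close>

lemma u_Hoelder:
  assumes x0: "x0 \<in> D"
  shows "\<exists>r>0. \<exists>\<gamma>>\<alpha>. \<exists>M\<ge>0. cball x0 r \<subseteq> D \<and> (\<forall>x\<in>cball x0 r. \<bar>u x\<bar> \<le> M) \<and>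
    (\<forall>x\<in>cball x0 r. \<forall>x'\<in>cball x0 r. \<bar>u x - u x'\<bar> \<le> M * norm (x - x') powr \<gamma>)"
proof -
  obtain r M0 where r: "0 < r" "r \<le> 1" "cball x0 r \<subseteq> D" and M0: "0 \<le> M0" "\<And>x. x \<in> cball x0 r \<Longrightarrow> \<bar>u x\<bar> \<le> M0"
    using u_bounded_near[OF x0] by blast
  have Q: "0 \<le> Q" using q_le[OF x0] by linarith
  have gb: "\<bar>g y\<bar> \<le> M0 * Q" if "y \<in> cball x0 r" for y
  proof -
    have "y \<in> D" using that r by auto
    then have "\<bar>g y\<bar> = \<bar>u y\<bar> * \<bar>q y\<bar>" by (simp add: g_eq abs_mult)
    also have "\<dots> \<le> M0 * Q" using M0 that q_le[OF \<open>y \<in> D\<close>] by (intro mult_mono) auto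
    finally show ?thesis .
  qed
  \<comment> \<open>Order 0 means bounded oscillation. As \<open>0 powr 0 = 0\<close>, equal points
    are treated apart.\<close>
  have g0: "\<bar>g y - g y'\<bar> \<le> 2 * (M0 * Q) * norm (y - y') powr 0" if "y \<in> cball x0 r" "y' \<in> cball x0 r" for y y'
    using gb[OF that(1)] gb[OF that(2)] by (cases "y = y'") auto
  have "\<exists>M\<ge>0. \<forall>x\<in>cball x0 (r / 4). \<forall>x'\<in>cball x0 (r / 4). \<bar>u x - u x'\<bar> \<le> M * norm (x - x') powr (0 + \<alpha> / 2)"
    by (rule u_Hoelder_gain[OF r _ _ g0]) (use M0 Q \<alpha> in auto)
  then obtain M1 where M1: "0 \<le> M1"
    "\<And>x x'. x \<in> cball x0 (r / 4) \<Longrightarrow> x' \<in> cball x0 (r / 4) \<Longrightarrow> \<bar>u x - u x'\<bar> \<le> M1 * norm (x - x') powr (\<alpha> / 2)"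
    by auto
  define r1 where "r1 = r / 4"
  have r1: "0 < r1" "r1 \<le> 1 / 4" "r1 \<le> 1" using r by (auto simp: r1_def)
  have sub1: "cball x0 r1 \<subseteq> cball x0 r" using r by (intro subset_cball) (simp add: r1_def)
  then have D1: "cball x0 r1 \<subseteq> D" using r by auto
  \<comment> \<open>The product u q inherits the smaller of the orders \<alpha>/2 and \<eta>. The
    cap 1 - \<alpha> leaves room for the next gain, since the total order must not exceed 1.\<close>
  define \<beta> where "\<beta> = min (min (\<alpha> / 2) \<eta>) (1 - \<alpha>)"
  have \<beta>: "0 < \<beta>" "\<beta> \<le> \<alpha> / 2" "\<beta> \<le> \<eta>" "\<beta> \<le> 1 - \<alpha>" using \<alpha> \<eta> by (auto simp: \<beta>_def min_def)
  have g1: "\<bar>g y - g y'\<bar> \<le> (M1 * Q + M0 * H) * norm (y - y') powr \<beta>" if y: "y \<in> cball x0 r1" "y' \<in> cball x0 r1" for y y'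
  proof -
    have D: "y \<in> D" "y' \<in> D" using y D1 by auto
    have n: "norm (y - y') \<le> 1"
      using y r1 dist_triangle2[of y y' x0] by (simp add: dist_norm norm_minus_commute)
    have "g y - g y' = (u y - u y') * q y + u y' * (q y - q y')"
      using D by (simp add: g_eq algebra_simps)
    then have "\<bar>g y - g y'\<bar> \<le> \<bar>u y - u y'\<bar> * \<bar>q y\<bar> + \<bar>u y'\<bar> * \<bar>q y - q y'\<bar>"
      by (metis abs_mult abs_triangle_ineq)
    also have "\<dots> \<le> (M1 * norm (y - y') powr (\<alpha> / 2)) * Q + M0 * (H * norm (y - y') powr \<eta>)"
      using y sub1 M1 M0 q_le D q_Hoelder
      by (intro add_mono mult_mono) (auto simp: r1_def)
    also have "\<dots> \<le> (M1 * norm (y - y') powr \<beta>) * Q + M0 * (H * norm (y - y') powr \<beta>)"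
      using \<beta> n M1 M0 Q H by (intro add_mono mult_right_mono mult_left_mono powr_mono') auto
    finally show ?thesis by (simp add: algebra_simps)
  qed
  \<comment> \<open>The gain \<tau> = \<alpha> - \<beta>/2 stays below \<alpha>, yet the total order
    \<alpha> + \<beta>/2 exceeds it; \<beta> + \<tau> \<le> 1 amounts to \<beta>/2 \<le> 1 -
    \<alpha>.\<close>
  have "\<exists>M\<ge>0. \<forall>x\<in>cball x0 (r1 / 4). \<forall>x'\<in>cball x0 (r1 / 4). \<bar>u x - u x'\<bar> \<le> M * norm (x - x') powr (\<beta> + (\<alpha> - \<beta> / 2))"
  proof (rule u_Hoelder_gain[OF r1(1,3) D1 _ _ g1])
    show "0 \<le> M1 * Q + M0 * H" using M1 M0 Q H by simp
  qed (use \<beta> \<alpha> in auto)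
  then obtain M2 where M2: "0 \<le> M2"
    "\<And>x x'. x \<in> cball x0 (r1 / 4) \<Longrightarrow> x' \<in> cball x0 (r1 / 4) \<Longrightarrow> \<bar>u x - u x'\<bar> \<le> M2 * norm (x - x') powr (\<beta> + (\<alpha> - \<beta> / 2))"
    by blast
  have sub2: "cball x0 (r1 / 4) \<subseteq> cball x0 r1" using r1 by (intro subset_cball) simp
  show ?thesis
  proof (intro exI conjI ballI)
    show "0 < r1 / 4" using r1 by simp
    show "\<alpha> < \<beta> + (\<alpha> - \<beta> / 2)" using \<beta> by simp
    show "0 \<le> max M0 M2" using M0 by simp
    show "cball x0 (r1 / 4) \<subseteq> D" using sub2 D1 by auto
    show "\<bar>u x\<bar> \<le> max M0 M2" if "x \<in> cball x0 (r1 / 4)" for x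
    proof -
      have "x \<in> cball x0 r" using that sub1 sub2 by blast
      from M0(2)[OF this] show ?thesis by simp
    qed
    show "\<bar>u x - u x'\<bar> \<le> max M0 M2 * norm (x - x') powr (\<beta> + (\<alpha> - \<beta> / 2))"
      if "x \<in> cball x0 (r1 / 4)" "x' \<in> cball x0 (r1 / 4)" for x x'
      using M2(2)[OF that] by (rule order_trans) (intro mult_right_mono, auto)
  qed
qed

lemma continuous_on_u: "continuous_on D u"
proof (rule continuous_at_imp_continuous_on, rule ballI)
  fix x assume "x \<in> D"
  then obtain r \<gamma> M where r: "0 < r" "\<alpha> < \<gamma>" and M: "\<And>x'. x' \<in> cball x r \<Longrightarrow> \<bar>u x' - u x\<bar> \<le> M * norm (x' - x) powr \<gamma>"
    using u_Hoelder[of x] by fastforce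
  have \<gamma>: "0 < \<gamma>" using r \<alpha> by simp
  have "((\<lambda>x'. u x' - u x) \<longlongrightarrow> 0) (at x)"
  proof (rule Lim_null_comparison)
    have "eventually (\<lambda>x'. x' \<in> cball x r) (at x)"
      using r eventually_at_ball[of r x UNIV] by (auto elim!: eventually_mono)
    then show "eventually (\<lambda>x'. norm (u x' - u x) \<le> M * norm (x' - x) powr \<gamma>) (at x)"
      by eventually_elim (use M in simp)
    have "((\<lambda>x'. norm (x' - x)) \<longlongrightarrow> norm (x - x)) (at x)" by (intro tendsto_intros)
    then have "((\<lambda>x'. norm (x' - x) powr \<gamma>) \<longlongrightarrow> 0) (at x)"
      using \<gamma> by (intro tendsto_zero_powrI[where b=\<gamma>]) auto
    then show "((\<lambda>x'. M * norm (x' - x) powr \<gamma>) \<longlongrightarrow> 0) (at x)"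
      by (rule tendsto_mult_right_zero)
  qed
  then show "isCont u x" unfolding isCont_def by (subst Lim_null)
qed

text \<open>Near \<open>x\<close> the order \<gamma> > \<alpha> leaves the integrable singularity |y
  - x|^(\<gamma>-d-\<alpha>). Away from \<open>x\<close> the kernel is comparable to the weight with
  which \<open>u\<close> is integrable.\<close>

lemma jump_integrable_u:
  assumes "x \<in> D"
  shows "jump_integrable \<alpha> u x"
proof -
  let ?p = "real DIM('a) + \<alpha>"
  obtain r \<gamma> M where r: "0 < r" "\<alpha> < \<gamma>" "0 \<le> M" and M: "\<And>x'. x' \<in> cball x r \<Longrightarrow> \<bar>u x' - u x\<bar> \<le> M * norm (x' - x) powr \<gamma>"
    using u_Hoelder[OF assms] by fastforce
  let ?near = "\<lambda>y. norm (y - x) powr (-(?p - \<gamma>)) * indicator (cball x r) y"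
  let ?far = "\<lambda>y. norm (y - x) powr (-?p) * indicator {y. r \<le> norm (y - x)} y"
  define c where "c = ((1 + r) / r) powr ?p * (1 + norm x) powr ?p"
  have far_le: "?far y \<le> c * decay \<alpha> y" for y
  proof (cases "r \<le> norm (y - x)")
    case True
    have "norm (y - x) powr (-?p) \<le> ((1 + r) / r) powr ?p * decay \<alpha> (y - x)"
      by (rule norm_powr_le_decay[OF \<alpha> True r(1)])
    also have "decay \<alpha> (y - x) = decay \<alpha> (x - y)" by (simp add: decay_def norm_minus_commute)
    also have "\<dots> \<le> (1 + norm x) powr ?p * decay \<alpha> y" by (rule decay_diff_le[OF \<alpha>(1)])
    finally show ?thesis using True by (simp add: c_def mult.assoc mult_left_mono)
  qed (use decay_pos[of \<alpha> y] in \<open>simp add: c_def\<close>)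
  have i1: "integrable lborel (\<lambda>y. M * ?near y)"
    using r by (intro integrable_mult_right integrable_norm_powr_cball) auto
  have i2: "integrable lborel (\<lambda>y. u y * ?far y)"
    by (rule u_mult_integrable[OF _ order_trans[OF _ far_le]]) (auto simp: indicator_def)
  have i3: "integrable lborel (\<lambda>y. \<bar>u x\<bar> * ?far y)"
    using \<alpha> r by (intro integrable_mult_right integrable_norm_powr_outside) auto
  show ?thesis
    unfolding jump_integrable_def
  proof (rule Bochner_Integration.integrable_bound)
    show "integrable lborel (\<lambda>y. M * ?near y + (\<bar>u y * ?far y\<bar> + \<bar>u x\<bar> * ?far y))"
      by (intro Bochner_Integration.integrable_add integrable_abs i1 i2 i3)
    show "AE y in lborel. norm ((u y - u x) / norm (y - x) powr ?p) \<le> norm (M * ?near y + (\<bar>u y * ?far y\<bar> + \<bar>u x\<bar> * ?far y))"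
    proof (intro AE_I2)
      fix y
      have nn: "0 \<le> M * ?near y" "0 \<le> \<bar>u x\<bar> * ?far y" using r by auto
      have "\<bar>u y - u x\<bar> * norm (y - x) powr (-?p) \<le> M * ?near y + (\<bar>u y * ?far y\<bar> + \<bar>u x\<bar> * ?far y)"
      proof (cases "y \<in> cball x r")
        case True
        have "\<bar>u y - u x\<bar> * norm (y - x) powr (-?p) \<le> (M * norm (y - x) powr \<gamma>) * norm (y - x) powr (-?p)"
          by (intro mult_right_mono M True) auto
        also have "\<dots> = M * ?near y" using True by (simp add: mult.assoc powr_add[symmetric] algebra_simps)
        finally show ?thesis using nn by linarith
      next
        case False
        have "\<bar>u y - u x\<bar> * norm (y - x) powr (-?p) \<le> (\<bar>u y\<bar> + \<bar>u x\<bar>) * norm (y - x) powr (-?p)"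
          by (intro mult_right_mono abs_triangle_ineq4) auto
        also have "\<dots> = \<bar>u y * ?far y\<bar> + \<bar>u x\<bar> * ?far y"
          using False by (simp add: dist_norm norm_minus_commute abs_mult distrib_right)
        finally show ?thesis using nn by linarith
      qed
      then have "norm ((u y - u x) / norm (y - x) powr ?p) \<le> M * ?near y + (\<bar>u y * ?far y\<bar> + \<bar>u x\<bar> * ?far y)"
        unfolding powr_minus real_norm_def abs_divide by (simp only: divide_inverse abs_of_nonneg[OF powr_ge_zero])
      also have "\<dots> \<le> norm (M * ?near y + (\<bar>u y * ?far y\<bar> + \<bar>u x\<bar> * ?far y))"
        unfolding real_norm_def by (rule abs_ge_self)
      finally show "norm ((u y - u x) / norm (y - x) powr ?p) \<le> norm (M * ?near y + (\<bar>u y * ?far y\<bar> + \<bar>u x\<bar> * ?far y))" .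
    qed
  qed measurable
qed

text \<open>The weak formulation with the test function \<open>bump (s *\<^sub>R (x - y))\<close>, multiplied by
  \<open>s ^ DIM('a)\<close>, tends to the equation at \<open>x\<close>, because \<open>s powr (DIM('a) + \<alpha>) * bump_jump \<alpha> (s *\<^sub>R z)\<close>
  tends to a multiple of the jump kernel at \<open>z\<close>.\<close>

lemma jump_int_u:
  assumes x: "x \<in> D"
  shows "A * jump_int \<alpha> u x = - (q x * u x)"
proof -
  let ?p = "real DIM('a) + \<alpha>" and ?d = "DIM('a)" and ?m = "bump_mass TYPE('a)"
  obtain r \<gamma> M where r: "0 < r" "cball x r \<subseteq> D" and M: "\<And>y. y \<in> cball x r \<Longrightarrow> \<bar>u y\<bar> \<le> M"
    using u_Hoelder[OF x] by blast
  \<comment> \<open>From this scale on, the bumps around \<open>x\<close> are supported in the ball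
    on which \<open>u\<close> is bounded.\<close>
  obtain N :: nat where N: "1 / r \<le> real N" using real_arch_simple by blast
  let ?S = "\<lambda>n. real (Suc (n + N))"
  have S: "0 < ?S n" "1 / ?S n \<le> r" for n
  proof -
    have "1 / r \<le> ?S n" using N by simp
    then show "1 / ?S n \<le> r" using r by (simp add: field_simps)
  qed simp
  obtain C where C: "0 < C" "\<And>x::'a. \<bar>bump_jump \<alpha> x\<bar> \<le> C * decay \<alpha> x"
    using bump_jump_decay[OF \<alpha>] by blast
  let ?j = "\<lambda>n z. ?S n powr ?p * bump_jump \<alpha> (?S n *\<^sub>R z)"
  \<comment> \<open>The powers of the scale cancel in S^p (S |z|)^(-p), so the jump kernel dominates
    for all \<open>n\<close>, and the absolutely convergent jump integral of \<open>u\<close>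
    becomes the majorant.\<close>
  have jle: "\<bar>?j n z\<bar> \<le> C / norm z powr ?p" if "z \<noteq> 0" for n and z :: 'a
  proof -
    have Sz: "?S n *\<^sub>R z \<noteq> 0" using that by simp
    have "\<bar>?j n z\<bar> = ?S n powr ?p * \<bar>bump_jump \<alpha> (?S n *\<^sub>R z)\<bar>" by (simp only: abs_mult abs_of_nonneg[OF powr_ge_zero])
    also have "\<dots> \<le> ?S n powr ?p * (C * norm (?S n *\<^sub>R z) powr (-?p))"
      using order_trans[OF C(2) mult_left_mono[OF decay_le_powr[OF \<alpha> Sz]]] C(1) by (intro mult_left_mono) auto
    also have "norm (?S n *\<^sub>R z) = ?S n * norm z" unfolding norm_scaleR abs_of_nat ..
    also have "?S n powr ?p * (C * (?S n * norm z) powr (-?p)) = C * (?S n powr ?p * ?S n powr (-?p)) * norm z powr (-?p)"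
      by (simp only: powr_mult mult_ac)
    also have "?S n powr ?p * ?S n powr (-?p) = 1" using S(1)[of n] by (simp only: powr_add[symmetric]) simp
    finally show ?thesis by (simp only: powr_minus_divide) simp
  qed
  let ?J = "\<lambda>y. (u y - u x) / norm (y - x) powr ?p"
  have intJ: "integrable lborel ?J" using jump_integrable_u[OF x] by (simp add: jump_integrable_def)
  have L: "(\<lambda>n. LINT y|lborel. (u y - u x) * ?j n (x - y)) \<longlonglongrightarrow> (LINT y|lborel. ?m * ?J y)"
  proof (rule integral_dominated_convergence)
    show "integrable lborel (\<lambda>y. C * \<bar>?J y\<bar>)" using intJ by (intro integrable_mult_right integrable_abs)
    show "AE y in lborel. (\<lambda>n. (u y - u x) * ?j n (x - y)) \<longlonglongrightarrow> ?m * ?J y"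
      using AE_lborel_singleton[of x]
    proof eventually_elim
      case (elim y)
      then have "x - y \<noteq> 0" by simp
      from LIMSEQ_ignore_initial_segment[OF scaled_bump_jump_tendsto[OF \<alpha> this], of N]
      have "(\<lambda>n. ?j n (x - y)) \<longlonglongrightarrow> ?m / norm (x - y) powr ?p" by simp
      then have "(\<lambda>n. (u y - u x) * ?j n (x - y)) \<longlonglongrightarrow> (u y - u x) * (?m / norm (x - y) powr ?p)"
        by (rule tendsto_mult_left)
      then show ?case by (simp add: norm_minus_commute mult.commute)
    qed
    show "AE y in lborel. norm ((u y - u x) * ?j n (x - y)) \<le> C * \<bar>?J y\<bar>" for n
      using AE_lborel_singleton[of x]
    proof eventually_elim
      case (elim y)
      then have "x - y \<noteq> 0" by simp
      from mult_left_mono[OF jle[OF this] abs_ge_zero[of "u y - u x"], of n]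
      have "\<bar>u y - u x\<bar> * \<bar>?j n (x - y)\<bar> \<le> \<bar>u y - u x\<bar> * (C / norm (x - y) powr ?p)" .
      also have "\<dots> = C * \<bar>?J y\<bar>" by (simp add: abs_divide norm_minus_commute)
      finally show ?case by (simp only: real_norm_def abs_mult)
    qed
  qed measurable
  let ?h = "\<lambda>y. indicator (cball x r) y * g y"
  have [measurable]: "?h \<in> borel_measurable borel" using g_integrable[OF compact_cball r(2)] by auto
  have Q: "0 \<le> Q" using q_le[OF x] by linarith
  have gM: "\<bar>?h y\<bar> \<le> M * Q" for y
  proof (cases "y \<in> cball x r")
    case True
    then have "y \<in> D" using r by auto
    moreover have "0 \<le> M" using M[OF True] by linarith
    ultimately show ?thesis
      using True M[OF True] q_le[of y] by (simp add: g_eq abs_mult mult_mono)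
  next
    case False
    have "0 \<le> M" using M[of x] r by simp
    then show ?thesis using False Q by simp
  qed
  have contq: "isCont q x"
  proof -
    have "((\<lambda>y. q y - q x) \<longlongrightarrow> 0) (at x)"
    proof (rule Lim_null_comparison)
      have "eventually (\<lambda>y. y \<in> D) (at x)"
        using open_D x by (rule eventually_at_in_open')
      then show "eventually (\<lambda>y. norm (q y - q x) \<le> H * norm (y - x) powr \<eta>) (at x)"
        by eventually_elim (use q_Hoelder x in simp)
      have "((\<lambda>y. norm (y - x)) \<longlongrightarrow> norm (x - x)) (at x)" by (intro tendsto_intros)
      then have "((\<lambda>y. norm (y - x) powr \<eta>) \<longlongrightarrow> 0) (at x)"
        using \<eta> by (intro tendsto_zero_powrI[where b=\<eta>]) auto
      then show "((\<lambda>y. H * norm (y - x) powr \<eta>) \<longlongrightarrow> 0) (at x)"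
        by (rule tendsto_mult_right_zero)
    qed
    then show ?thesis unfolding isCont_def by (subst Lim_null)
  qed
  have contu: "isCont u x"
    using continuous_on_u open_D x by (simp add: continuous_on_eq_continuous_at)
  \<comment> \<open>Mollification of u q at a point of continuity; \<open>M * Q\<close> bounds the
    values of u q that occur.\<close>
  have G: "(\<lambda>n. LINT w|lborel. ?h (x - (1 / ?S n) *\<^sub>R w) * bump w) \<longlonglongrightarrow> (LINT w|lborel. (u x * q x) * bump (w::'a))"
  proof (rule integral_dominated_convergence)
    show "integrable lborel (\<lambda>w::'a. M * Q * bump w)" by (intro integrable_mult_right integrable_bump)
    show "AE w in lborel. (\<lambda>n. ?h (x - (1 / ?S n) *\<^sub>R w) * bump w) \<longlonglongrightarrow> (u x * q x) * bump w"
    proof (intro AE_I2)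
      fix w :: 'a
      have "(\<lambda>n. 1 / real (Suc n)) \<longlonglongrightarrow> 0" by (intro LIMSEQ_Suc lim_1_over_n)
      then have "(\<lambda>n. 1 / ?S n) \<longlonglongrightarrow> 0" using LIMSEQ_ignore_initial_segment[of "\<lambda>n. 1 / real (Suc n)" 0 N] by simp
      then have "(\<lambda>n. x - (1 / ?S n) *\<^sub>R w) \<longlonglongrightarrow> x - 0 *\<^sub>R w" by (intro tendsto_intros)
      then have l: "(\<lambda>n. x - (1 / ?S n) *\<^sub>R w) \<longlonglongrightarrow> x" by simp
      have "eventually (\<lambda>n. x - (1 / ?S n) *\<^sub>R w \<in> ball x r) sequentially"
        using l r by (intro topological_tendstoD[OF l]) auto
      then have "eventually (\<lambda>n. u (x - (1 / ?S n) *\<^sub>R w) * q (x - (1 / ?S n) *\<^sub>R w) = ?h (x - (1 / ?S n) *\<^sub>R w)) sequentially"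
      proof eventually_elim
        case (elim n)
        then have "x - (1 / ?S n) *\<^sub>R w \<in> cball x r" using ball_subset_cball by blast
        then show ?case using r g_eq by (simp add: subset_iff)
      qed
      moreover have "(\<lambda>n. u (x - (1 / ?S n) *\<^sub>R w) * q (x - (1 / ?S n) *\<^sub>R w)) \<longlonglongrightarrow> u x * q x"
        using isCont_tendsto_compose[OF contu l] isCont_tendsto_compose[OF contq l] by (rule tendsto_mult)
      ultimately have "(\<lambda>n. ?h (x - (1 / ?S n) *\<^sub>R w)) \<longlonglongrightarrow> u x * q x"
        by (rule Lim_transform_eventually[rotated])
      then show "(\<lambda>n. ?h (x - (1 / ?S n) *\<^sub>R w) * bump w) \<longlonglongrightarrow> (u x * q x) * bump w"
        by (rule tendsto_mult_right)
    qed
    show "AE w in lborel. norm (?h (x - (1 / ?S n) *\<^sub>R w) * bump w) \<le> M * Q * bump w" for n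
      using mult_right_mono[OF gM bump_nonneg]
      by (intro AE_I2) (simp only: real_norm_def abs_mult abs_of_nonneg[OF bump_nonneg])
  qed measurable
  have eq: "A * (LINT y|lborel. (u y - u x) * ?j n (x - y)) = - (LINT w|lborel. ?h (x - (1 / ?S n) *\<^sub>R w) * bump w)" for n
  proof -
    let ?s = "?S n"
    have s: "0 < ?s" "?s \<noteq> 0" using S(1)[of n] by auto
    have cb: "cball x (1 / ?s) \<subseteq> cball x r" using S(2)[of n] by (rule subset_cball)
    \<comment> \<open>The vanishing total integral of \<open>bump_jump\<close> allows
      \<open>u x\<close> to be subtracted from \<open>u y\<close>, which produces the jump of
      \<open>u\<close> in the limit.\<close>
    have bj0: "(LINT y|lborel. bump_jump \<alpha> (?s *\<^sub>R (x - y))) = 0"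
      and bji: "integrable lborel (\<lambda>y. bump_jump \<alpha> (?s *\<^sub>R (x - y)))"
    proof -
      have "(LINT y|lborel. bump_jump \<alpha> (?s *\<^sub>R (x - y))) = (LINT y|lborel. bump_jump \<alpha> (?s *\<^sub>R (y::'a)))"
        by (rule integral_lborel_minus[of "\<lambda>y. bump_jump \<alpha> (?s *\<^sub>R y)"])
      moreover have "0 = ?s ^ ?d * (LINT y|lborel. bump_jump \<alpha> (?s *\<^sub>R (y::'a)))"
        using integral_affine_euclidean[OF s(2), of "bump_jump \<alpha>" "0::'a"] integral_bump_jump[OF \<alpha>, where 'a='a] s by simp
      ultimately show "(LINT y|lborel. bump_jump \<alpha> (?s *\<^sub>R (x - y))) = 0" using s by simp
      have "integrable lborel (\<lambda>y::'a. bump_jump \<alpha> (?s *\<^sub>R y))"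
        using integrable_affine_euclidean[OF integrable_bump_jump[OF \<alpha>] s(2), of 0] by simp
      then show "integrable lborel (\<lambda>y. bump_jump \<alpha> (?s *\<^sub>R (x - y)))"
        using integrable_lborel_minus_iff[of "\<lambda>y. bump_jump \<alpha> (?s *\<^sub>R y)" x] by simp
    qed
    have pw: "?s powr ?p = ?s ^ ?d * ?s powr \<alpha>" using s by (simp only: powr_add powr_realpow)
    have "(LINT y|lborel. (u y - u x) * ?j n (x - y)) =
      (LINT y|lborel. ?s powr ?p * (u y * bump_jump \<alpha> (?s *\<^sub>R (x - y)) - u x * bump_jump \<alpha> (?s *\<^sub>R (x - y))))"
      by (intro Bochner_Integration.integral_cong refl) (simp only: left_diff_distrib right_diff_distrib mult_ac)
    also have "\<dots> = ?s powr ?p * (LINT y|lborel. u y * bump_jump \<alpha> (?s *\<^sub>R (x - y)) - u x * bump_jump \<alpha> (?s *\<^sub>R (x - y)))"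
      by (rule integral_mult_right_zero)
    also have "(LINT y|lborel. u y * bump_jump \<alpha> (?s *\<^sub>R (x - y)) - u x * bump_jump \<alpha> (?s *\<^sub>R (x - y))) =
      (LINT y|lborel. u y * bump_jump \<alpha> (?s *\<^sub>R (x - y))) - (LINT y|lborel. u x * bump_jump \<alpha> (?s *\<^sub>R (x - y)))"
      by (intro Bochner_Integration.integral_diff integrable_u_bump_jump integrable_mult_right bji s)
    also have "(LINT y|lborel. u x * bump_jump \<alpha> (?s *\<^sub>R (x - y))) = 0"
      by (subst integral_mult_right_zero) (simp only: bj0 mult_zero_right)
    finally have "A * (LINT y|lborel. (u y - u x) * ?j n (x - y)) = ?s powr ?p * (A * (LINT y|lborel. u y * bump_jump \<alpha> (?s *\<^sub>R (x - y))))"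
      by (simp only: diff_zero mult_ac)
    also have "?s powr ?p * (A * (LINT y|lborel. u y * bump_jump \<alpha> (?s *\<^sub>R (x - y)))) =
      ?s ^ ?d * (A * ?s powr \<alpha> * (LINT y|lborel. u y * bump_jump \<alpha> (?s *\<^sub>R (x - y))))"
      by (simp only: pw mult_ac)
    also have "\<dots> = - (?s ^ ?d * (LINT y|lborel. g y * bump (?s *\<^sub>R (x - y))))"
      using cb r(2) by (subst weak[OF s(1)]) auto
    also have "(LINT y|lborel. g y * bump (?s *\<^sub>R (x - y))) = (LINT y|lborel. ?h y * bump (?s *\<^sub>R (x - y)))"
      by (intro Bochner_Integration.integral_cong refl g_bump_restrict s cb)
    also have "\<dots> = \<bar>- 1 / ?s\<bar> ^ ?d * (LINT w|lborel. ?h (x + (- 1 / ?s) *\<^sub>R w) * bump (?s *\<^sub>R (x - (x + (- 1 / ?s) *\<^sub>R w))))"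
      using s by (intro integral_affine_euclidean) auto
    also have "(\<lambda>w. ?h (x + (- 1 / ?s) *\<^sub>R w) * bump (?s *\<^sub>R (x - (x + (- 1 / ?s) *\<^sub>R w)))) = (\<lambda>w. ?h (x - (1 / ?s) *\<^sub>R w) * bump w)"
    proof
      fix w :: 'a
      have "?s *\<^sub>R (x - (x + (- 1 / ?s) *\<^sub>R w)) = w" using s by simp
      moreover have "x + (- 1 / ?s) *\<^sub>R w = x - (1 / ?s) *\<^sub>R w" by simp
      ultimately show "?h (x + (- 1 / ?s) *\<^sub>R w) * bump (?s *\<^sub>R (x - (x + (- 1 / ?s) *\<^sub>R w))) = ?h (x - (1 / ?s) *\<^sub>R w) * bump w"
        by (simp only:)
    qed
    also have "\<bar>- 1 / ?s\<bar> ^ ?d = 1 / ?s ^ ?d" using s by (simp add: power_one_over)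
    finally show ?thesis using s by simp
  qed
  have "(\<lambda>n. A * (LINT y|lborel. (u y - u x) * ?j n (x - y))) \<longlonglongrightarrow> A * (LINT y|lborel. ?m * ?J y)"
    by (rule tendsto_mult_left[OF L])
  moreover have "(\<lambda>n. A * (LINT y|lborel. (u y - u x) * ?j n (x - y))) \<longlonglongrightarrow> - (LINT w|lborel. (u x * q x) * bump (w::'a))"
    unfolding eq by (rule tendsto_minus[OF G])
  ultimately have "A * (LINT y|lborel. ?m * ?J y) = - (LINT w|lborel. (u x * q x) * bump (w::'a))"
    by (rule LIMSEQ_unique)
  also have "(LINT w|lborel. (u x * q x) * bump (w::'a)) = u x * q x * ?m"
    unfolding bump_mass_def by (rule integral_mult_right_zero)
  also have "(LINT y|lborel. ?m * ?J y) = ?m * jump_int \<alpha> u x"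
    unfolding jump_int_def by (rule integral_mult_right_zero)
  finally have "?m * (A * jump_int \<alpha> u x) = ?m * (- (q x * u x))" by (simp add: mult_ac)
  then show ?thesis using bump_mass_pos[where 'a='a] by (metis mult_left_cancel less_irrefl)
qed

end

subsection \<open>From weak to strong solutions\<close>

lemma holder_continuous_on_imp_continuous_on:
  assumes "holder_continuous_on \<eta> D q"
  shows "continuous_on D q"
proof -
  obtain C where \<eta>: "0 < \<eta>" and C: "\<And>x y. x \<in> D \<Longrightarrow> y \<in> D \<Longrightarrow> \<bar>q x - q y\<bar> \<le> C * dist x y powr \<eta>"
    using assms by (auto simp: holder_continuous_on_def)
  show ?thesis
    unfolding continuous_on_def
  proof
    fix x assume x: "x \<in> D"
    have "((\<lambda>y. q y - q x) \<longlongrightarrow> 0) (at x within D)"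
    proof (rule Lim_null_comparison)
      show "eventually (\<lambda>y. norm (q y - q x) \<le> C * dist y x powr \<eta>) (at x within D)"
        using C x by (auto simp: eventually_at_filter)
      have "((\<lambda>y. dist y x) \<longlongrightarrow> dist x x) (at x within D)" by (intro tendsto_intros)
      then have "((\<lambda>y. dist y x powr \<eta>) \<longlongrightarrow> 0) (at x within D)"
        using \<eta> by (intro tendsto_zero_powrI[where b=\<eta>]) auto
      then show "((\<lambda>y. C * dist y x powr \<eta>) \<longlongrightarrow> 0) (at x within D)"
        by (rule tendsto_mult_right_zero)
    qed
    then show "(q \<longlongrightarrow> q x) (at x within D)" by (subst Lim_null)
  qed
qed

lemma holder_continuous_on_bounded:
  assumes "holder_continuous_on \<eta> D q" "bounded D"
  shows "\<exists>Q\<ge>0. \<forall>x\<in>D. \<bar>q x\<bar> \<le> Q"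
proof (cases "D = {}")
  case False
  then obtain x0 where x0: "x0 \<in> D" by blast
  obtain C where \<eta>: "0 < \<eta>" and C: "\<And>x y. x \<in> D \<Longrightarrow> y \<in> D \<Longrightarrow> \<bar>q x - q y\<bar> \<le> C * dist x y powr \<eta>"
    using assms by (auto simp: holder_continuous_on_def)
  obtain e where e: "\<And>x. x \<in> D \<Longrightarrow> dist x0 x \<le> e"
    using assms(2) bounded_any_center[of D x0] by auto
  have "\<bar>q x\<bar> \<le> \<bar>q x0\<bar> + \<bar>C\<bar> * \<bar>e\<bar> powr \<eta>" if x: "x \<in> D" for x
  proof -
    have "\<bar>q x - q x0\<bar> \<le> C * dist x x0 powr \<eta>" by (rule C[OF x x0])
    also have "\<dots> \<le> \<bar>C\<bar> * dist x x0 powr \<eta>" by (intro mult_right_mono) auto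
    also have "\<dots> \<le> \<bar>C\<bar> * \<bar>e\<bar> powr \<eta>"
      using e[OF x] \<eta> by (intro mult_left_mono powr_mono2) (auto simp: dist_commute)
    finally show ?thesis by linarith
  qed
  then show ?thesis by (intro exI[of _ "\<bar>q x0\<bar> + \<bar>C\<bar> * \<bar>e\<bar> powr \<eta>"]) auto
qed auto

text \<open>The scaled bump is an admissible test function with an explicit fractional Laplacian.
  Splitting the integral of the weak formulation requires each summand to be integrable by itself,
  which the auxiliary locale provides.\<close>

lemma weak_solution_imp_weak_pair:
  fixes D :: "'a::euclidean_space set"
  assumes \<alpha>: "0 < \<alpha>" "\<alpha> < 1" and D: "open D" and weak: "weak_solution \<alpha> q D u"
  shows "weak_pair \<alpha> (riesz_const DIM('a) (- \<alpha>)) D u (\<lambda>y. u y * q y)"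
proof -
  let ?A = "riesz_const DIM('a) (- \<alpha>)"
  have u: "u \<in> weighted_L1 \<alpha>" and uq: "(\<lambda>y. u y * q y) \<in> L1_loc D"
    using weak by (auto simp: weak_solution_def)
  interpret weak_pair_data \<alpha> ?A D u "\<lambda>y. u y * q y"
    by unfold_locales
      (use \<alpha> D u uq riesz_const_pos[OF \<alpha>, of "DIM('a)"] in \<open>auto simp: weighted_L1_def decay_def\<close>)
  show ?thesis
  proof
    fix x :: 'a and s :: real assume s: "0 < s" and sub: "cball x (1 / s) \<subseteq> D"
    let ?\<phi> = "\<lambda>y. bump (s *\<^sub>R (x - y))" and ?b = "\<lambda>y. bump_jump \<alpha> (s *\<^sub>R (x - y))"
    have "?\<phi> \<in> test_functions D" by (rule bump_test_function[OF s sub])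
    then have "(LINT y|lborel. u y * (frac_lap \<alpha> ?\<phi> y + q y * ?\<phi> y)) = 0"
      using weak by (auto simp: weak_solution_def)
    then have eq: "(LINT y|lborel. ?A * s powr \<alpha> * (u y * ?b y) + u y * q y * ?\<phi> y) = 0"
      unfolding frac_lap_scaled_bump[OF \<alpha> s] by (simp only: distrib_left mult_ac)
    have "(\<lambda>y. u y * q y * ?\<phi> y) = (\<lambda>y. indicator (cball x (1 / s)) y * (u y * q y) * ?\<phi> y)"
      by (intro ext g_bump_restrict s order_refl)
    then have i2: "integrable lborel (\<lambda>y. u y * q y * ?\<phi> y)"
      by (simp only: integrable_bump_mult[OF g_integrable[OF compact_cball sub]])
    have "(LINT y|lborel. ?A * s powr \<alpha> * (u y * ?b y) + u y * q y * ?\<phi> y) =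
      (LINT y|lborel. ?A * s powr \<alpha> * (u y * ?b y)) + (LINT y|lborel. u y * q y * ?\<phi> y)"
      by (intro Bochner_Integration.integral_add integrable_mult_right integrable_u_bump_jump s i2)
    also have "(LINT y|lborel. ?A * s powr \<alpha> * (u y * ?b y)) = ?A * s powr \<alpha> * (LINT y|lborel. u y * ?b y)"
      by (rule integral_mult_right_zero)
    finally show "?A * s powr \<alpha> * (LINT y|lborel. u y * ?b y) = - (LINT y|lborel. u y * q y * ?\<phi> y)"
      using eq by linarith
  qed
qed

theorem corollary1p4:
  fixes \<alpha> \<eta> :: real
    and D :: "'a::euclidean_space set"
    and q u :: "'a \<Rightarrow> real"
  assumes "0 < \<alpha>" and "\<alpha> < 1"
    and "open D" and "bounded D"
    and "\<eta> > 1 - \<alpha>" and "holder_continuous_on \<eta> D q"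
    and "(\<forall>x. 0 \<le> u x) \<or> bdd_above (range (\<lambda>x. \<bar>u x\<bar>))"
    and "weak_solution \<alpha> q D u"
  shows "\<exists>v. (AE x in lborel. v x = u x) \<and> continuous_on D v \<and> strong_solution \<alpha> q D v"
proof -
  let ?A = "riesz_const DIM('a) (- \<alpha>)"
  let ?m = "kern_mass TYPE('a) \<alpha>"
  have q_cont: "continuous_on D q" using assms(6) by (rule holder_continuous_on_imp_continuous_on)
  obtain Q where Q: "0 \<le> Q" "\<And>x. x \<in> D \<Longrightarrow> \<bar>q x\<bar> \<le> Q"
    using holder_continuous_on_bounded[OF assms(6,4)] by blast
  obtain C where \<eta>: "0 < \<eta>" and C: "\<And>x y. x \<in> D \<Longrightarrow> y \<in> D \<Longrightarrow> \<bar>q x - q y\<bar> \<le> C * dist x y powr \<eta>"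
    using assms(6) by (auto simp: holder_continuous_on_def)
  interpret U0: weak_pair \<alpha> ?A D u "\<lambda>y. u y * q y"
    by (rule weak_solution_imp_weak_pair[OF assms(1-3,8)])
  interpret U: weak_pair_bounded \<alpha> ?A D u "\<lambda>y. u y * q y" Q
  proof
    show "\<bar>u y * q y\<bar> \<le> Q * \<bar>u y\<bar>" if "y \<in> D" for y
      using mult_right_mono[OF Q(2)[OF that] abs_ge_zero[of "u y"]] by (simp add: abs_mult mult.commute)
  qed
  \<comment> \<open>On D the values depend on the class of \<open>u\<close> only, and the limit
    exists at every point there by \<open>approx_convergent\<close>. Outside D nothing is
    changed.\<close>
  define v where "v x = (if x \<in> D then lim (\<lambda>n. U0.approx n x) / ?m else u x)" for x
  have vu: "AE x in lborel. v x = u x"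
    using U.AE_approx_lim by eventually_elim (simp add: v_def)
  have [measurable]: "D \<in> sets borel" using assms(3) by simp
  have [measurable]: "U0.approx n \<in> borel_measurable borel" for n
    unfolding U0.approx_def[abs_def] by measurable
  have v_meas[measurable]: "v \<in> borel_measurable borel"
    unfolding v_def[abs_def] by measurable
  have v_int: "integrable lborel (\<lambda>x. \<bar>v x\<bar> * decay \<alpha> x)"
    using U0.u_integrable by (rule integrable_cong_AE_imp) (use vu in auto)
  have vq: "(\<lambda>y. v y * q y) \<in> L1_loc D"
    unfolding L1_loc_def
  proof (clarify, unfold set_integrable_def)
    fix K assume K: "compact K" "K \<subseteq> D"
    have [measurable]: "K \<in> sets borel" using K(1) by (simp add: borel_compact)
    \<comment> \<open>\<open>q\<close> is known on D only and may be arbitrary outside;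
      measurability comes from its continuity on the compact set \<open>K\<close>, so
      \<open>q\<close> is kept together with the indicator.\<close>
    have "(\<lambda>y. indicator K y *\<^sub>R q y) \<in> borel_measurable borel"
      using continuous_on_subset[OF q_cont K(2)] by (intro borel_measurable_continuous_on_indicator) auto
    then have m: "(\<lambda>y. v y * (indicator K y *\<^sub>R q y)) \<in> borel_measurable lborel" by measurable
    have "integrable lborel (\<lambda>y. indicator K y *\<^sub>R (u y * q y))"
      using U0.g_L1_loc K by (auto simp: L1_loc_def set_integrable_def)
    then have "integrable lborel (\<lambda>y. v y * (indicator K y *\<^sub>R q y))"
    proof (rule integrable_cong_AE_imp[OF _ m])
      show "AE y in lborel. indicator K y *\<^sub>R (u y * q y) = v y * (indicator K y *\<^sub>R q y)"
        using vu by eventually_elim simp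
    qed
    then show "integrable lborel (\<lambda>y. indicator K y *\<^sub>R (v y * q y))"
      by (simp add: mult_ac)
  qed
  have weak_v: "?A * s powr \<alpha> * (LINT y|lborel. v y * bump_jump \<alpha> (s *\<^sub>R (x - y))) = - (LINT y|lborel. v y * q y * bump (s *\<^sub>R (x - y)))"
    if s: "0 < s" and sub: "cball x (1 / s) \<subseteq> D" for x s
  proof -
    have "(LINT y|lborel. v y * bump_jump \<alpha> (s *\<^sub>R (x - y))) = (LINT y|lborel. u y * bump_jump \<alpha> (s *\<^sub>R (x - y)))"
      by (rule integral_cong_AE) (use vu in auto)
    moreover have "(LINT y|lborel. v y * q y * bump (s *\<^sub>R (x - y))) = (LINT y|lborel. u y * q y * bump (s *\<^sub>R (x - y)))"
    proof -
      let ?K = "cball x (1 / s)"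
      have restrict: "f y * q y * bump (s *\<^sub>R (x - y)) = f y * (indicator ?K y *\<^sub>R q y) * bump (s *\<^sub>R (x - y))" for f :: "'a \<Rightarrow> real" and y
        using scaled_bump_eq_0[OF s, of y x] by (cases "y \<in> ?K") auto
      have [measurable]: "(\<lambda>y. indicator ?K y *\<^sub>R q y) \<in> borel_measurable borel"
        using continuous_on_subset[OF q_cont sub] by (intro borel_measurable_continuous_on_indicator) auto
      show ?thesis
        unfolding restrict by (rule integral_cong_AE) (measurable, use vu in auto)
    qed
    ultimately show ?thesis using U0.weak[OF s sub] by simp
  qed
  interpret V0: weak_pair \<alpha> ?A D v "\<lambda>y. v y * q y"
    by unfold_locales (use assms(1-3) U0.A v_meas v_int vq weak_v in auto)
  interpret V: weak_pair_bounded \<alpha> ?A D v "\<lambda>y. v y * q y" Q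
  proof
    show "\<bar>v y * q y\<bar> \<le> Q * \<bar>v y\<bar>" if "y \<in> D" for y
      using mult_right_mono[OF Q(2)[OF that] abs_ge_zero[of "v y"]] by (simp add: abs_mult mult.commute)
  qed
  \<comment> \<open>Convolutions ignore null sets, so \<open>v\<close> has the same approximations
    as \<open>u\<close> and coincides on D with the limit of its own.\<close>
  have approx: "V0.approx n x = U0.approx n x" for n x
    unfolding V0.approx_def U0.approx_def by (rule integral_cong_AE) (use vu in auto)
  \<comment> \<open>The definition of Hoelder continuity leaves the sign of the constant open, hence
    \<open>\<bar>C\<bar>\<close>.\<close>
  interpret V': regular_pair \<alpha> ?A D v "\<lambda>y. v y * q y" Q q \<eta> "\<bar>C\<bar>"
  proof
    show "\<bar>q y - q y'\<bar> \<le> \<bar>C\<bar> * norm (y - y') powr \<eta>" if "y \<in> D" "y' \<in> D" for y y'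
      using C[OF that] mult_right_mono[OF abs_ge_self[of C], of "dist y y' powr \<eta>"] by (simp add: dist_norm)
    show "v x = lim (\<lambda>n. V0.approx n x) / ?m" if "x \<in> D" for x
      using that by (simp add: v_def approx)
  qed (use Q \<eta> in auto)
  have "strong_solution \<alpha> q D v"
    unfolding strong_solution_def
  proof (intro conjI ballI)
    show "v \<in> weighted_L1 \<alpha>" using v_int by (simp add: weighted_L1_def decay_def)
    show "(\<lambda>x. v x * q x) \<in> L1_loc D" by (rule vq)
    fix x assume x: "x \<in> D"
    show "frac_lap_exists \<alpha> v x"
      by (rule frac_lap_eq_jump_int(1)[OF V'.jump_integrable_u[OF x]])
    show "frac_lap \<alpha> v x + q x * v x = 0"
      unfolding frac_lap_eq_jump_int(2)[OF V'.jump_integrable_u[OF x]] V'.jump_int_u[OF x] by simp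
  qed
  with vu V'.continuous_on_u show ?thesis by blast
qed

end
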